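(* Let $\lambda=[\lambda_1,\dots,\lambda_p]$ be a partition of $n$, written in exponential form as $[t_1^{n_{t_1}},t_2^{n_{t_2}},\dots,t_k^{n_{t_k}}]$ with distinct parts $t_1,\dots,t_k>0$ of multiplicities $n_{t_1},\dots,n_{t_k}$, and put $\lambda_i=0$ for $p<i\le n$. Then the dimension of the minimal ad-nilpotent ideals of type $A_{n-1}$ corresponding to $\lambda$ (the smallest dimension $m_{\mathcal O_\lambda}$ of an ad-nilpotent ideal with associated orbit $\mathcal O_\lambda$) is $$m_{\mathcal O_\lambda}=\frac{n(n+1)}{2}+\sum_{i=1}^n\bigl(-A(\lambda_i-1)+A(-\lambda_i-1)\bigr)+\sum_{i=1}^k\frac{n_{t_i}(n_{t_i}-1)}{2}.$$
   Context: Let $\mathfrak g=\mathfrak{sl}_n(\mathbb C)$, $G=SL_n(\mathbb C)$, $B$ the upper triangular Borel subgroup, $\mathfrak b$ its Lie algebra, $\mathfrak n$ the strictly upper triangular matrices. An ad-nilpotent ideal is an ideal of $\mathfrak b$ contained in $\mathfrak n$; its associated orbit $\mathcal O_I$ is the unique nilpotent orbit whose closure is the image of $G\times_B I\to\mathfrak g$, $(g,x)\mapsto\mathrm{Ad}(g)x$. $\mathcal O_\lambda$ is the nilpotent orbit of Jordan type $\lambda$. For a nilpotent orbit $\mathcal O$ and $X\in\mathcal O$, $m_{\mathcal O}=\dim B-\dim B_{G_X}$, with $G_X$ the centralizer of $X$ in $G$ and $B_{G_X}$ a Borel subgroup (maximal connected solvable subgroup) of $G_X$; this equals the minimal dimension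 of ad-nilpotent ideals with associated orbit $\mathcal O$. The Dynkin element of $\mathcal O_\lambda$ is $H=\mathrm{diag}(h_1,\dots,h_n)$, $h_1\ge\dots\ge h_n$, where $(h_1,\dots,h_n)$ is the decreasing rearrangement of the multiset union over the parts $\lambda_i$ ($1\le i\le p$) of $\{\lambda_i-1,\lambda_i-3,\dots,1-\lambda_i\}$. For an integer $l$, $A(l)$ is the number of indices $j$ with $h_j\le l$. *)

theory Defs
  imports "HOL-Analysis.Analysis" "HOL-Algebra.Solvable_Groups"
begin

text \<open>
  The size is \<open>n = CARD('n)\<close>; the linear order on the index type \<open>'n\<close> gives a meaning to
  ``upper triangular''. The library makes this type a real vector space only, so complex
  scalars are added by hand.
\<close>

type_synonym 'n sqmat = "complex ^ 'n ^ 'n"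

definition cscale :: "complex \<Rightarrow> 'n::finite sqmat \<Rightarrow> 'n sqmat" where
  "cscale c A = (\<chi> i j. c * A $ i $ j)"

global_interpretation cmat: vector_space "cscale :: complex \<Rightarrow> 'n::finite sqmat \<Rightarrow> _"
  by unfold_locales (simp_all add: cscale_def vec_eq_iff algebra_simps)

definition upper_triangular :: "'n::{finite,linorder} sqmat \<Rightarrow> bool" where
  "upper_triangular A \<longleftrightarrow> (\<forall>i j. j < i \<longrightarrow> A $ i $ j = 0)"

definition strictly_upper_triangular :: "'n::{finite,linorder} sqmat \<Rightarrow> bool" where
  "strictly_upper_triangular A \<longleftrightarrow> (\<forall>i j. j \<le> i \<longrightarrow> A $ i $ j = 0)"

subsection \<open>The group \<open>SL\<^sub>n\<close>, its subgroups and their dimensions\<close>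

definition SLn :: "'n::finite sqmat monoid" where
  "SLn = \<lparr>carrier = {g. det g = 1}, mult = (\<lambda>g h. g ** h), one = mat 1\<rparr>"

definition Borel :: "'n::{finite,linorder} sqmat set" where
  "Borel = {g \<in> carrier SLn. upper_triangular g}"

definition Ad :: "'n::finite sqmat \<Rightarrow> 'n sqmat \<Rightarrow> 'n sqmat" where
  "Ad g x = g ** x ** matrix_inv g"

definition centralizer :: "'n::finite sqmat \<Rightarrow> 'n sqmat set" where
  "centralizer X = {g \<in> carrier SLn. Ad g X = X}"

text \<open>
  The dimension of an algebraic subgroup is the complex dimension of its Lie algebra, the
  latter being the space of velocities at the identity of curves in the subgroup.
\<close>

definition lie_algebra :: "'n::finite sqmat set \<Rightarrow> 'n sqmat set" where
  "lie_algebra H = {v. \<exists>\<gamma> :: real \<Rightarrow> 'n sqmat.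
     (\<forall>t. \<gamma> t \<in> H) \<and> \<gamma> 0 = mat 1 \<and> (\<gamma> has_vector_derivative v) (at 0)}"

definition group_dim :: "'n::finite sqmat set \<Rightarrow> nat" where
  "group_dim H = cmat.dim (lie_algebra H)"

text \<open>
  Connectedness below refers to the Euclidean topology. This yields the Borel subgroups in the
  sense of algebraic groups: if \<open>H\<close> is Euclidean-connected and solvable, then its Zariski
  closure is solvable and Zariski-connected, hence Euclidean-connected, so that a maximal
  \<open>H\<close> is Zariski-closed.
\<close>

definition connected_solvable_subgroup ::
    "'n::finite sqmat set \<Rightarrow> 'n sqmat set \<Rightarrow> bool" where
  "connected_solvable_subgroup H K \<longleftrightarrow>
     subgroup H SLn \<and> H \<subseteq> K \<and> connected H \<and> solvable (SLn\<lparr>carrier := H\<rparr>)"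

definition borel_subgroup_of ::
    "'n::finite sqmat set \<Rightarrow> 'n sqmat set \<Rightarrow> bool" where
  "borel_subgroup_of H K \<longleftrightarrow> connected_solvable_subgroup H K \<and>
     (\<forall>H'. connected_solvable_subgroup H' K \<and> H \<subseteq> H' \<longrightarrow> H' = H)"

subsection \<open>Ad-nilpotent ideals and nilpotent orbits\<close>

definition borel_algebra :: "'n::{finite,linorder} sqmat set" where
  "borel_algebra = {b. trace b = 0 \<and> upper_triangular b}"

definition ad_nilpotent_ideal :: "'n::{finite,linorder} sqmat set \<Rightarrow> bool" where
  "ad_nilpotent_ideal I \<longleftrightarrow> cmat.subspace I \<and> I \<subseteq> Collect strictly_upper_triangular \<and>
     (\<forall>b \<in> borel_algebra. \<forall>x \<in> I. b ** x - x ** b \<in> I)"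

definition nilpotent_mat :: "'n::finite sqmat \<Rightarrow> bool" where
  "nilpotent_mat X \<longleftrightarrow> (\<exists>k::nat. ((\<lambda>Y. X ** Y) ^^ k) (mat 1) = 0)"

definition nilpotent_orbit :: "'n::finite sqmat set \<Rightarrow> bool" where
  "nilpotent_orbit \<O> \<longleftrightarrow> (\<exists>X. nilpotent_mat X \<and> \<O> = (\<lambda>g. Ad g X) ` carrier SLn)"

text \<open>
  There is at most one such orbit for each ideal. The closure is the Euclidean one; for
  orbits of algebraic groups it agrees with the Zariski closure.
\<close>

definition has_associated_orbit ::
    "'n::{finite,linorder} sqmat set \<Rightarrow> 'n sqmat set \<Rightarrow> bool" where
  "has_associated_orbit I \<O> \<longleftrightarrow> nilpotent_orbit \<O> \<and>
     closure \<O> = {Ad g x | g x. g \<in> carrier SLn \<and> x \<in> I}"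

text \<open>
  The value \<open>dim B - dim B'\<close>, with \<open>B'\<close> a Borel subgroup of the centralizer of \<open>X\<close>, depends
  neither on the choice of \<open>X\<close> in the orbit nor on that of \<open>B'\<close>. The difference is taken in \<open>int\<close>, because
  subtraction on \<open>nat\<close> truncates.
\<close>

definition m_orbit :: "'n::{finite,linorder} sqmat set \<Rightarrow> int" where
  "m_orbit \<O> = (THE d. \<exists>X \<in> \<O>. \<exists>H. borel_subgroup_of H (centralizer X) \<and>
     d = int (group_dim (Borel :: 'n sqmat set)) - int (group_dim H))"

subsection \<open>Partitions, Jordan types and the Dynkin element\<close>

definition is_partition :: "nat list \<Rightarrow> nat \<Rightarrow> bool" where
  "is_partition ls n \<longleftrightarrow> sorted_wrt (\<ge>) ls \<and> (\<forall>l \<in> set ls. 0 < l) \<and> sum_list ls = n"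

text \<open>The \<open>i\<close>-th part, counted from 1, and 0 beyond the last part.\<close>

definition part :: "nat list \<Rightarrow> nat \<Rightarrow> nat" where
  "part ls i = (if 1 \<le> i \<and> i \<le> length ls then ls ! (i - 1) else 0)"

text \<open>
  \<open>X\<close> has nilpotent Jordan blocks of sizes \<open>ls\<close>: the vectors \<open>v i j\<close>, \<open>j < ls ! i\<close>, form a
  basis of the whole space in which \<open>X\<close> is block diagonal with one Jordan block of eigenvalue 0
  for each \<open>i\<close>.
\<close>

definition has_jordan_type :: "'n::finite sqmat \<Rightarrow> nat list \<Rightarrow> bool" where
  "has_jordan_type X ls \<longleftrightarrow> (\<exists>v :: nat \<Rightarrow> nat \<Rightarrow> complex ^ 'n.
     let J = (SIGMA i:{..<length ls}. {..<ls ! i}); b = (\<lambda>(i, j). v i j) in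
       inj_on b J \<and> vec.independent (b ` J) \<and> vec.span (b ` J) = UNIV \<and>
       (\<forall>(i, j) \<in> J. X *v v i j = (if j = 0 then 0 else v i (j - 1))))"

definition orbit_of_type :: "nat list \<Rightarrow> 'n::finite sqmat set" where
  "orbit_of_type ls = {X. has_jordan_type X ls}"

text \<open>The diagonal \<open>h\<^sub>1 \<ge> \<dots> \<ge> h\<^sub>n\<close> of the Dynkin element, as a list.\<close>

definition dynkin_diag :: "nat list \<Rightarrow> int list" where
  "dynkin_diag ls =
     rev (sort (concat (map (\<lambda>l. map (\<lambda>j. int l - 1 - 2 * int j) [0..<l]) ls)))"

definition dynkin_count :: "nat list \<Rightarrow> int \<Rightarrow> nat" where
  "dynkin_count ls l = card {j. j < length (dynkin_diag ls) \<and> dynkin_diag ls ! j \<le> l}"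

end

theory Submission
  imports Defs "HOL-Computational_Algebra.Fundamental_Theorem_Algebra"
begin

text \<open>
  In a Jordan basis of \<open>X\<close> ordered by the levels of its vectors in their blocks, and then by the blocks
  in decreasing order of size, a Borel subgroup of the centralizer of \<open>X\<close> is the identity component of
  the group of upper triangular matrices that commute with \<open>X\<close>: by the Lie-Kolchin argument, applied to
  subquotients, the kernel vectors of a Jordan basis can be chosen adapted to a given connected solvable
  subgroup of the centralizer, and this makes the subgroup triangular. The map \<open>b \<mapsto> [b, X]\<close> sends the
  upper triangular matrices onto the ideal \<open>I\<close> generated by \<open>X\<close>, with kernel the Lie algebra of the Borel
  subgroup up to scalars; so \<open>dim I = m\<^sub>\<O>\<close>, and the dimension is found by counting the matrix
  units in \<open>I\<close>. The closure of the orbit is \<open>G I\<close>, because a matrix in \<open>I\<close> whose entries are non-zero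
  where those of \<open>X\<close> are is conjugate to \<open>X\<close>, and because \<open>G I = K I\<close> is closed for the compact unitary
  group \<open>K\<close>. For an arbitrary ideal \<open>I\<close> with the same orbit and \<open>X \<in> I\<close>, the kernel of \<open>b \<mapsto> [b, X]\<close> is
  again triangularizable, hence at most as large, while the image lies in \<open>I\<close>.
\<close>

subsection \<open>Linear algebra in the space of matrices\<close>

text \<open>The formula is \<open>n(n+1)/2\<close>, the number of pairs \<open>p \<le> q\<close>,
  minus the dimension of the triangular matrices commuting with \<open>X\<close>. Since
  \<open>A(b-1) - A(-b-1)\<close> is the sum of \<open>min(\<lambda>_k, b)\<close> over
  \<open>k\<close>, the sum over \<open>i\<close> is the dimension of the full matrix centralizer of
  \<open>X\<close>, namely the double sum of \<open>min(\<lambda>_i, \<lambda>_k)\<close>. Its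
  reductive part is a product of groups \<open>GL\<close> of sizes \<open>n_t\<close>, and a Borel
  subgroup loses \<open>n_t(n_t-1)/2\<close> in each: the last sum. The obstacle is that Borel
  subgroups are given by Euclidean connectedness and dimensions by velocities of curves, with
  neither Zariski closures nor the Lie correspondence at hand. So Lie-Kolchin runs on connectedness
  and the finiteness of spectra, and maximality comes from comparing explicitly computed Lie
  algebras. Subquotients are needed because the flag of kernel vectors must pass through the spaces
  of those that end long chains.\<close>

definition mat_unit :: "'n::finite \<times> 'n \<Rightarrow> 'n sqmat" where
  "mat_unit pq = (\<chi> i j. if (i, j) = pq then 1 else 0)"

lemma mat_unit_nth: "mat_unit pq $ i $ j = (if (i, j) = pq then 1 else 0)"
  by (simp add: mat_unit_def)

lemma inj_mat_unit: "inj mat_unit"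
proof (rule injI)
  fix x y :: "'n::finite \<times> 'n"
  assume "mat_unit x = mat_unit y"
  then have "mat_unit x $ fst x $ snd x = mat_unit y $ fst x $ snd x"
    by simp
  then show "x = y"
    by (simp add: mat_unit_nth split: if_splits)
qed

lemma sum_mat_unit_nth:
  "(\<Sum>pq\<in>S. cscale (f pq) (mat_unit pq)) $ i $ j = (if (i, j) \<in> S then f (i, j) else 0)"
  if "finite S"
proof -
  have "(\<Sum>pq\<in>S. cscale (f pq) (mat_unit pq)) $ i $ j =
      (\<Sum>pq\<in>S. if (i, j) = pq then f pq else 0)"
    by (simp add: sum_component cscale_def mat_unit_nth if_distrib cong: if_cong)
  then show ?thesis
    using that by simp
qed

lemma independent_mat_unit: "cmat.independent (mat_unit ` S)"
proof (rule cmat.independent_if_scalars_zero)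
  show fin: "finite (mat_unit ` S)"
    by simp
  fix f :: "'a sqmat \<Rightarrow> complex" and x :: "'a sqmat"
  assume sum: "(\<Sum>x\<in>mat_unit ` S. cscale (f x) x) = 0" and x: "x \<in> mat_unit ` S"
  from x obtain p where p: "x = mat_unit p" "p \<in> S"
    by blast
  have "(\<Sum>q\<in>S. cscale (f (mat_unit q)) (mat_unit q)) = 0"
    using sum inj_mat_unit by (subst (asm) sum.reindex) (auto intro: inj_on_subset)
  then have "(\<Sum>q\<in>S. cscale (f (mat_unit q)) (mat_unit q)) $ fst p $ snd p = 0"
    by simp
  then show "f x = 0"
    using p by (simp add: sum_mat_unit_nth del: sum_component)
qed

definition coord_space :: "('n::finite \<times> 'n) set \<Rightarrow> 'n sqmat set" where
  "coord_space S = {A. \<forall>i j. A $ i $ j \<noteq> 0 \<longrightarrow> (i, j) \<in> S}"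

lemma subspace_coord_space: "cmat.subspace (coord_space S)"
  by (rule cmat.subspaceI) (auto simp: coord_space_def cscale_def, force)

lemma span_mat_unit: "cmat.span (mat_unit ` S) = coord_space S"
proof
  show "cmat.span (mat_unit ` S) \<subseteq> coord_space S"
    by (rule cmat.span_minimal[OF _ subspace_coord_space])
      (auto simp: coord_space_def mat_unit_nth split: if_splits)
  show "coord_space S \<subseteq> cmat.span (mat_unit ` S)"
  proof
    fix A assume A: "A \<in> coord_space S"
    have "A = (\<Sum>pq\<in>S. cscale (A $ fst pq $ snd pq) (mat_unit pq))"
      using A by (auto simp: vec_eq_iff sum_mat_unit_nth coord_space_def simp del: sum_component)
    moreover have "\<dots> \<in> cmat.span (mat_unit ` S)"
      by (intro cmat.span_sum cmat.span_scale cmat.span_base) simp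
    ultimately show "A \<in> cmat.span (mat_unit ` S)"
      by simp
  qed
qed

interpretation cmat: finite_dimensional_vector_space
  "cscale :: complex \<Rightarrow> 'n::finite sqmat \<Rightarrow> _" "range mat_unit"
proof
  show "cmat.span (range mat_unit :: 'n sqmat set) = UNIV"
    unfolding span_mat_unit by (auto simp: coord_space_def)
qed (auto simp: independent_mat_unit)

interpretation cmat_pair: finite_dimensional_vector_space_pair
  "cscale :: complex \<Rightarrow> 'n::finite sqmat \<Rightarrow> _" "range mat_unit"
  "cscale :: complex \<Rightarrow> 'n::finite sqmat \<Rightarrow> _" "range mat_unit" ..

lemma dim_coord_space: "cmat.dim (coord_space S) = card S"
  using card_image[OF inj_on_subset[OF inj_mat_unit], of S]
  by (simp add: span_mat_unit[symmetric] cmat.dim_span_eq_card_independent independent_mat_unit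
      del: cmat.dim_span)

context finite_dimensional_vector_space
begin

text \<open>Stated for a linear map restricted to a subspace, since the commutator map is applied to
  the upper triangular matrices only. A kernel basis extended to \<open>V\<close> bounds the rank
  from above; joined to a lifted basis of the image, it gives the reverse.\<close>

lemma rank_nullity:
  assumes f: "Vector_Spaces.linear scale scale f" and V: "subspace V"
  shows "dim V = dim (f ` V) + dim {v \<in> V. f v = 0}"
proof -
  interpret f: Vector_Spaces.linear scale scale f
    by (rule f)
  let ?K = "{v \<in> V. f v = 0}"
  obtain B where B: "B \<subseteq> ?K" "independent B" "?K \<subseteq> span B" "card B = dim ?K"
    using basis_exists by blast
  obtain C where C: "B \<subseteq> C" "C \<subseteq> V" "independent C" "V \<subseteq> span C"
    using maximal_independent_subset_extend[of B V] B by auto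
  have finC: "finite C"
    using C by (simp add: finiteI_independent)
  have "f ` V \<subseteq> span (f ` (C - B))"
  proof -
    have "f ` V \<subseteq> f ` span C"
      using C by blast
    also have "\<dots> = span (f ` C)"
      by (simp add: f.span_image)
    also have "\<dots> \<subseteq> span (f ` (C - B))"
    proof (rule span_minimal)
      show "f ` C \<subseteq> span (f ` (C - B))"
      proof (intro image_subsetI)
        fix x assume "x \<in> C"
        then show "f x \<in> span (f ` (C - B))"
          using B(1) by (cases "x \<in> B") (auto simp: span_zero intro: span_base)
      qed
    qed simp
    finally show ?thesis .
  qed
  then have "dim (f ` V) \<le> card (f ` (C - B))"
    using finC by (intro dim_le_card) auto
  also have "\<dots> \<le> card (C - B)"
    using finC by (intro card_image_le) auto
  also have "\<dots> = card C - card B"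
    using finC C by (simp add: card_Diff_subset finite_subset)
  finally have "dim (f ` V) + dim ?K \<le> dim V"
    using basis_card_eq_dim[of C V] C B card_mono[OF finC C(1)] by simp
  moreover have "dim V \<le> dim (f ` V) + dim ?K"
  proof -
    obtain E where E: "E \<subseteq> f ` V" "independent E" "f ` V \<subseteq> span E" "card E = dim (f ` V)"
      using basis_exists by blast
    obtain E' where E': "E' \<subseteq> V" "E = f ` E'" "inj_on f E'"
      using E(1) by (meson subset_image_inj)
    have finE': "finite E'"
      using E(2) E' finiteI_independent finite_image_iff by blast
    have "V \<subseteq> span (B \<union> E')"
    proof
      fix v assume v: "v \<in> V"
      then have "f v \<in> f ` span E'"
        using E(3) by (auto simp: E'(2) f.span_image)
      then obtain e where e: "e \<in> span E'" "f v = f e"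
        by blast
      have "e \<in> V"
        using e(1) E'(1) V by (meson in_mono span_minimal)
      then have "v - e \<in> span B"
        using v V e B(3) by (auto simp: f.diff subspace_diff)
      then have "(v - e) + e \<in> span (B \<union> E')"
        using e(1) by (intro span_add) (meson in_mono span_mono sup_ge1 sup_ge2)+
      then show "v \<in> span (B \<union> E')"
        by simp
    qed
    then have "dim V \<le> card (B \<union> E')"
      using finE' B(2) by (intro dim_le_card) (auto simp: finiteI_independent)
    also have "\<dots> \<le> card B + card E'"
      by (rule card_Un_le)
    also have "card E' = card E"
      using E' by (simp add: card_image)
    finally show ?thesis
      using B E by simp
  qed
  ultimately show ?thesis
    by simp
qed

end

lemma cscale_mult_left: "cscale c A ** B = cscale c (A ** B)"
  by (simp add: cscale_def matrix_matrix_mult_def vec_eq_iff sum_distrib_left mult.assoc)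

lemma cscale_mult_right: "A ** cscale c B = cscale c (A ** B)"
  by (simp add: cscale_def matrix_matrix_mult_def vec_eq_iff sum_distrib_left algebra_simps)

lemma cscale_mult_vec: "cscale c A *v x = c *s (A *v x)"
  by (simp add: cscale_def matrix_vector_mult_def vec_eq_iff sum_distrib_left mult.assoc)

lemma matrix_add_rdistrib: "(A + B) ** C = A ** C + (B ** C :: 'n::finite sqmat)"
  by (simp add: matrix_matrix_mult_def vec_eq_iff distrib_right sum.distrib)

lemma linear_mult_mult:
  fixes g :: "'n::finite sqmat"
  shows "Vector_Spaces.linear cscale cscale (\<lambda>A. g ** A ** h)"
  by (simp add: Vector_Spaces.linear_iff cmat.vector_space_axioms matrix_add_ldistrib matrix_add_rdistrib cscale_mult_left cscale_mult_right)

lemma linear_commutator: "Vector_Spaces.linear cscale cscale (\<lambda>A. A ** X - X ** A)"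
  by (simp add: Vector_Spaces.linear_iff cmat.vector_space_axioms matrix_add_ldistrib matrix_add_rdistrib cscale_mult_left cscale_mult_right
       cmat.scale_right_diff_distrib)

lemma trace_zero: "trace (0 :: 'n::finite sqmat) = 0"
  by (simp add: trace_def)

lemma trace_cscale: "trace (cscale c A) = c * trace A"
  by (simp add: trace_def cscale_def sum_distrib_left)

lemma dim_conj:
  fixes g :: "'n::finite sqmat"
  assumes "h ** g = mat 1"
  shows "cmat.dim ((\<lambda>A. g ** A ** h) ` V) = cmat.dim V"
proof -
  have "inj_on (\<lambda>A. g ** A ** h) (cmat.span V)"
  proof (rule inj_onI)
    fix x y
    assume "g ** x ** h = g ** y ** h"
    then have "h ** (g ** x ** h) ** g = h ** (g ** y ** h) ** g"
      by simp
    then have "(h ** g) ** x ** (h ** g) = (h ** g) ** y ** (h ** g)"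
      by (simp only: matrix_mul_assoc)
    then show "x = y"
      by (simp add: assms)
  qed
  then show ?thesis
    by (intro cmat_pair.dim_image_eq linear_mult_mult)
qed

text \<open>Passes between matrix spaces containing the scalars, where ranks are computed, and their
  trace-free parts, which are the Lie algebras. The discrepancy 1 cancels in
  \<open>m_orbit_eq\<close>.\<close>

lemma dim_trace_zero:
  fixes A :: "'n::finite sqmat set"
  assumes A: "cmat.subspace A" and one: "mat 1 \<in> A"
  shows "cmat.dim {a \<in> A. trace a = 0} + 1 = cmat.dim A"
proof -
  let ?A0 = "{a \<in> A. trace a = 0}"
  have tr1: "trace (mat 1 :: 'n sqmat) \<noteq> 0"
    by (simp add: trace_def mat_def)
  have sub: "cmat.subspace ?A0"
    using A by (auto simp: cmat.subspace_def trace_cscale trace_add trace_zero)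
  have "cmat.span (insert (mat 1) ?A0) = A"
  proof
    show "cmat.span (insert (mat 1) ?A0) \<subseteq> A"
      using A one by (intro cmat.span_minimal) auto
    show "A \<subseteq> cmat.span (insert (mat 1) ?A0)"
    proof
      fix a assume a: "a \<in> A"
      let ?c = "trace a / trace (mat 1 :: 'n sqmat)"
      have "a - cscale ?c (mat 1) \<in> ?A0"
        using a one A tr1 by (auto simp: trace_sub trace_cscale cmat.subspace_diff cmat.subspace_scale)
      then have "(a - cscale ?c (mat 1)) + cscale ?c (mat 1) \<in> cmat.span (insert (mat 1) ?A0)"
        by (intro cmat.span_add cmat.span_scale cmat.span_base) auto
      then show "a \<in> cmat.span (insert (mat 1) ?A0)"
        by simp
    qed
  qed
  moreover have "mat 1 \<notin> cmat.span ?A0"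
    using sub tr1 by (simp add: cmat.span_eq_iff[THEN iffD2])
  ultimately show ?thesis
    using cmat.dim_insert[of "mat 1" ?A0] cmat.dim_span[of "insert (mat 1) ?A0"]
    by (simp del: cmat.dim_span)
qed

subsection \<open>Continuity and inverses of matrices\<close>

lemma bounded_bilinear_matrix_mult:
  "bounded_bilinear ((**) :: 'n::finite sqmat \<Rightarrow> 'n sqmat \<Rightarrow> 'n sqmat)"
proof -
  have scaleR_left: "(r *\<^sub>R A) ** B = r *\<^sub>R (A ** B)"
    and scaleR_right: "A ** (r *\<^sub>R B) = r *\<^sub>R (A ** B)" for r and A B :: "'n sqmat"
    by (simp_all add: matrix_matrix_mult_def vec_eq_iff scaleR_sum_right)
  have "bilinear ((**) :: 'n sqmat \<Rightarrow> 'n sqmat \<Rightarrow> 'n sqmat)"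
    unfolding bilinear_def
    by (auto intro!: linearI simp: matrix_add_ldistrib matrix_add_rdistrib
        scaleR_right scaleR_left)
  then show ?thesis
    by (simp add: bilinear_conv_bounded_bilinear)
qed

lemmas continuous_on_matrix_mult [continuous_intros] =
  bounded_bilinear.continuous_on[OF bounded_bilinear_matrix_mult]

lemma continuous_on_det [continuous_intros]:
  fixes f :: "'a::topological_space \<Rightarrow> 'n::finite sqmat"
  assumes "continuous_on S f"
  shows "continuous_on S (\<lambda>x. det (f x))"
  unfolding det_def by (intro continuous_intros assms)

lemma matrix_inv_cancel:
  fixes A :: "'n::finite sqmat"
  assumes "det A \<noteq> 0"
  shows "A ** matrix_inv A = mat 1" "matrix_inv A ** A = mat 1"
proof -
  have "A ** matrix_inv A = mat 1 \<and> matrix_inv A ** A = mat 1"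
    unfolding matrix_inv_def
    using assms unfolding invertible_det_nz[symmetric] invertible_def by (rule someI_ex)
  then show "A ** matrix_inv A = mat 1" "matrix_inv A ** A = mat 1"
    by auto
qed

lemma matrix_inv_unique:
  fixes A :: "'n::finite sqmat"
  assumes "B ** A = mat 1"
  shows "matrix_inv A = B"
proof -
  have "det B * det A = 1"
    by (metis assms det_I det_mul)
  then have "det A \<noteq> 0"
    by auto
  then show ?thesis
    using matrix_inv_cancel(1) assms by (metis matrix_mul_assoc matrix_mul_lid matrix_mul_rid)
qed

lemma matrix_inv_mult:
  fixes A :: "'n::finite sqmat"
  assumes "det A \<noteq> 0" "det B \<noteq> 0"
  shows "matrix_inv (A ** B) = matrix_inv B ** matrix_inv A"
proof (rule matrix_inv_unique)
  have "matrix_inv B ** matrix_inv A ** (A ** B) = matrix_inv B ** (matrix_inv A ** A) ** B"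
    by (simp add: matrix_mul_assoc)
  then show "matrix_inv B ** matrix_inv A ** (A ** B) = mat 1"
    using assms by (simp add: matrix_inv_cancel)
qed

lemma det_matrix_inv:
  fixes A :: "'n::finite sqmat"
  assumes "det A \<noteq> 0"
  shows "det (matrix_inv A) = inverse (det A)"
proof -
  have "det A * det (matrix_inv A) = 1"
    by (simp add: det_mul[symmetric] matrix_inv_cancel[OF assms])
  then show ?thesis
    using assms by (simp add: field_simps)
qed

text \<open>Cramer's rule for the columns of the inverse; it yields the continuity of
  inversion.\<close>

lemma matrix_inv_nth:
  fixes A :: "'n::finite sqmat"
  assumes "det A \<noteq> 0"
  shows "matrix_inv A $ k $ j = det (\<chi> p q. if q = k then mat 1 $ p $ j else A $ p $ q) / det A"
proof -
  let ?x = "\<chi> k. matrix_inv A $ k $ j"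
  let ?e = "\<chi> p. (mat 1 :: 'n sqmat) $ p $ j"
  have "A *v ?x = ?e"
    unfolding matrix_inv_cancel(1)[OF assms, symmetric]
    by (simp add: matrix_vector_mult_def matrix_matrix_mult_def vec_eq_iff)
  then have x: "?x = (\<chi> k. det (\<chi> p q. if q = k then ?e $ p else A $ p $ q) / det A)"
    using cramer[OF assms] by blast
  have "matrix_inv A $ k $ j = ?x $ k"
    by simp
  also have "\<dots> = det (\<chi> p q. if q = k then ?e $ p else A $ p $ q) / det A"
    by (subst x) simp
  finally show ?thesis
    by (simp cong: if_cong)
qed

lemma continuous_on_matrix_inv [continuous_intros]:
  fixes f :: "'a::topological_space \<Rightarrow> 'n::finite sqmat"
  assumes f: "continuous_on S f" and nz: "\<And>x. x \<in> S \<Longrightarrow> det (f x) \<noteq> 0"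
  shows "continuous_on S (\<lambda>x. matrix_inv (f x))"
proof -
  have "continuous_on S (\<lambda>x. \<chi> k j.
      det (\<chi> p q. if q = k then mat 1 $ p $ j else f x $ p $ q) / det (f x))"
  proof (intro continuous_intros f)
    show "\<forall>x\<in>S. det (f x) \<noteq> 0"
      using nz by blast
    fix p q k j :: 'n
    show "continuous_on S (\<lambda>x. if q = k then mat 1 $ p $ j else f x $ p $ q)"
      by (cases "q = k") (auto intro!: continuous_intros f)
  qed
  moreover have "(\<chi> k j. det (\<chi> p q. if q = k then mat 1 $ p $ j else f x $ p $ q) / det (f x))
      = matrix_inv (f x)" if "x \<in> S" for x
    using nz[OF that] by (simp add: vec_eq_iff matrix_inv_nth)
  ultimately show ?thesis
    by (metis (no_types, lifting) continuous_on_cong)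
qed

subsection \<open>The group \<open>SL\<^sub>n\<close>\<close>

lemma SLn_simps [simp]:
  "g \<in> carrier SLn \<longleftrightarrow> det g = 1" "g \<otimes>\<^bsub>SLn\<^esub> h = g ** h" "\<one>\<^bsub>SLn\<^esub> = mat 1"
  by (simp_all add: SLn_def)

lemma group_SLn: "group (SLn :: 'n::finite sqmat monoid)"
proof (rule groupI)
  fix x :: "'n sqmat" assume "x \<in> carrier SLn"
  then show "\<exists>y\<in>carrier SLn. y \<otimes>\<^bsub>SLn\<^esub> x = \<one>\<^bsub>SLn\<^esub>"
    by (intro bexI[of _ "matrix_inv x"]) (auto simp: matrix_inv_cancel det_matrix_inv)
qed (auto simp: det_mul matrix_mul_assoc)

interpretation SLn: group "SLn :: 'n::finite sqmat monoid"
  by (rule group_SLn)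

lemma inv_SLn [simp]: "det g = 1 \<Longrightarrow> inv\<^bsub>SLn\<^esub> g = matrix_inv g"
  by (rule SLn.inv_equality) (auto simp: matrix_inv_cancel det_matrix_inv)

lemma subgroup_SLnD:
  assumes "subgroup H SLn"
  shows "mat 1 \<in> H" "\<And>x. x \<in> H \<Longrightarrow> det x = 1" "\<And>x y. x \<in> H \<Longrightarrow> y \<in> H \<Longrightarrow> x ** y \<in> H"
    "\<And>x. x \<in> H \<Longrightarrow> matrix_inv x \<in> H"
proof -
  interpret subgroup H SLn
    by (rule assms)
  show "mat 1 \<in> H" "\<And>x. x \<in> H \<Longrightarrow> det x = 1" "\<And>x y. x \<in> H \<Longrightarrow> y \<in> H \<Longrightarrow> x ** y \<in> H"
    using one_closed mem_carrier m_closed by auto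
  show "matrix_inv x \<in> H" if "x \<in> H" for x
    using m_inv_closed[OF that] mem_carrier[OF that] by simp
qed

lemma subgroup_SLnI:
  assumes "mat 1 \<in> H" "\<And>x. x \<in> H \<Longrightarrow> det x = 1" "\<And>x y. x \<in> H \<Longrightarrow> y \<in> H \<Longrightarrow> x ** y \<in> H"
    "\<And>x. x \<in> H \<Longrightarrow> matrix_inv x \<in> H"
  shows "subgroup H SLn"
proof (rule SLn.subgroupI)
  show "H \<subseteq> carrier SLn"
    using assms(2) by auto
  show "H \<noteq> {}"
    using assms(1) by auto
  show "inv\<^bsub>SLn\<^esub> x \<in> H" if "x \<in> H" for x
    using assms(2,4)[OF that] by simp
  show "x \<otimes>\<^bsub>SLn\<^esub> y \<in> H" if "x \<in> H" "y \<in> H" for x y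
    using assms(3)[OF that] by simp
qed

text \<open>Bases found by linear algebra give a non-zero determinant only; a scalar factor, a root
  of \<open>1 / det g\<close>, repairs this without changing the conjugation.\<close>

lemma scale_to_SLn:
  fixes g :: "'n::finite sqmat"
  assumes "det g \<noteq> 0"
  obtains c where "c \<noteq> 0" "det (cscale c g) = 1"
proof -
  have det: "det (cscale c g) = c ^ CARD('n) * det g" for c
  proof -
    have "cscale c g = (\<chi> i. c *s g $ i)"
      by (simp add: cscale_def vec_eq_iff)
    then show ?thesis
      using det_rows_mul[of "\<lambda>_. c" "\<lambda>i. g $ i"] by simp
  qed
  obtain c where c: "c ^ CARD('n) = inverse (det g)"
  proof -
    have "card {z. z ^ CARD('n) = inverse (det g)} = CARD('n)"
      using assms by (intro card_nth_roots) auto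
    then have "{z. z ^ CARD('n) = inverse (det g)} \<noteq> {}"
      by (metis card.empty zero_less_card_finite less_irrefl)
    with that show thesis
      by blast
  qed
  show thesis
  proof (rule that[of c])
    show "c \<noteq> 0"
      using c assms by (cases "c = 0") (auto simp: power_0_left)
    show "det (cscale c g) = 1"
      using assms by (simp add: det c)
  qed
qed

subsection \<open>Triangular matrices\<close>

lemma det_upper_triangular:
  fixes A :: "'n::{finite,linorder} sqmat"
  assumes "upper_triangular A"
  shows "det A = (\<Prod>i\<in>UNIV. A $ i $ i)"
proof -
  \<comment> \<open>The largest index moved by \<open>p\<close> would go to a larger one, which is
    fixed; this contradicts injectivity.\<close>
  have *: "p = id" if p: "p permutes UNIV" "\<And>i. i \<le> p i" for p :: "'n \<Rightarrow> 'n"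
  proof (rule ccontr)
    let ?i = "Max {i. p i \<noteq> i}"
    assume "p \<noteq> id"
    then have "{i. p i \<noteq> i} \<noteq> {}"
      by auto
    then have "p ?i \<noteq> ?i"
      using Max_in[of "{i. p i \<noteq> i}"] by auto
    moreover have "p (p ?i) = p ?i"
    proof (rule ccontr)
      assume "p (p ?i) \<noteq> p ?i"
      then have "p ?i \<le> ?i"
        by (intro Max_ge) auto
      with p(2)[of ?i] \<open>p ?i \<noteq> ?i\<close> show False
        by simp
    qed
    ultimately show False
      using permutes_inj[OF p(1)] by (meson injD)
  qed
  have zero: "(\<Prod>i\<in>UNIV. A $ i $ p i) = 0" if "p permutes UNIV" "p \<noteq> id" for p
  proof -
    from that obtain i where "p i < i"
      using * by (meson not_le)
    then have "A $ i $ p i = 0"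
      using assms by (simp add: upper_triangular_def)
    then show ?thesis
      by (intro prod_zero) auto
  qed
  have "det A = (\<Sum>p\<in>{id}. of_int (sign p) * (\<Prod>i\<in>UNIV. A $ i $ p i))"
    unfolding det_def by (rule sum.mono_neutral_right) (auto simp: permutes_id zero)
  then show ?thesis
    by simp
qed

lemma upper_triangular_conv_coord: "Collect upper_triangular = coord_space {(i, j). i \<le> j}"
  unfolding upper_triangular_def coord_space_def using not_le by auto

lemma subspace_upper_triangular: "cmat.subspace (Collect upper_triangular)"
  by (simp add: upper_triangular_conv_coord subspace_coord_space)

lemma upper_triangular_mult:
  assumes "upper_triangular A" "upper_triangular B"
  shows "upper_triangular (A ** B)"
  unfolding upper_triangular_def matrix_matrix_mult_def
proof (clarsimp, intro sum.neutral ballI)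
  fix i j k :: 'a
  assume "j < i"
  then have "k < i \<or> j < k"
    by (meson le_less_trans not_le)
  then show "A $ i $ k * B $ k $ j = 0"
    using assms by (auto simp: upper_triangular_def)
qed

lemma upper_triangular_mat_1: "upper_triangular (mat 1)"
  by (simp add: upper_triangular_def mat_def)

text \<open>If row \<open>p\<close> of the inverse \<open>?C\<close> had non-zero entries left of
  the diagonal, the first one, in column \<open>m\<close>, would make entry \<open>(p, m)\<close> of
  \<open>?C ** A\<close> equal to \<open>?C $ p $ m * A $ m $ m\<close>, which is non-zero.\<close>

lemma upper_triangular_inv:
  fixes A :: "'n::{finite,linorder} sqmat"
  assumes A: "upper_triangular A" and det: "det A \<noteq> 0"
  shows "upper_triangular (matrix_inv A)"
proof (rule ccontr)
  let ?C = "matrix_inv A"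
  assume "\<not> upper_triangular ?C"
  then obtain p q where pq: "q < p" "?C $ p $ q \<noteq> 0"
    by (auto simp: upper_triangular_def)
  let ?S = "{q. q < p \<and> ?C $ p $ q \<noteq> 0}"
  define m where "m = Min ?S"
  have m: "m < p" "?C $ p $ m \<noteq> 0"
    using Min_in[of ?S] pq by (auto simp: m_def)
  have min: "m \<le> q" if "?C $ p $ q \<noteq> 0" "q < p" for q
    using Min_le[of ?S q] that by (auto simp: m_def)
  have "(?C ** A) $ p $ m = (\<Sum>s\<in>UNIV. ?C $ p $ s * A $ s $ m)"
    by (simp add: matrix_matrix_mult_def)
  also have "\<dots> = (\<Sum>s\<in>{m}. ?C $ p $ s * A $ s $ m)"
  proof (rule sum.mono_neutral_right; clarsimp)
    fix s assume "s \<noteq> m" "A $ s $ m \<noteq> 0"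
    then have "s < m"
      using A by (auto simp: upper_triangular_def neq_iff)
    then show "?C $ p $ s = 0"
      using min m(1) by (meson less_trans not_le)
  qed
  finally have "?C $ p $ m * A $ m $ m = 0"
    using m(1) det by (simp add: matrix_inv_cancel mat_def split: if_splits)
  moreover have "A $ m $ m \<noteq> 0"
    using det A by (simp add: det_upper_triangular)
  ultimately show False
    using m by simp
qed

subsection \<open>Polynomials in a matrix\<close>

definition mat_poly :: "complex poly \<Rightarrow> 'n::finite sqmat \<Rightarrow> 'n sqmat" where
  "mat_poly p k = fold_coeffs (\<lambda>a M. cscale a (mat 1) + k ** M) p 0"

lemma mat_poly_0 [simp]: "mat_poly 0 k = 0"
  by (simp add: mat_poly_def)

lemma mat_poly_pCons [simp]: "mat_poly (pCons a p) k = cscale a (mat 1) + k ** mat_poly p k"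
  by (cases "p = 0 \<and> a = 0") (auto simp: mat_poly_def)

lemma mat_poly_add: "mat_poly (p + q) k = mat_poly p k + mat_poly q k"
  by (induction p q rule: poly_induct2)
    (simp_all add: cmat.scale_left_distrib matrix_add_ldistrib)

lemma mat_poly_smult: "mat_poly (smult c p) k = cscale c (mat_poly p k)"
  by (induction p) (simp_all add: cmat.scale_right_distrib cscale_mult_right)

lemma mat_poly_sum: "mat_poly (\<Sum>i\<in>S. f i) k = (\<Sum>i\<in>S. mat_poly (f i) k)"
  by (induction S rule: infinite_finite_induct) (simp_all add: mat_poly_add)

lemma mat_poly_root:
  "mat_poly ([:- a, 1:] * q) k *v v = k *v (mat_poly q k *v v) - a *s (mat_poly q k *v v)"
proof -
  have "[:- a, 1:] * q = smult (- a) q + pCons 0 q"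
    by simp
  then show ?thesis
    by (simp only: mat_poly_add mat_poly_smult mat_poly_pCons)
      (simp add: matrix_vector_mult_diff_rdistrib cscale_mult_vec matrix_vector_mul_assoc)
qed

text \<open>More powers of \<open>k\<close> than the dimension of the matrix space cannot be
  independent.\<close>

lemma annihilating_mat_poly:
  fixes k :: "'n::finite sqmat"
  obtains p where "p \<noteq> 0" "mat_poly p k = 0"
proof -
  define d where "d = cmat.dim (UNIV :: 'n sqmat set)"
  define f where "f i = mat_poly (monom 1 i) k" for i
  show thesis
  proof (cases "inj_on f {..d}")
    \<comment> \<open>Dependence concerns the set of powers, so a repetition among them is handled
      separately; it gives a difference of two monomials.\<close>
    case False
    then obtain i j where ij: "i \<noteq> j" "f i = f j"
      by (auto simp: inj_on_def)
    have "mat_poly (monom 1 i + smult (- 1) (monom 1 j)) k = f i + cscale (- 1) (f j)"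
      by (simp only: mat_poly_add mat_poly_smult f_def)
    also have "\<dots> = 0"
      by (simp add: ij(2))
    finally have "mat_poly (monom 1 i + smult (- 1) (monom 1 j)) k = 0" .
    have "coeff (monom 1 i + smult (- 1) (monom 1 j)) i = (1 :: complex)"
      using ij by simp
    then have "monom 1 i + smult (- 1) (monom 1 j) \<noteq> (0 :: complex poly)"
      by (metis coeff_0 zero_neq_one)
    then show thesis
      using that \<open>mat_poly (monom 1 i + smult (- 1) (monom 1 j)) k = 0\<close> by blast
  next
    case True
    then have "card (f ` {..d}) > cmat.dim (UNIV :: 'n sqmat set)"
      by (simp add: card_image d_def)
    then have "cmat.dependent (f ` {..d})"
      using cmat.independent_card_le_dim[of "f ` {..d}" UNIV] by (meson not_le subset_UNIV)
    then obtain u where u: "\<exists>x\<in>f ` {..d}. u x \<noteq> 0" "(\<Sum>x\<in>f ` {..d}. cscale (u x) x) = 0"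
      by (auto simp: cmat.dependent_finite)
    define p where "p = (\<Sum>i\<le>d. smult (u (f i)) (monom 1 i))"
    have "mat_poly p k = (\<Sum>i\<le>d. cscale (u (f i)) (f i))"
      by (simp only: p_def mat_poly_sum mat_poly_smult f_def)
    also have "\<dots> = 0"
      using u(2) by (simp add: sum.reindex[OF True])
    finally have "mat_poly p k = 0" .
    obtain i where i: "i \<le> d" "u (f i) \<noteq> 0"
      using u(1) by auto
    have "coeff p i = (\<Sum>j\<le>d. if j = i then u (f j) else 0)"
      unfolding p_def coeff_sum by (intro sum.cong) auto
    then have "coeff p i = u (f i)"
      using i(1) by simp
    then have "p \<noteq> 0"
      using i(2) by auto
    then show thesis
      using that \<open>mat_poly p k = 0\<close> by blast
  qed
qed

subsection \<open>Simultaneous triangularization\<close>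

definition stable :: "'n::finite sqmat set \<Rightarrow> (complex ^ 'n) set \<Rightarrow> bool" where
  "stable S W \<longleftrightarrow> vec.subspace W \<and> (\<forall>s\<in>S. \<forall>w\<in>W. s *v w \<in> W)"

text \<open>The common eigenvector is asked for in every subquotient \<open>V / (V \<inter> W)\<close>; so this says that
  every \<open>S\<close>-stable chain of subspaces refines to a complete \<open>S\<close>-stable flag.\<close>

definition triangularizable :: "'n::finite sqmat set \<Rightarrow> bool" where
  "triangularizable S \<longleftrightarrow> (\<forall>W V. stable S W \<longrightarrow> stable S V \<longrightarrow> \<not> V \<subseteq> W \<longrightarrow>
     (\<exists>v\<in>V - W. \<forall>s\<in>S. \<exists>c. s *v v - c *s v \<in> W))"

lemma stableD:
  assumes "stable S W"
  shows "vec.subspace W" "\<And>s w. s \<in> S \<Longrightarrow> w \<in> W \<Longrightarrow> s *v w \<in> W"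
  using assms by (auto simp: stable_def)

lemma eigenvalue_unique:
  assumes "vec.subspace W" "v \<notin> W" "x - c *s v \<in> W" "x - d *s v \<in> W"
  shows "c = d"
proof (rule ccontr)
  assume "c \<noteq> d"
  have "(x - d *s v) - (x - c *s v) \<in> W"
    by (rule vec.subspace_diff[OF assms(1,4,3)])
  then have "inverse (c - d) *s ((x - d *s v) - (x - c *s v)) \<in> W"
    by (rule vec.subspace_scale[OF assms(1)])
  also have "inverse (c - d) *s ((x - d *s v) - (x - c *s v)) = v"
  proof -
    have "(x - d *s v) - (x - c *s v) = (c - d) *s v"
      by (simp add: vec.scale_left_diff_distrib)
    then show ?thesis
      using \<open>c \<noteq> d\<close> by (simp only: vec.scale_scale) simp
  qed
  finally show False
    using assms(2) by simp
qed

lemma mat_poly_stable: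
  assumes "stable {k} V" "v \<in> V"
  shows "mat_poly p k *v v \<in> V"
proof (induction p)
  case 0
  show ?case
    using stableD(1)[OF assms(1)] by (simp add: vec.subspace_0)
next
  case (pCons a p)
  have "a *s v + k *v (mat_poly p k *v v) \<in> V"
    using stableD[OF assms(1)] assms(2) pCons by (intro vec.subspace_add vec.subspace_scale) auto
  then show ?case
    by (simp add: matrix_vector_mult_add_rdistrib cscale_mult_vec matrix_vector_mul_assoc)
qed

lemma mat_poly_eigenvector:
  assumes W: "stable {k} W" and v: "k *v v - c *s v \<in> W"
  shows "mat_poly p k *v v - poly p c *s v \<in> W"
proof (induction p)
  case 0
  show ?case
    using stableD(1)[OF W] by (simp add: vec.subspace_0)
next
  case (pCons a p)
  let ?P = "mat_poly p k *v v"
  have "k *v (?P - poly p c *s v) + poly p c *s (k *v v - c *s v) \<in> W"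
    using stableD[OF W] v pCons by (intro vec.subspace_add vec.subspace_scale) auto
  also have "k *v (?P - poly p c *s v) + poly p c *s (k *v v - c *s v) =
      mat_poly (pCons a p) k *v v - poly (pCons a p) c *s v"
    by (simp add: matrix_vector_mult_add_rdistrib matrix_vector_mult_diff_distrib cscale_mult_vec
        matrix_vector_mul_assoc[symmetric] vec.scale_left_distrib vec.scale_right_diff_distrib
        vec.scale mult.commute)
  finally show ?case .
qed

text \<open>Eigenvalues on the quotient are roots of one annihilating polynomial. This finiteness is
  what turns continuity on a connected group into constancy.\<close>

lemma finite_eigenvalues:
  assumes W: "stable {k} W"
  shows "finite {c. \<exists>v. v \<notin> W \<and> k *v v - c *s v \<in> W}"
proof -
  obtain p where p: "p \<noteq> 0" "mat_poly p k = 0"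
    by (rule annihilating_mat_poly)
  have "poly p c = 0" if "v \<notin> W" "k *v v - c *s v \<in> W" for c v
  proof -
    have "0 - poly p c *s v \<in> W"
      using mat_poly_eigenvector[OF W that(2), of p] p(2) by simp
    moreover have "0 - 0 *s v \<in> W"
      using stableD(1)[OF W] by (simp add: vec.subspace_0)
    ultimately show ?thesis
      using eigenvalue_unique[OF stableD(1)[OF W] that(1)] by blast
  qed
  then have "{c. \<exists>v. v \<notin> W \<and> k *v v - c *s v \<in> W} \<subseteq> {c. poly p c = 0}"
    by blast
  then show ?thesis
    using poly_roots_finite[OF p(1)] finite_subset by blast
qed

text \<open>Among the non-zero polynomials sending \<open>v\<close> into \<open>W\<close> take one
  of least degree and split off a root \<open>c\<close>; the cofactor then moves \<open>v\<close> to
  an eigenvector outside \<open>W\<close>.\<close>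

lemma exists_eigenvector:
  assumes W: "stable {k} W" and V: "stable {k} V" and "\<not> V \<subseteq> W"
  obtains v c where "v \<in> V" "v \<notin> W" "k *v v - c *s v \<in> W"
proof -
  obtain v where v: "v \<in> V" "v \<notin> W"
    using assms by blast
  let ?Q = "\<lambda>p. p \<noteq> 0 \<and> mat_poly p k *v v \<in> W"
  obtain p0 where "p0 \<noteq> 0" "mat_poly p0 k = 0"
    by (rule annihilating_mat_poly)
  then have "?Q p0"
    using stableD(1)[OF W] by (simp add: vec.subspace_0)
  then obtain p where p: "?Q p" and min: "\<And>q. ?Q q \<Longrightarrow> degree p \<le> degree q"
    using ex_has_least_nat[of ?Q p0 degree] by blast
  have "degree p \<noteq> 0"
  proof
    assume "degree p = 0"
    then obtain a where a: "p = [:a:]"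
      by (rule degree_eq_zeroE)
    with p have "a \<noteq> 0" and av: "a *s v \<in> W"
      by (auto simp: cscale_mult_vec)
    have "inverse a *s (a *s v) \<in> W"
      by (rule vec.subspace_scale[OF stableD(1)[OF W] av])
    with \<open>a \<noteq> 0\<close> v(2) show False
      by simp
  qed
  then obtain c where "poly p c = 0"
    using fundamental_theorem_of_algebra[of p] by (auto simp: constant_degree)
  then obtain q where q: "p = [:- c, 1:] * q"
    by (auto simp: poly_eq_0_iff_dvd)
  with p have "q \<noteq> 0"
    by auto
  then have "degree p = Suc (degree q)"
    unfolding q by (subst degree_mult_eq) auto
  with min[of q] \<open>q \<noteq> 0\<close> have "mat_poly q k *v v \<notin> W"
    by auto
  moreover have "mat_poly q k *v v \<in> V"
    by (rule mat_poly_stable[OF V v(1)])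
  moreover have "k *v (mat_poly q k *v v) - c *s (mat_poly q k *v v) \<in> W"
    using p unfolding q mat_poly_root by simp
  ultimately show thesis
    using that by blast
qed

text \<open>Take a stable subspace \<open>U\<close> of least dimension not contained in
  \<open>W\<close>. The eigenspaces of \<open>s\<close> in \<open>U\<close> modulo \<open>W\<close>
  are again stable, since \<open>S\<close> commutes modulo \<open>W\<close>, so minimality makes
  each \<open>s\<close> a scalar on \<open>U\<close> modulo \<open>W\<close>.\<close>

lemma common_eigenvector_commuting:
  assumes W: "stable S W" and V: "stable S V" and ne: "\<not> V \<subseteq> W"
    and comm: "\<And>s t v. s \<in> S \<Longrightarrow> t \<in> S \<Longrightarrow> v \<in> V \<Longrightarrow> s *v (t *v v) - t *v (s *v v) \<in> W"
  shows "\<exists>v\<in>V - W. \<forall>s\<in>S. \<exists>c. s *v v - c *s v \<in> W"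
proof -
  let ?Q = "\<lambda>U. stable S U \<and> U \<subseteq> V \<and> \<not> U \<subseteq> W"
  obtain U where U: "?Q U" and min: "\<And>U'. ?Q U' \<Longrightarrow> vec.dim U \<le> vec.dim U'"
    using ex_has_least_nat[of ?Q V vec.dim] V ne by blast
  obtain v where v: "v \<in> U" "v \<notin> W"
    using U by blast
  have "\<exists>c. s *v v - c *s v \<in> W" if s: "s \<in> S" for s
  proof -
    have "stable {s} W" "stable {s} U"
      using W U s by (auto simp: stable_def)
    then obtain u c where u: "u \<in> U" "u \<notin> W" "s *v u - c *s u \<in> W"
      using exists_eigenvector U by metis
    define U' where "U' = {x \<in> U. s *v x - c *s x \<in> W}"
    have "?Q U'"
    proof (intro conjI)
      have subU: "vec.subspace U" and subW: "vec.subspace W"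
        using U W stableD(1) by blast+
      show "U' \<subseteq> V" "\<not> U' \<subseteq> W"
        using U u by (auto simp: U'_def)
      have "vec.subspace U'"
      proof (rule vec.subspaceI)
        show "0 \<in> U'"
          using subU subW by (simp add: U'_def vec.subspace_0)
      next
        fix x y assume xy: "x \<in> U'" "y \<in> U'"
        then have "(s *v x - c *s x) + (s *v y - c *s y) \<in> W"
          using subW by (intro vec.subspace_add) (auto simp: U'_def)
        then show "x + y \<in> U'"
          using xy subU by (simp add: U'_def vec.subspace_add vec.add vec.scale_right_distrib
              algebra_simps)
      next
        fix a x assume x: "x \<in> U'"
        then have "a *s (s *v x - c *s x) \<in> W"
          using subW by (intro vec.subspace_scale) (auto simp: U'_def)
        then show "a *s x \<in> U'"
          using x subU by (simp add: U'_def vec.subspace_scale vec.scale vec.scale_right_diff_distrib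
              mult.commute)
      qed
      moreover have "t *v x \<in> U'" if t: "t \<in> S" and x: "x \<in> U'" for t x
      proof -
        have "x \<in> V" "x \<in> U"
          using x U by (auto simp: U'_def)
        have "(s *v (t *v x) - t *v (s *v x)) + t *v (s *v x - c *s x) \<in> W"
          using comm[OF s t \<open>x \<in> V\<close>] stableD[OF W] t x
          by (intro vec.subspace_add) (auto simp: U'_def)
        then have "s *v (t *v x) - c *s (t *v x) \<in> W"
          by (simp add: vec.diff vec.scale)
        moreover have "t *v x \<in> U"
          using U t \<open>x \<in> U\<close> stableD(2) by blast
        ultimately show ?thesis
          by (simp add: U'_def)
      qed
      ultimately show "stable S U'"
        by (simp add: stable_def)
    qed
    then have "vec.dim U \<le> vec.dim U'"
      by (rule min)
    moreover have "U' \<subseteq> U"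
      by (auto simp: U'_def)
    ultimately have "U' = U"
      using vec.subspace_dim_equal[of U' U] \<open>?Q U'\<close> U stableD(1) by blast
    then show ?thesis
      using v by (auto simp: U'_def)
  qed
  then show ?thesis
    using v U by blast
qed

lemma continuous_on_matrix_vector_mult [continuous_intros]:
  fixes f :: "'a::topological_space \<Rightarrow> 'n::finite sqmat"
  assumes "continuous_on S f"
  shows "continuous_on S (\<lambda>x. f x *v v)"
  unfolding matrix_vector_mult_def by (intro continuous_intros assms)

text \<open>The linear functional that kills \<open>W\<close> and is 1 at \<open>v\<close>; it makes
  eigenvalues continuous functions of the matrix. It is a coordinate of a linear map fixing
  \<open>v\<close> and killing \<open>W\<close>, divided by that coordinate of
  \<open>v\<close>.\<close>

lemma eigenvalue_functional:
  fixes v :: "complex ^ 'n::finite"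
  assumes W: "vec.subspace W" and v: "v \<notin> W"
  obtains \<phi> where "continuous_on UNIV \<phi>" "\<And>x c. x - c *s v \<in> W \<Longrightarrow> \<phi> x = c"
proof -
  obtain B where B: "B \<subseteq> W" "vec.independent B" "W \<subseteq> vec.span B"
    by (rule vec.basis_exists[of W])
  have "v \<notin> vec.span B"
    using vec.span_minimal[OF B(1) W] v by blast
  then have ind: "vec.independent (insert v B)"
    by (rule vec.independent_insertI[OF _ B(2)])
  obtain g :: "complex ^ 'n \<Rightarrow> complex ^ 'n" where g: "Vector_Spaces.linear (*s) (*s) g"
    "\<forall>x\<in>insert v B. g x = (if x = v then v else 0)"
    using vec.linear_independent_extend[OF ind, of "\<lambda>x. if x = v then v else 0"]
    by (elim exE conjE) (rule that)
  interpret g: Vector_Spaces.linear "(*s)" "(*s)" g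
    by (rule g)
  have gv: "g v = v"
    using g by auto
  have gW: "g w = 0" if "w \<in> W" for w
  proof (rule g.eq_0_on_span)
    show "w \<in> vec.span B"
      using that B by blast
    show "g x = 0" if "x \<in> B" for x
      using that g(2) v B(1) by auto
  qed
  obtain i where i: "v $ i \<noteq> 0"
    using v vec.subspace_0[OF W] vec_eq_iff[of v 0] by auto
  show thesis
  proof (rule that[of "\<lambda>x. g x $ i / v $ i"])
    show "continuous_on UNIV (\<lambda>x. g x $ i / v $ i)"
    proof -
      have "g x = matrix g *v x" for x
        by (simp add: matrix_works[OF g(1)])
      then show ?thesis
        using i by (auto simp: matrix_vector_mult_def intro!: continuous_intros)
    qed
    show "g x $ i / v $ i = c" if "x - c *s v \<in> W" for x c
      using gW[OF that] i by (simp add: g.diff g.scale gv)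
  qed
qed

section \<open>Derived groups and the Lie-Kolchin theorem\<close>

lemma matrix_inv_inv:
  fixes A :: "'n::finite sqmat"
  assumes "det A \<noteq> 0"
  shows "matrix_inv (matrix_inv A) = A"
  by (rule matrix_inv_unique) (simp add: matrix_inv_cancel assms)

lemma matrix_inv_mat_1 [simp]: "matrix_inv (mat 1) = (mat 1 :: 'n::finite sqmat)"
  by (rule matrix_inv_unique) simp

lemma commutator_in_derived:
  assumes H: "subgroup H SLn" and xy: "x \<in> H" "y \<in> H"
  shows "x ** y ** matrix_inv x ** matrix_inv y \<in> derived SLn H"
  unfolding derived_def
proof (rule generate.incl, rule UN_I[OF xy(1)], rule UN_I[OF xy(2)])
  show "x ** y ** matrix_inv x ** matrix_inv y \<in>
      {x \<otimes>\<^bsub>SLn\<^esub> y \<otimes>\<^bsub>SLn\<^esub> inv\<^bsub>SLn\<^esub> x \<otimes>\<^bsub>SLn\<^esub> inv\<^bsub>SLn\<^esub> y}"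
    using xy subgroup_SLnD(2)[OF H] by simp
qed

text \<open>Letting \<open>x\<close> run through \<open>H\<close> joins the commutator of
  \<open>x\<close> and \<open>y\<close> to the identity inside the derived group; translates of such
  connected sets then reach all products.\<close>

lemma connected_derived:
  fixes H :: "'n::finite sqmat set"
  assumes H: "subgroup H SLn" and conn: "connected H"
  shows "connected (derived SLn H)"
proof -
  note sg = subgroup_SLnD[OF H]
  have sub: "subgroup (derived SLn H) SLn"
    by (intro SLn.derived_is_subgroup subgroup.subset H)
  let ?c = "\<lambda>x y. x ** y ** matrix_inv x ** matrix_inv y"
  have inD: "?c x y \<in> derived SLn H" if "x \<in> H" "y \<in> H" for x y
    using commutator_in_derived[OF H that] .
  have comm: "connected_component (derived SLn H) (mat 1) (?c x y)" if "x \<in> H" "y \<in> H" for x y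
    unfolding connected_component_def
  proof (intro exI conjI)
    show "connected ((\<lambda>x. ?c x y) ` H)"
      using sg(2) \<open>y \<in> H\<close> by (intro connected_continuous_image conn continuous_intros) auto
    show "(\<lambda>x. ?c x y) ` H \<subseteq> derived SLn H"
      using inD that by auto
    have "?c (mat 1) y = mat 1"
      using sg(2)[OF \<open>y \<in> H\<close>]
      by (simp add: matrix_inv_cancel)
    then show "mat 1 \<in> (\<lambda>x. ?c x y) ` H"
      by (intro image_eqI[of _ _ "mat 1"] sg(1)) simp
    show "?c x y \<in> (\<lambda>x. ?c x y) ` H"
      using that by blast
  qed
  have "connected_component (generate SLn (derived_set SLn H)) (mat 1) x"
    if "x \<in> generate SLn (derived_set SLn H)" for x
    using that
  proof (induction rule: generate.induct)
    case one
    then show ?case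
      using generate.one[of SLn] by simp
  next
    case (incl h)
    then show ?case
      using comm sg(2) unfolding derived_def by auto
  next
    case (inv h)
    then obtain x y where xy: "x \<in> H" "y \<in> H" "h = ?c x y"
      using sg(2) by auto
    \<comment> \<open>The inverse of a commutator is the commutator of the same elements in the
      other order.\<close>
    then have "inv\<^bsub>SLn\<^esub> h = ?c y x"
      using sg(2)[OF xy(1)] sg(2)[OF xy(2)]
      by (simp add: det_mul det_matrix_inv matrix_inv_mult matrix_inv_inv matrix_mul_assoc)
    then show ?case
      using comm[OF xy(2,1)] unfolding derived_def by simp
  next
    case (eng x y)
    let ?K = "generate SLn (derived_set SLn H)"
    from eng.IH(2) obtain T where T: "connected T" "T \<subseteq> ?K" "mat 1 \<in> T" "y \<in> T"
      unfolding connected_component_def by blast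
    have "connected ((\<lambda>t. x ** t) ` T)"
      by (intro connected_continuous_image T continuous_intros)
    moreover have "(\<lambda>t. x ** t) ` T \<subseteq> ?K"
      using T(2) eng.hyps subgroup_SLnD(3)[OF sub] unfolding derived_def by blast
    moreover have "x \<in> (\<lambda>t. x ** t) ` T"
      using T(3) by (force intro: image_eqI[of _ _ "mat 1"])
    ultimately have "connected_component ?K x (x ** y)"
      unfolding connected_component_def using T(4) by blast
    then show ?case
      using eng.IH(1) connected_component_trans by fastforce
  qed
  then show ?thesis
    unfolding derived_def connected_iff_connected_component
    using connected_component_trans[OF connected_component_sym] by blast
qed

text \<open>A finite-valued continuous function on a connected group is constant. This is used twice:
  a conjugate of a character of the derived group takes eigenvalues of a fixed matrix as values, and
  where a commutator \<open>h k h\<^sup>-\<^sup>1 k\<^sup>-\<^sup>1\<close> acts as a scalar, the quotient of a fixed eigenvalue of \<open>k\<close> by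
  this scalar is again an eigenvalue of \<open>k\<close>.\<close>

lemma triangularizable_of_derived:
  fixes H :: "'n::finite sqmat set"
  assumes H: "subgroup H SLn" and conn: "connected H"
    and der: "triangularizable (derived SLn H)"
  shows "triangularizable H"
  unfolding triangularizable_def
proof (intro allI impI)
  fix W V
  assume W: "stable H W" and V: "stable H V" and ne: "\<not> V \<subseteq> W"
  let ?D = "derived SLn H"
  note sg = subgroup_SLnD[OF H]
  note subW = stableD(1)[OF W] and subV = stableD(1)[OF V]
  note stW = stableD(2)[OF W] and stV = stableD(2)[OF V]
  have cancel: "matrix_inv h *v (h *v x) = x" "h *v (matrix_inv h *v x) = x" if "h \<in> H" for h x
    using sg(2)[OF that] by (simp_all add: matrix_vector_mul_assoc matrix_inv_cancel)
  have DH: "?D \<subseteq> H"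
    by (rule SLn.derived_incl[OF _ H]) simp
  have subD: "subgroup ?D SLn"
    by (intro SLn.derived_is_subgroup subgroup.subset H)
  have comm_in: "h ** k ** matrix_inv h ** matrix_inv k \<in> ?D" if "h \<in> H" "k \<in> H" for h k
    using commutator_in_derived[OF H that] .
  \<comment> \<open>Normality of the derived group: the conjugate of \<open>k\<close> is a
    commutator times \<open>k\<close>.\<close>
  have conj_in: "matrix_inv h ** k ** h \<in> ?D" if "h \<in> H" "k \<in> ?D" for h k
  proof -
    have k: "k \<in> H"
      using DH that by blast
    have "(matrix_inv h ** k ** matrix_inv (matrix_inv h) ** matrix_inv k) ** k \<in> ?D"
      using that k by (intro subgroup_SLnD(3)[OF subD] comm_in sg(4))
    also have "(matrix_inv h ** k ** matrix_inv (matrix_inv h) ** matrix_inv k) ** k =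
        matrix_inv h ** k ** h ** (matrix_inv k ** k)"
      using sg(2)[OF that(1)] by (simp add: matrix_inv_inv matrix_mul_assoc)
    finally show ?thesis
      using sg(2)[OF k] by (simp add: matrix_inv_cancel)
  qed
  have "stable ?D W" "stable ?D V"
    using W V DH by (auto simp: stable_def)
  then obtain v0 where v0: "v0 \<in> V" "v0 \<notin> W" "\<forall>k\<in>?D. \<exists>c. k *v v0 - c *s v0 \<in> W"
    using der ne unfolding triangularizable_def by (metis DiffE)
  then obtain \<mu> where \<mu>: "\<And>k. k \<in> ?D \<Longrightarrow> k *v v0 - \<mu> k *s v0 \<in> W"
    by metis
  obtain \<phi> where \<phi>: "continuous_on UNIV \<phi>" "\<And>x c. x - c *s v0 \<in> W \<Longrightarrow> \<phi> x = c"
    using eigenvalue_functional[OF subW v0(2)] by blast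
  have mu_eq: "\<mu> k = \<phi> (k *v v0)" if "k \<in> ?D" for k
    using \<phi>(2) \<mu>[OF that] by metis
  have notW: "h *v x \<notin> W" if "h \<in> H" "x \<notin> W" for h x
    using stW[OF sg(4)[OF that(1)], of "h *v x"] that cancel by auto
  have cont: "continuous_on H (\<lambda>h. \<phi> (f h *v v0))" if "continuous_on H f" for f
    by (rule continuous_on_compose2[OF \<phi>(1)]) (auto intro!: continuous_intros that)
  have mu_conj: "\<mu> (matrix_inv h ** k ** h) = \<mu> k" if h: "h \<in> H" and k: "k \<in> ?D" for h k
  proof -
    let ?f = "\<lambda>h. \<mu> (matrix_inv h ** k ** h)"
    have "continuous_on H (\<lambda>h. \<phi> ((matrix_inv h ** k ** h) *v v0))"
      using sg(2) by (intro cont continuous_intros) auto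
    then have "continuous_on H ?f"
      by (rule continuous_on_eq) (simp add: mu_eq conj_in k)
    \<comment> \<open>Moving the common eigenvector by \<open>h\<close> turns the value of the
      conjugated character into an eigenvalue of the fixed \<open>k\<close>.\<close>
    moreover have "?f ` H \<subseteq> {c. \<exists>v. v \<notin> W \<and> k *v v - c *s v \<in> W}"
    proof clarsimp
      fix h assume h: "h \<in> H"
      have "h *v ((matrix_inv h ** k ** h) *v v0 - ?f h *s v0) \<in> W"
        by (intro stW h \<mu> conj_in k)
      then have "k *v (h *v v0) - ?f h *s (h *v v0) \<in> W"
        by (simp add: vec.diff vec.scale cancel h flip: matrix_vector_mul_assoc)
      then show "\<exists>v. v \<notin> W \<and> k *v v - ?f h *s v \<in> W"
        using notW[OF h v0(2)] by blast
    qed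
    moreover have "stable {k} W"
      using W k DH by (auto simp: stable_def)
    ultimately have "?f constant_on H"
      using finite_eigenvalues finite_subset continuous_finite_range_constant[OF conn] by blast
    then have "?f h = ?f (mat 1)"
      using h sg(1) unfolding constant_on_def by metis
    then show ?thesis
      by simp
  qed
  \<comment> \<open>The weight space of \<open>\<mu>\<close> modulo \<open>W\<close>; invariance of
    \<open>\<mu>\<close> under conjugation makes it stable under all of \<open>H\<close>.\<close>
  define V1 where "V1 = {v \<in> V. \<forall>k\<in>?D. k *v v - \<mu> k *s v \<in> W}"
  have v0V1: "v0 \<in> V1"
    using v0 \<mu> by (simp add: V1_def)
  have V1V: "V1 \<subseteq> V"
    by (auto simp: V1_def)
  have V1: "stable H V1"
    unfolding stable_def
  proof (intro conjI ballI)
    show "vec.subspace V1"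
    proof (rule vec.subspaceI)
      show "0 \<in> V1"
        using subV subW by (simp add: V1_def vec.subspace_0)
    next
      fix x y assume xy: "x \<in> V1" "y \<in> V1"
      have "k *v (x + y) - \<mu> k *s (x + y) \<in> W" if "k \<in> ?D" for k
      proof -
        have "(k *v x - \<mu> k *s x) + (k *v y - \<mu> k *s y) \<in> W"
          using xy that by (intro vec.subspace_add[OF subW]) (auto simp: V1_def)
        then show ?thesis
          by (simp add: vec.add vec.scale_right_distrib algebra_simps)
      qed
      then show "x + y \<in> V1"
        using xy subV by (simp add: V1_def vec.subspace_add)
    next
      fix a x assume x: "x \<in> V1"
      have "k *v (a *s x) - \<mu> k *s (a *s x) \<in> W" if "k \<in> ?D" for k
      proof -
        have "a *s (k *v x - \<mu> k *s x) \<in> W"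
          using x that by (intro vec.subspace_scale[OF subW]) (auto simp: V1_def)
        then show ?thesis
          by (simp add: vec.scale vec.scale_right_diff_distrib mult.commute)
      qed
      then show "a *s x \<in> V1"
        using x subV by (simp add: V1_def vec.subspace_scale)
    qed
  next
    fix h x assume h: "h \<in> H" and x: "x \<in> V1"
    have "k *v (h *v x) - \<mu> k *s (h *v x) \<in> W" if k: "k \<in> ?D" for k
    proof -
      have "h *v ((matrix_inv h ** k ** h) *v x - \<mu> (matrix_inv h ** k ** h) *s x) \<in> W"
        using x h k conj_in by (intro stW) (auto simp: V1_def)
      then show ?thesis
        by (simp add: mu_conj[OF h k] vec.diff vec.scale cancel[OF h] flip: matrix_vector_mul_assoc)
    qed
    then show "h *v x \<in> V1"
      using x stV[OF h] by (simp add: V1_def)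
  qed
  have mu_comm: "\<mu> (h ** k ** matrix_inv h ** matrix_inv k) = 1" if h: "h \<in> H" and k: "k \<in> H" for h k
  proof -
    let ?c = "\<lambda>h. h ** k ** matrix_inv h ** matrix_inv k"
    have "continuous_on H (\<lambda>h. \<phi> (?c h *v v0))"
      using sg(2) by (intro cont continuous_intros) auto
    then have contc: "continuous_on H (\<lambda>h. \<mu> (?c h))"
      by (rule continuous_on_eq) (simp add: mu_eq comm_in k)
    have stW1: "stable {k} W" and "stable {k} V1"
      using W V1 k by (auto simp: stable_def)
    then obtain u a where u: "u \<in> V1" "u \<notin> W" "k *v u - a *s u \<in> W"
      using exists_eigenvector[of k W V1] v0V1 v0(2) by blast
    let ?E = "{c. \<exists>v. v \<notin> W \<and> k *v v - c *s v \<in> W}"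
    have "a \<noteq> 0"
    proof
      assume "a = 0"
      with u(3) notW[OF k u(2)] show False
        by simp
    qed
    \<comment> \<open>With \<open>?c'\<close> for the scalar, \<open>h k = ?c' k h\<close> on
      \<open>V1\<close> modulo \<open>W\<close>; so \<open>h u\<close> is an eigenvector of
      \<open>k\<close> with eigenvalue \<open>a / ?c'\<close>, which leaves finitely many values for
      \<open>?c'\<close>.\<close>
    have "\<mu> (?c h) \<in> (\<lambda>e. a / e) ` ?E" if h: "h \<in> H" for h
    proof -
      let ?c' = "\<mu> (?c h)"
      have "h *v (k *v u - a *s u) \<in> W"
        by (intro stW h u)
      moreover have "k *v (h *v u) \<in> V1"
        using stableD(2)[OF V1] h k u(1) by blast
      then have "?c h *v (k *v (h *v u)) - ?c' *s (k *v (h *v u)) \<in> W"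
        using comm_in[OF h k] by (simp add: V1_def)
      then have "h *v (k *v u) - ?c' *s (k *v (h *v u)) \<in> W"
        by (simp add: cancel[OF h] cancel[OF k] flip: matrix_vector_mul_assoc)
      ultimately have "h *v (k *v u - a *s u) - (h *v (k *v u) - ?c' *s (k *v (h *v u))) \<in> W"
        by (rule vec.subspace_diff[OF subW])
      then have *: "?c' *s (k *v (h *v u)) - a *s (h *v u) \<in> W"
        by (simp add: vec.diff vec.scale)
      have "?c' \<noteq> 0"
      proof
        assume "?c' = 0"
        with * have "inverse (- a) *s (- (a *s (h *v u))) \<in> W"
          by (intro vec.subspace_scale[OF subW]) simp
        then show False
          using notW[OF h u(2)] \<open>a \<noteq> 0\<close> by (simp add: vec.scale_minus_right)
      qed
      have "inverse ?c' *s (?c' *s (k *v (h *v u)) - a *s (h *v u)) \<in> W"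
        using * by (intro vec.subspace_scale[OF subW])
      then have "k *v (h *v u) - (a / ?c') *s (h *v u) \<in> W"
        using \<open>?c' \<noteq> 0\<close> by (simp add: vec.scale_right_diff_distrib divide_inverse mult.commute)
      then have "a / ?c' \<in> ?E"
        using notW[OF h u(2)] by blast
      then show ?thesis
        using \<open>?c' \<noteq> 0\<close> \<open>a \<noteq> 0\<close> by (intro image_eqI[of _ _ "a / ?c'"]) auto
    qed
    then have "(\<lambda>h. \<mu> (?c h)) ` H \<subseteq> (\<lambda>e. a / e) ` ?E"
      by (rule image_subsetI)
    then have "finite ((\<lambda>h. \<mu> (?c h)) ` H)"
      by (rule finite_surj[OF finite_eigenvalues[OF stW1]])
    then have "(\<lambda>h. \<mu> (?c h)) constant_on H"
      by (intro continuous_finite_range_constant[OF conn contc])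
    then have "\<mu> (?c h) = \<mu> (?c (mat 1))"
      using h sg(1) unfolding constant_on_def by metis
    also have "?c (mat 1) = mat 1"
      using sg(2)[OF k]
      by (simp add: matrix_inv_cancel)
    also have "\<mu> (mat 1) = 1"
      using eigenvalue_unique[OF subW v0(2) \<mu>[OF subgroup_SLnD(1)[OF subD]], of 1] subW
      by (simp add: vec.subspace_0)
    finally show ?thesis .
  qed
  \<comment> \<open>All commutators act trivially on \<open>V1\<close> modulo \<open>W\<close>, so
    \<open>H\<close> acts commutatively there.\<close>
  have "\<exists>v\<in>V1 - W. \<forall>s\<in>H. \<exists>c. s *v v - c *s v \<in> W"
  proof (rule common_eigenvector_commuting[OF W V1])
    show "\<not> V1 \<subseteq> W"
      using v0V1 v0(2) by blast
    fix s t v assume st: "s \<in> H" "t \<in> H" and v: "v \<in> V1"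
    let ?c = "s ** t ** matrix_inv s ** matrix_inv t"
    have "t *v (s *v v) \<in> V1"
      using stableD(2)[OF V1] st v by blast
    then have "?c *v (t *v (s *v v)) - \<mu> ?c *s (t *v (s *v v)) \<in> W"
      using comm_in[OF st] by (simp add: V1_def)
    then show "s *v (t *v v) - t *v (s *v v) \<in> W"
      by (simp add: mu_comm[OF st] cancel[OF st(1)] cancel[OF st(2)] flip: matrix_vector_mul_assoc)
  qed
  then show "\<exists>v\<in>V - W. \<forall>s\<in>H. \<exists>c. s *v v - c *s v \<in> W"
    using V1V by blast
qed

text \<open>Induction along the derived series, whose members stay connected. For the trivial group
  every vector outside \<open>W\<close> is a common eigenvector.\<close>

theorem Lie_Kolchin:
  fixes H :: "'n::finite sqmat set"
  assumes H: "subgroup H SLn" and conn: "connected H" and solv: "solvable (SLn\<lparr>carrier := H\<rparr>)"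
  shows "triangularizable H"
proof -
  interpret GH: group "SLn\<lparr>carrier := H\<rparr>"
    by (rule subgroup.subgroup_is_group[OF H group_SLn])
  obtain n where "(derived (SLn\<lparr>carrier := H\<rparr>) ^^ n) H = {mat 1}"
    using GH.solvable_imp_trivial_derived_seq[of H] solv by (auto simp: solvable_def)
  \<comment> \<open>Solvability speaks of derived groups formed within \<open>H\<close>; formed in
    \<open>SLn\<close>, where the induction takes place, they are the same sets.\<close>
  moreover have "(derived (SLn\<lparr>carrier := H\<rparr>) ^^ n) H = (derived SLn ^^ n) H
      \<and> (derived SLn ^^ n) H \<subseteq> H" for n
  proof (induction n)
    case (Suc n)
    then show ?case
      using SLn.derived_consistent[OF _ H] SLn.derived_incl[OF _ H] by simp
  qed simp
  ultimately have "(derived SLn ^^ n) H = {mat 1}"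
    by simp
  then show ?thesis
    using H conn
  proof (induction n arbitrary: H)
    case 0
    then show ?case
      unfolding triangularizable_def
      by (auto simp: stable_def vec.subspace_0 intro!: exI[of _ 1])
  next
    case (Suc n)
    have "triangularizable (derived SLn H)"
    proof (rule Suc.IH)
      show "(derived SLn ^^ n) (derived SLn H) = {mat 1}"
        using Suc.prems(1) by (simp add: funpow_swap1)
      show "subgroup (derived SLn H) SLn"
        by (intro SLn.derived_is_subgroup subgroup.subset Suc.prems)
      show "connected (derived SLn H)"
        by (intro connected_derived Suc.prems)
    qed
    then show ?case
      by (rule triangularizable_of_derived[OF Suc.prems(2,3)])
  qed
qed

text \<open>Choose \<open>v\<close> in \<open>V\<close> outside \<open>W\<close> whose last non-zero
  coordinate \<open>m\<close> comes as early as possible. Then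
  \<open>s *v v - s $ m $ m *s v\<close> ends before \<open>m\<close> and stays in \<open>V\<close>,
  hence lies in \<open>W\<close>. In the lower bound for ideals this serves for the linear space
  \<open>upper_centralizer x\<close>.\<close>

lemma triangularizable_upper:
  fixes S :: "'n::{finite,linorder} sqmat set"
  assumes S: "\<And>s. s \<in> S \<Longrightarrow> upper_triangular s"
  shows "triangularizable S"
  unfolding triangularizable_def
proof (intro allI impI)
  fix W V
  assume W: "stable S W" and V: "stable S V" and ne: "\<not> V \<subseteq> W"
  let ?F = "\<lambda>p. {v. \<forall>q. p < q \<longrightarrow> v $ q = 0}"
  let ?T = "{p. \<not> V \<inter> ?F p \<subseteq> W}"
  have "Max UNIV \<in> ?T"
    using ne by (auto simp: not_less[symmetric])
  then have "?T \<noteq> {}"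
    by blast
  define m where "m = Min ?T"
  have "m \<in> ?T"
    unfolding m_def using \<open>?T \<noteq> {}\<close> by (intro Min_in) auto
  then obtain v where v: "v \<in> V" "v \<in> ?F m" "v \<notin> W"
    by auto
  have min: "m \<le> p" if "x \<in> V" "x \<in> ?F p" "x \<notin> W" for p x
    unfolding m_def using that by (intro Min_le) auto
  have "s *v v - s $ m $ m *s v \<in> W" if s: "s \<in> S" for s
  proof (rule ccontr)
    let ?x = "s *v v - s $ m $ m *s v"
    assume nW: "?x \<notin> W"
    have xV: "?x \<in> V"
      using stableD[OF V] s v(1) by (intro vec.subspace_diff vec.subspace_scale) auto
    have zero: "?x $ q = 0" if "m \<le> q" for q
    proof -
      have "(s *v v) $ q = (\<Sum>j\<in>UNIV. s $ q $ j * v $ j)"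
        by (simp add: matrix_vector_mult_def)
      also have "\<dots> = (\<Sum>j\<in>{q}. s $ q $ j * v $ j)"
      proof (rule sum.mono_neutral_right; clarsimp)
        fix j assume "j \<noteq> q" "v $ j \<noteq> 0"
        then have "j < q"
          using v(2) that by (metis (mono_tags, lifting) mem_Collect_eq le_less_trans neq_iff not_le)
        then show "s $ q $ j = 0"
          using S[OF s] by (simp add: upper_triangular_def)
      qed
      finally show ?thesis
        using v(2) that by (cases "q = m") auto
    qed
    show False
    proof (cases "?x = 0")
      case True
      then show False
        using nW stableD(1)[OF W] by (metis vec.subspace_0)
    next
      case False
      then obtain j where j: "?x $ j \<noteq> 0"
        by (metis vec_eq_iff zero_index)
      let ?p = "Max {j. ?x $ j \<noteq> 0}"
      have "?p \<in> {j. ?x $ j \<noteq> 0}"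
        using j by (intro Max_in) auto
      then have "?p < m"
        using zero by (metis (mono_tags, lifting) mem_Collect_eq not_le)
      moreover have "?x \<in> ?F ?p"
      proof (clarify, rule ccontr)
        fix q assume q: "?p < q" "?x $ q \<noteq> 0"
        then have "q \<le> ?p"
          by (intro Max_ge) auto
        with q(1) show False
          by (meson not_le)
      qed
      then have "m \<le> ?p"
        using min xV nW by blast
      ultimately show False
        by simp
    qed
  qed
  then show "\<exists>v\<in>V - W. \<forall>s\<in>S. \<exists>c. s *v v - c *s v \<in> W"
    using v by blast
qed

subsection \<open>Jordan bases adapted to a triangularizable set\<close>

text \<open>The index type is identified with the boxes of the Young diagram of \<open>lam\<close>: the index \<open>p\<close> is the
  vector of the Jordan block \<open>idx p\<close> that \<open>X ^ lev p\<close> maps to the kernel vector of this block. The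
  order is lexicographic, level first.\<close>

lemma matrix_vector_mult_axis:
  fixes A :: "'n::finite sqmat"
  shows "A *v axis k 1 = column k A"
  by (simp add: vec_eq_iff matrix_vector_mult_def column_def axis_def if_distrib cong: if_cong)

locale jordan_frame =
  fixes lam :: "nat list" and lev idx :: "'n::{finite,linorder} \<Rightarrow> nat"
  assumes lam_sorted: "sorted_wrt (\<ge>) lam"
    and lam_pos: "\<And>l. l \<in> set lam \<Longrightarrow> 0 < l"
    and frame_bij: "bij_betw (\<lambda>p. (lev p, idx p)) UNIV {(j, i). i < length lam \<and> j < lam ! i}"
    and le_iff: "p \<le> q \<longleftrightarrow> lev p < lev q \<or> lev p = lev q \<and> idx p \<le> idx q"
begin

text \<open>Inverse of the frame bijection, meaningful for boxes of the diagram only. The level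
  comes first, whereas \<open>has_jordan_type\<close> puts the block first.\<close>

definition box :: "nat \<Rightarrow> nat \<Rightarrow> 'n" where
  "box j i = (THE p. lev p = j \<and> idx p = i)"

lemma frame_inj: "lev p = lev q \<Longrightarrow> idx p = idx q \<Longrightarrow> p = q"
  using frame_bij by (auto simp: bij_betw_def inj_on_def)

lemma frame_range: "idx p < length lam" "lev p < lam ! idx p"
  using bij_betw_apply[OF frame_bij UNIV_I, of p] by auto

lemma box [simp]:
  assumes "i < length lam" "j < lam ! i"
  shows "lev (box j i) = j" "idx (box j i) = i"
proof -
  have "(j, i) \<in> (\<lambda>p. (lev p, idx p)) ` UNIV"
    using frame_bij assms by (simp add: bij_betw_def)
  then obtain p where "lev p = j \<and> idx p = i"
    by auto
  then have "lev (box j i) = j \<and> idx (box j i) = i"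
    unfolding box_def by (rule theI) (use frame_inj \<open>lev p = j \<and> idx p = i\<close> in auto)
  then show "lev (box j i) = j" "idx (box j i) = i"
    by auto
qed

lemma box_lev_idx [simp]: "box (lev p) (idx p) = p"
  using box[OF frame_range, of p] frame_inj by blast

lemma lam_nth_pos: "i < length lam \<Longrightarrow> 0 < lam ! i"
  using lam_pos by simp

lemma lam_antimono: "i \<le> j \<Longrightarrow> j < length lam \<Longrightarrow> lam ! j \<le> lam ! i"
  using lam_sorted by (cases "i = j") (auto simp: sorted_wrt_iff_nth_less)

lemma less_iff: "p < q \<longleftrightarrow> lev p < lev q \<or> lev p = lev q \<and> idx p < idx q"
  using le_iff[of q p] by (auto simp: not_le[symmetric])

text \<open>The Jordan normal form with its blocks interleaved level by level: each basis vector
  goes one level down in its block, and level 0 to zero.\<close>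

definition X0 :: "'n sqmat" where
  "X0 = (\<chi> p q. if lev q = Suc (lev p) \<and> idx q = idx p then 1 else 0)"

lemma X0_nth: "X0 $ p $ q = (if lev q = Suc (lev p) \<and> idx q = idx p then 1 else 0)"
  by (simp add: X0_def)

lemma X0_conv: "lev q = Suc (lev p) \<and> idx q = idx p \<longleftrightarrow>
    Suc (lev p) < lam ! idx p \<and> q = box (Suc (lev p)) (idx p)"
proof
  assume *: "lev q = Suc (lev p) \<and> idx q = idx p"
  then show "Suc (lev p) < lam ! idx p \<and> q = box (Suc (lev p)) (idx p)"
    using frame_range(2)[of q] box_lev_idx[of q] by simp
next
  assume "Suc (lev p) < lam ! idx p \<and> q = box (Suc (lev p)) (idx p)"
  then show "lev q = Suc (lev p) \<and> idx q = idx p"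
    using frame_range(1)[of p] by simp
qed

lemma X0_vec: "(X0 *v x) $ p =
    (if Suc (lev p) < lam ! idx p then x $ box (Suc (lev p)) (idx p) else 0)"
  unfolding matrix_vector_mult_def
  by (cases "Suc (lev p) < lam ! idx p") (simp_all add: X0_nth X0_conv mult_if_delta)

lemma X0_pow_vec: "(((*v) X0 ^^ m) x) $ p =
    (if lev p + m < lam ! idx p then x $ box (lev p + m) (idx p) else 0)"
proof (induction m arbitrary: p)
  case 0
  then show ?case
    using frame_range by simp
next
  case (Suc m)
  have "(((*v) X0 ^^ Suc m) x) $ p = (if Suc (lev p) < lam ! idx p
      then (((*v) X0 ^^ m) x) $ box (Suc (lev p)) (idx p) else 0)"
    by (simp add: X0_vec)
  also have "\<dots> = (if lev p + Suc m < lam ! idx p then x $ box (lev p + Suc m) (idx p) else 0)"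
    using frame_range(1)[of p] by (auto simp: Suc.IH)
  finally show ?case .
qed

lemma column_mult_X0:
  "column q (g ** X0) = (if lev q = 0 then 0 else column (box (lev q - 1) (idx q)) g)"
proof -
  have *: "(lev q = Suc (lev p) \<and> idx q = idx p) \<longleftrightarrow> lev q \<noteq> 0 \<and> p = box (lev q - 1) (idx q)" for p
    using frame_range[of q] box[of "idx q" "lev q - 1"] frame_inj[of p "box (lev q - 1) (idx q)"]
    by (cases "lev q = 0") auto
  show ?thesis
    by (cases "lev q = 0")
      (simp_all add: vec_eq_iff column_def matrix_matrix_mult_def X0_nth * if_distrib cong: if_cong)
qed

lemma conj_X0_iff:
  "X ** g = g ** X0 \<longleftrightarrow>
    (\<forall>q. X *v column q g = (if lev q = 0 then 0 else column (box (lev q - 1) (idx q)) g))"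
proof -
  have l: "column q (X ** g) = X *v column q g" for q
    by (simp add: matrix_matrix_mult_def matrix_vector_mult_def column_def)
  have "X ** g = g ** X0 \<longleftrightarrow> (\<forall>q. column q (X ** g) = column q (g ** X0))"
    by (auto simp: vec_eq_iff column_def)
  then show ?thesis
    unfolding l column_mult_X0 .
qed

lemma funpow_add': "(f ^^ (a + b)) x = (f ^^ a) ((f ^^ b) x)"
  by (simp add: funpow_add)

lemma funpow_mult_0:
  fixes X :: "'m::finite sqmat"
  shows "((*v) X ^^ k) 0 = 0"
  by (induction k) (simp_all add: vec.zero)

lemma pow_conj:
  assumes "X ** g = g ** X0"
  shows "((*v) X ^^ m) (g *v x) = g *v ((*v) X0 ^^ m) x"
  by (induction m) (simp_all add: matrix_vector_mul_assoc assms)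

lemma boxes_eq: "(SIGMA i:{..<length lam}. {..<lam ! i}) = range (\<lambda>p. (idx p, lev p))"
proof -
  have "(SIGMA i:{..<length lam}. {..<lam ! i}) = prod.swap ` {(j, i). i < length lam \<and> j < lam ! i}"
    by (auto simp: image_iff)
  also have "\<dots> = range (\<lambda>p. (idx p, lev p))"
  proof -
    have "{(j, i). i < length lam \<and> j < lam ! i} = range (\<lambda>p. (lev p, idx p))"
      using frame_bij by (simp add: bij_betw_def)
    then show ?thesis
      by (simp only: image_image prod.swap_def fst_conv snd_conv)
  qed
  finally show ?thesis .
qed

lemma has_jordan_type_iff: "has_jordan_type X lam \<longleftrightarrow> (\<exists>g. det g \<noteq> 0 \<and> X ** g = g ** X0)"
proof
  assume "has_jordan_type X lam"
  then obtain v where v: "vec.span ((\<lambda>(i, j). v i j) ` (SIGMA i:{..<length lam}. {..<lam ! i})) = UNIV"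
    "\<forall>(i, j) \<in> (SIGMA i:{..<length lam}. {..<lam ! i}).
      X *v v i j = (if j = 0 then 0 else v i (j - 1))"
    unfolding has_jordan_type_def Let_def by blast
  define g where "g = (\<chi> r p. v (idx p) (lev p) $ r)"
  have col: "column p g = v (idx p) (lev p)" for p
    by (simp add: column_def g_def)
  have "columns g = (\<lambda>(i, j). v i j) ` (SIGMA i:{..<length lam}. {..<lam ! i})"
    unfolding boxes_eq by (auto simp: columns_def col)
  then have "vec.span (columns g) = UNIV"
    using v by simp
  then have "invertible g"
    using matrix_right_invertible_span_columns[of g] by (simp add: invertible_right_inverse)
  then have "det g \<noteq> 0"
    by (simp add: invertible_det_nz)
  moreover have "X ** g = g ** X0"
    unfolding conj_X0_iff col
  proof
    fix q
    have "(idx q, lev q) \<in> (SIGMA i:{..<length lam}. {..<lam ! i})"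
      using frame_range by simp
    then have "X *v v (idx q) (lev q) = (if lev q = 0 then 0 else v (idx q) (lev q - 1))"
      using v(2) by blast
    then show "X *v v (idx q) (lev q) = (if lev q = 0 then 0
        else v (idx (box (lev q - 1) (idx q))) (lev (box (lev q - 1) (idx q))))"
      using frame_range[of q] by simp
  qed
  ultimately show "\<exists>g. det g \<noteq> 0 \<and> X ** g = g ** X0"
    by blast
next
  assume "\<exists>g. det g \<noteq> 0 \<and> X ** g = g ** X0"
  then obtain g where g: "det g \<noteq> 0" "X ** g = g ** X0"
    by blast
  let ?J = "SIGMA i:{..<length lam}. {..<lam ! i}"
  let ?b = "\<lambda>(i, j). column (box j i) g"
  have injg: "inj ((*v) g)"
    by (rule injI) (metis g(1) matrix_inv_cancel(2) matrix_vector_mul_assoc matrix_vector_mul_lid)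
  have bJ: "?b ` ?J = (*v) g ` cart_basis"
  proof -
    have cart: "cart_basis = range (\<lambda>p. axis p (1 :: complex) :: (complex, 'n) vec)"
      by (auto simp: cart_basis_def)
    show ?thesis
      unfolding boxes_eq cart by (simp only: image_image matrix_vector_mult_axis prod.case box_lev_idx)
  qed
  have "inj_on ?b ?J"
  proof (rule inj_onI)
    fix x y assume x: "x \<in> ?J" and y: "y \<in> ?J" and eq: "?b x = ?b y"
    then obtain p q where pq: "x = (idx p, lev p)" "y = (idx q, lev q)"
      unfolding boxes_eq by auto
    with eq have "g *v axis p 1 = g *v axis q 1"
      by (simp add: matrix_vector_mult_axis)
    then have "axis p (1 :: complex) = axis q 1"
      using injg by (simp add: inj_eq)
    then show "x = y"
      using pq by (simp add: axis_eq_axis)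
  qed
  moreover have "vec.independent (?b ` ?J)"
    unfolding bJ
    by (rule vec.linear_independent_injective_image[OF matrix_vector_mul_linear_gen
          independent_cart_basis inj_on_subset[OF injg subset_UNIV]])
  moreover have "vec.span (?b ` ?J) = UNIV"
  proof -
    have "vec.span (?b ` ?J) = range ((*v) g)"
      unfolding bJ by (simp add: vec.span_image)
    also have "\<dots> = UNIV"
      by (rule surjI[of _ "(*v) (matrix_inv g)"]) (simp add: matrix_vector_mul_assoc matrix_inv_cancel g(1))
    finally show ?thesis .
  qed
  moreover have "X *v column (box j i) g = (if j = 0 then 0 else column (box (j - 1) i) g)"
    if "(i, j) \<in> ?J" for i j
    using g(2) that unfolding conj_X0_iff by auto
  ultimately show "has_jordan_type X lam"
    unfolding has_jordan_type_def Let_def by (intro exI[of _ "\<lambda>i j. column (box j i) g"]) blast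
qed

text \<open>Applying the highest power of \<open>X\<close> that does not kill \<open>x\<close> reduces injectivity to the kernel of
  \<open>X\<close>.\<close>

lemma pow_eq_0_imp:
  assumes conj: "X ** g = g ** X0"
    and inj0: "\<And>x. (\<And>p. lev p \<noteq> 0 \<Longrightarrow> x $ p = 0) \<Longrightarrow> g *v x = 0 \<Longrightarrow> x = 0"
    and zero: "((*v) X ^^ m) (g *v x) = 0" and p: "m \<le> lev p"
  shows "x $ p = 0"
proof (rule ccontr)
  assume "x $ p \<noteq> 0"
  let ?T = "{lev q |q. m \<le> lev q \<and> x $ q \<noteq> 0}"
  have fin: "finite ?T"
    by simp
  have "?T \<noteq> {}"
    using p \<open>x $ p \<noteq> 0\<close> by blast
  then obtain q where q: "Max ?T = lev q" "m \<le> lev q" "x $ q \<noteq> 0"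
    using Max_in[OF fin] by auto
  have max: "x $ r = 0" if "lev q < lev r" for r
  proof (rule ccontr)
    assume "x $ r \<noteq> 0"
    then have "lev r \<le> Max ?T"
      using that q(2) by (intro Max_ge fin) auto
    with that q(1) show False
      by simp
  qed
  let ?y = "((*v) X0 ^^ lev q) x"
  have "g *v ?y = ((*v) X ^^ lev q) (g *v x)"
    by (simp add: pow_conj[OF conj])
  also have "\<dots> = ((*v) X ^^ (lev q - m)) (((*v) X ^^ m) (g *v x))"
    using q(2) by (simp flip: funpow_add')
  also have "\<dots> = 0"
    unfolding zero by (rule funpow_mult_0)
  finally have "?y = 0"
  proof (intro inj0)
    fix r assume "lev r \<noteq> 0"
    then show "?y $ r = 0"
      using max frame_range(1)[of r] by (auto simp: X0_pow_vec)
  qed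
  then have "?y $ box 0 (idx q) = 0"
    by simp
  moreover have "?y $ box 0 (idx q) = x $ q"
    using frame_range[of q] lam_nth_pos[of "idx q"] by (simp add: X0_pow_vec)
  ultimately show False
    using q(3) by simp
qed


text \<open>The span of the vectors chosen so far is stable, and \<open>V m\<close> holds
  \<open>m + 1\<close> independent vectors, one too many for it; a common eigenvector in
  \<open>V m\<close> modulo this span is the next vector.\<close>

lemma flag_exists:
  assumes S: "triangularizable S" and stab: "\<And>i. i < m \<Longrightarrow> stable S (V i)"
    and ind: "\<And>i. i < m \<Longrightarrow> \<exists>B\<subseteq>V i. vec.independent B \<and> card B = Suc i"
  shows "\<exists>w. \<forall>i<m. w i \<in> V i \<and> w i \<notin> vec.span (w ` {..<i}) \<and>
    (\<forall>s\<in>S. s *v w i \<in> vec.span (w ` {..i}))"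
  using stab ind
proof (induction m)
  case 0
  then show ?case
    by simp
next
  case (Suc m)
  then obtain w where w: "\<And>i. i < m \<Longrightarrow> w i \<in> V i" "\<And>i. i < m \<Longrightarrow> w i \<notin> vec.span (w ` {..<i})"
    "\<And>i s. i < m \<Longrightarrow> s \<in> S \<Longrightarrow> s *v w i \<in> vec.span (w ` {..i})"
    by (metis less_Suc_eq)
  let ?W = "vec.span (w ` {..<m})"
  have "stable S ?W"
    unfolding stable_def
  proof (intro conjI ballI)
    fix s x assume s: "s \<in> S" and x: "x \<in> ?W"
    have "(*v) s ` w ` {..<m} \<subseteq> ?W"
    proof clarsimp
      fix i assume i: "i < m"
      then have "vec.span (w ` {..i}) \<subseteq> ?W"
        by (intro vec.span_mono image_mono) auto
      then show "s *v w i \<in> ?W"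
        using w(3)[OF i s] by blast
    qed
    then have "vec.span ((*v) s ` w ` {..<m}) \<subseteq> ?W"
      by (rule vec.span_minimal) simp
    then show "s *v x \<in> ?W"
      using x by (auto simp: vec.span_image)
  qed simp
  moreover have "\<not> V m \<subseteq> ?W"
  proof
    assume sub: "V m \<subseteq> ?W"
    obtain B where B: "B \<subseteq> V m" "vec.independent B" "card B = Suc m"
      using Suc.prems(2)[of m] by blast
    have "card B \<le> card (w ` {..<m})"
      using vec.independent_span_bound[of "w ` {..<m}" B] B sub by auto
    also have "\<dots> \<le> m"
      using card_image_le[of "{..<m}" w] by simp
    finally show False
      using B by simp
  qed
  moreover have "stable S (V m)"
    by (rule Suc.prems(1)) simp
  ultimately obtain v where v: "v \<in> V m" "v \<notin> ?W" "\<forall>s\<in>S. \<exists>c. s *v v - c *s v \<in> ?W"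
    using S unfolding triangularizable_def by (metis DiffE)
  let ?w = "w(m := v)"
  have img: "?w ` {..<i} = w ` {..<i}" if "i \<le> m" for i
    using that by (intro image_cong) auto
  have img': "?w ` {..i} = w ` {..i}" if "i < m" for i
    using that by (intro image_cong) auto
  have imgm: "?w ` {..m} = insert v (w ` {..<m})"
    using img[of m] unfolding lessThan_Suc_atMost[symmetric] lessThan_Suc image_insert by simp
  have "?w i \<in> V i \<and> ?w i \<notin> vec.span (?w ` {..<i}) \<and> (\<forall>s\<in>S. s *v ?w i \<in> vec.span (?w ` {..i}))"
    if i: "i < Suc m" for i
  proof (cases "i = m")
    case True
    have "s *v v \<in> vec.span (insert v (w ` {..<m}))" if "s \<in> S" for s
      using v(3) that unfolding vec.span_breakdown_eq by blast
    then show ?thesis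
      using v unfolding True fun_upd_same img[OF order_refl] imgm by blast
  next
    case False
    with i have "i < m"
      by simp
    then show ?thesis
      using w by (simp add: img img')
  qed
  then show ?case
    by blast
qed

text \<open>The kernel vectors that end chains of length at least \<open>lam ! i\<close>. Sizes
  decrease with \<open>i\<close>, so these spaces grow.\<close>

definition chain_space :: "'n sqmat \<Rightarrow> nat \<Rightarrow> (complex, 'n) vec set" where
  "chain_space X i = {x. X *v x = 0 \<and> x \<in> range ((*v) X ^^ (lam ! i - 1))}"

lemma funpow_commute:
  fixes X :: "'m::finite sqmat"
  assumes "s ** X = X ** s"
  shows "((*v) X ^^ k) (s *v x) = s *v (((*v) X ^^ k) x)"
  by (induction k) (simp_all add: matrix_vector_mul_assoc assms)

lemma funpow_linear:
  fixes X :: "'m::finite sqmat"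
  shows "((*v) X ^^ k) (x + y) = ((*v) X ^^ k) x + ((*v) X ^^ k) y"
    and "((*v) X ^^ k) (c *s x) = c *s ((*v) X ^^ k) x"
  by (induction k) (simp_all add: vec.add vec.scale)

lemma stable_chain_space:
  assumes comm: "\<And>s. s \<in> S \<Longrightarrow> s ** X = X ** s"
  shows "stable S (chain_space X i)"
  unfolding stable_def
proof (intro conjI ballI)
  let ?L = "(*v) X ^^ (lam ! i - 1)"
  show "vec.subspace (chain_space X i)"
  proof (rule vec.subspaceI)
    show "0 \<in> chain_space X i"
      using funpow_mult_0[of "lam ! i - 1" X] by (auto simp: chain_space_def vec.zero intro: range_eqI[OF sym])
  next
    fix x y assume "x \<in> chain_space X i" "y \<in> chain_space X i"
    then show "x + y \<in> chain_space X i"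
      by (auto simp: chain_space_def vec.add simp flip: funpow_linear)
  next
    fix c x assume "x \<in> chain_space X i"
    then show "c *s x \<in> chain_space X i"
      by (auto simp: chain_space_def vec.scale simp flip: funpow_linear)
  qed
next
  fix s x assume s: "s \<in> S" and x: "x \<in> chain_space X i"
  then obtain y where y: "X *v x = 0" "x = ((*v) X ^^ (lam ! i - 1)) y"
    by (auto simp: chain_space_def)
  have "s *v x = ((*v) X ^^ (lam ! i - 1)) (s *v y)"
    using y funpow_commute[OF comm[OF s]] by simp
  moreover have "X *v (s *v x) = s *v (X *v x)"
    by (simp add: matrix_vector_mul_assoc comm[OF s])
  ultimately show "s *v x \<in> chain_space X i"
    using y(1) by (simp add: chain_space_def vec.zero)
qed

text \<open>The blocks up to \<open>i\<close> are at least as large as block \<open>i\<close>, so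
  their kernel vectors all qualify.\<close>

lemma chain_space_large:
  assumes g: "det g \<noteq> 0" "X ** g = g ** X0" and i: "i < length lam"
  shows "\<exists>B\<subseteq>chain_space X i. vec.independent B \<and> card B = Suc i"
proof (intro exI conjI)
  let ?e = "\<lambda>k. axis (box 0 k) 1 :: (complex, 'n) vec"
  let ?B = "(*v) g ` ?e ` {..i}"
  have injg: "inj ((*v) g)"
    by (rule injI) (metis g(1) matrix_inv_cancel(2) matrix_vector_mul_assoc matrix_vector_mul_lid)
  have box0: "box 0 k = box 0 l \<longleftrightarrow> k = l" if "k \<le> i" "l \<le> i" for k l
    using box(2)[of k 0] box(2)[of l 0] that i lam_nth_pos by (metis le_less_trans)
  have "?e ` {..i} \<subseteq> cart_basis"
    by (auto simp: cart_basis_def)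
  then have "vec.independent (?e ` {..i})"
    using independent_cart_basis vec.independent_mono by blast
  then show "vec.independent ?B"
    by (rule vec.linear_independent_injective_image[OF matrix_vector_mul_linear_gen _
          inj_on_subset[OF injg subset_UNIV]])
  have "card ?B = card {..i}"
    unfolding image_image
  proof (rule card_image, rule inj_onI)
    fix k l assume kl: "k \<in> {..i}" "l \<in> {..i}" "g *v ?e k = g *v ?e l"
    then have "?e k = ?e l"
      using injg by (simp add: inj_eq)
    then show "k = l"
      using kl box0 by (simp add: axis_eq_axis)
  qed
  then show "card ?B = Suc i"
    by simp
  show "?B \<subseteq> chain_space X i"
  proof clarsimp
    fix k assume k: "k \<le> i"
    then have kN: "k < length lam" and lam: "lam ! i \<le> lam ! k" "0 < lam ! k"
      using i lam_antimono lam_nth_pos by auto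
    let ?t = "axis (box (lam ! i - 1) k) 1 :: (complex, 'n) vec"
    have "(((*v) X0 ^^ (lam ! i - 1)) ?t) $ p = ?e k $ p" for p
    proof (cases "lev p + (lam ! i - 1) < lam ! idx p")
      case True
      have "box (lev p + (lam ! i - 1)) (idx p) = box (lam ! i - 1) k \<longleftrightarrow> p = box 0 k"
      proof
        assume eq: "box (lev p + (lam ! i - 1)) (idx p) = box (lam ! i - 1) k"
        have "lev p + (lam ! i - 1) = lam ! i - 1" "idx p = k"
          using arg_cong[OF eq, of lev] arg_cong[OF eq, of idx] kN lam True frame_range(1)[of p]
          by simp_all
        then show "p = box 0 k"
          using box_lev_idx[of p] by simp
      qed (use kN lam in simp)
      then show ?thesis
        unfolding X0_pow_vec using True by (simp add: axis_def)
    next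
      case False
      then have "p \<noteq> box 0 k"
        using kN lam by auto
      then show ?thesis
        unfolding X0_pow_vec using False by (simp add: axis_def)
    qed
    then have "((*v) X0 ^^ (lam ! i - 1)) ?t = ?e k"
      unfolding vec_eq_iff by blast
    then have "g *v ?e k = ((*v) X ^^ (lam ! i - 1)) (g *v ?t)"
      by (simp add: pow_conj[OF g(2)])
    moreover have "X *v (g *v ?e k) = 0"
      using g(2) kN lam unfolding conj_X0_iff by (simp add: matrix_vector_mult_axis)
    ultimately show "g *v ?e k \<in> chain_space X i"
      by (simp add: chain_space_def)
  qed
qed

text \<open>Only the kernel vectors of the Jordan basis have to be chosen: if \<open>s\<close> commutes with \<open>X\<close>, then
  \<open>X ^ j\<close> maps the image under \<open>s\<close> of the vector at level \<open>j\<close> to the image of the kernel vector, so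
  that the two expansions have the same coefficients up to terms of lower level.\<close>

theorem adapted_jordan_basis:
  assumes X: "has_jordan_type X lam" and S: "triangularizable S"
    and comm: "\<And>s. s \<in> S \<Longrightarrow> s ** X = X ** s"
  obtains g where "det g = 1" "X ** g = g ** X0"
    "\<And>s. s \<in> S \<Longrightarrow> upper_triangular (matrix_inv g ** s ** g)"
proof -
  let ?N = "length lam"
  obtain g0 where g0: "det g0 \<noteq> 0" "X ** g0 = g0 ** X0"
    using X has_jordan_type_iff by blast
  obtain w where w: "\<And>i. i < ?N \<Longrightarrow> w i \<in> chain_space X i"
    "\<And>i. i < ?N \<Longrightarrow> w i \<notin> vec.span (w ` {..<i})"
    "\<And>i s. i < ?N \<Longrightarrow> s \<in> S \<Longrightarrow> s *v w i \<in> vec.span (w ` {..i})"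
    using flag_exists[of S ?N "chain_space X"] S stable_chain_space[OF comm]
      chain_space_large[OF g0] by (metis (no_types, lifting))
  have "\<exists>t. \<forall>i<?N. w i = ((*v) X ^^ (lam ! i - 1)) (t i)"
    using w(1) by (intro choice) (auto simp: chain_space_def)
  then obtain t where t: "\<And>i. i < ?N \<Longrightarrow> ((*v) X ^^ (lam ! i - 1)) (t i) = w i"
    by metis
  \<comment> \<open>Block \<open>i\<close> is generated by one preimage \<open>t i\<close> of its
    kernel vector \<open>w i\<close>, so that the chain relations hold by construction.\<close>
  define v where "v p = ((*v) X ^^ (lam ! idx p - 1 - lev p)) (t (idx p))" for p
  define g where "g = (\<chi> r p. v p $ r)"
  have col: "column p g = v p" for p
    by (simp add: column_def g_def)
  have v0: "v p = w (idx p)" if "lev p = 0" for p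
    using that t frame_range(1) by (simp add: v_def)
  have Xv: "X *v v q = (if lev q = 0 then 0 else v (box (lev q - 1) (idx q)))" for q
  proof (cases "lev q = 0")
    case True
    then show ?thesis
      using v0[OF True] w(1)[of "idx q"] frame_range(1)[of q] by (simp add: chain_space_def)
  next
    case False
    then have "X *v v q = ((*v) X ^^ Suc (lam ! idx q - 1 - lev q)) (t (idx q))"
      by (simp add: v_def)
    also have "Suc (lam ! idx q - 1 - lev q) = lam ! idx q - 1 - (lev q - 1)"
      using frame_range(2)[of q] False by simp
    finally show ?thesis
      using False frame_range[of q] by (simp add: v_def)
  qed
  have conj: "X ** g = g ** X0"
    unfolding conj_X0_iff col using Xv by blast
  \<comment> \<open>A relation among the kernel vectors, solved for its last term, would put some
    \<open>w i\<close> into the span of the earlier ones.\<close>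
  have inj0: "x = 0" if x: "\<And>p. lev p \<noteq> 0 \<Longrightarrow> x $ p = 0" and gx: "g *v x = 0" for x
  proof (rule ccontr)
    assume "x \<noteq> 0"
    then have ne: "{p. x $ p \<noteq> 0} \<noteq> {}"
      by (auto simp: vec_eq_iff)
    let ?m = "Max {p. x $ p \<noteq> 0}"
    have m: "x $ ?m \<noteq> 0"
      using Max_in[OF _ ne] by simp
    have max: "q < ?m" if "x $ q \<noteq> 0" "q \<noteq> ?m" for q
      using Max_ge[of "{p. x $ p \<noteq> 0}" q] that by (simp add: order.strict_iff_order)
    have lev0: "lev q = 0" if "x $ q \<noteq> 0" for q
      using x that by blast
    have "(\<Sum>p\<in>UNIV. x $ p *s v p) = 0"
      using gx by (simp add: matrix_mult_sum col)
    then have "x $ ?m *s v ?m = - (\<Sum>p\<in>UNIV - {?m}. x $ p *s v p)"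
      by (simp add: sum.remove[of UNIV ?m] eq_neg_iff_add_eq_0)
    moreover have "(\<Sum>p\<in>UNIV - {?m}. x $ p *s v p) \<in> vec.span (w ` {..<idx ?m})"
    proof (rule vec.span_sum)
      fix p assume p: "p \<in> UNIV - {?m}"
      show "x $ p *s v p \<in> vec.span (w ` {..<idx ?m})"
      proof (cases "x $ p = 0")
        case True
        then show ?thesis
          by (simp add: vec.span_zero)
      next
        case False
        then have "p < ?m"
          using max p by simp
        then have "idx p < idx ?m"
          using lev0[OF m] lev0[OF False] by (simp add: less_iff)
        then show ?thesis
          using v0[OF lev0[OF False]] by (intro vec.span_scale vec.span_base) simp
      qed
    qed
    ultimately have "x $ ?m *s v ?m \<in> vec.span (w ` {..<idx ?m})"
      by (simp add: vec.span_neg)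
    then have "inverse (x $ ?m) *s (x $ ?m *s v ?m) \<in> vec.span (w ` {..<idx ?m})"
      by (rule vec.span_scale)
    then have "w (idx ?m) \<in> vec.span (w ` {..<idx ?m})"
      using m v0[OF lev0[OF m]] by simp
    then show False
      using w(2)[OF frame_range(1)] by blast
  qed
  have "x = 0" if "g *v x = 0" for x
    using pow_eq_0_imp[OF conj inj0, of 0 x] that by (simp add: vec_eq_iff)
  then have det: "det g \<noteq> 0"
    unfolding invertible_det_nz[symmetric] invertible_left_inverse matrix_left_invertible_ker by blast
  have upper: "upper_triangular (matrix_inv g ** s ** g)" if s: "s \<in> S" for s
    unfolding upper_triangular_def
  proof (intro allI impI)
    fix p q :: 'n assume "q < p"
    define x where "x = matrix_inv g *v (s *v v q)"
    have gx: "g *v x = s *v v q"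
      by (simp add: x_def matrix_vector_mul_assoc matrix_mul_assoc matrix_inv_cancel det)
    have entry: "(matrix_inv g ** s ** g) $ p $ q = x $ p"
      by (simp add: x_def col[symmetric] matrix_vector_mul_assoc)
        (simp add: matrix_matrix_mult_def matrix_vector_mult_def column_def)
    have Lv: "((*v) X ^^ lev q) (v q) = w (idx q)"
      using frame_range[of q] t[of "idx q"] by (simp add: v_def flip: funpow_add')
    have "((*v) X ^^ Suc (lev q)) (v q) = 0"
      using Lv w(1)[of "idx q"] frame_range(1)[of q] by (simp add: chain_space_def)
    then have "((*v) X ^^ Suc (lev q)) (g *v x) = 0"
      unfolding gx funpow_commute[OF comm[OF s]] by (simp add: vec.zero)
    \<comment> \<open>The power \<open>Suc (lev q)\<close> of \<open>X\<close> kills the chain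
      vector \<open>v q\<close> and hence its image under \<open>s\<close>, so no higher level
      occurs in \<open>x\<close>.\<close>
    then have zero: "x $ r = 0" if "lev q < lev r" for r
      using pow_eq_0_imp[OF conj inj0] that by (metis Suc_leI)
    have "g *v (((*v) X0 ^^ lev q) x) = s *v w (idx q)"
      by (simp add: pow_conj[OF conj, symmetric] gx funpow_commute[OF comm[OF s]] Lv)
    moreover have "s *v w (idx q) \<in> (*v) g ` {d. \<forall>r. \<not> (lev r = 0 \<and> idx r \<le> idx q) \<longrightarrow> d $ r = 0}"
      (is "_ \<in> (*v) g ` ?D")
    proof -
      have "vec.subspace ?D"
        by (rule vec.subspaceI) auto
      then have "vec.subspace ((*v) g ` ?D)"
        by (rule vec.subspace_image)
      moreover have "w ` {..idx q} \<subseteq> (*v) g ` ?D"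
      proof (rule image_subsetI)
        fix k assume k: "k \<in> {..idx q}"
        then have kN: "k < ?N"
          using frame_range(1)[of q] by simp
        have "w k = g *v axis (box 0 k) 1"
          using v0[of "box 0 k"] kN lam_nth_pos by (simp add: matrix_vector_mult_axis col)
        moreover have "axis (box 0 k) 1 \<in> ?D"
          using k kN lam_nth_pos by (simp add: axis_def)
        ultimately show "w k \<in> (*v) g ` ?D"
          by blast
      qed
      ultimately have "vec.span (w ` {..idx q}) \<subseteq> (*v) g ` ?D"
        by (rule vec.span_minimal[rotated])
      then show ?thesis
        using w(3)[OF frame_range(1) s] by blast
    qed
    ultimately obtain d where d: "d \<in> ?D" "g *v (((*v) X0 ^^ lev q) x) = g *v d"
      by auto
    have "((*v) X0 ^^ lev q) x - d = 0"
    proof (rule inj0)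
      show "g *v (((*v) X0 ^^ lev q) x - d) = 0"
        using d(2) by (simp add: vec.diff)
      show "(((*v) X0 ^^ lev q) x - d) $ r = 0" if "lev r \<noteq> 0" for r
        using that d(1) zero frame_range(1)[of r] by (auto simp: X0_pow_vec)
    qed
    then have eq: "((*v) X0 ^^ lev q) x = d"
      by simp
    show "(matrix_inv g ** s ** g) $ p $ q = 0"
    proof (cases "lev q < lev p")
      case True
      then show ?thesis
        using zero entry by simp
    next
      case False
      with \<open>q < p\<close> have p: "lev p = lev q" "idx q < idx p"
        by (auto simp: less_iff)
      have "d $ box 0 (idx p) = x $ p"
        unfolding eq[symmetric] using frame_range[of p] lam_nth_pos[of "idx p"] p(1)[symmetric]
        by (simp add: X0_pow_vec)
      moreover have "d $ box 0 (idx p) = 0"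
        using d(1) p(2) frame_range(1)[of p] lam_nth_pos[of "idx p"] by force
      ultimately show ?thesis
        using entry by simp
    qed
  qed
  obtain c where c: "c \<noteq> 0" "det (cscale c g) = 1"
    by (rule scale_to_SLn[OF det])
  have inv: "matrix_inv (cscale c g) = cscale (inverse c) (matrix_inv g)"
    using c(1) det by (intro matrix_inv_unique)
      (simp add: cscale_mult_left cscale_mult_right matrix_inv_cancel)
  show thesis
  proof (rule that[OF c(2)])
    show "X ** cscale c g = cscale c g ** X0"
      by (simp add: cscale_mult_left cscale_mult_right conj)
    show "upper_triangular (matrix_inv (cscale c g) ** s ** cscale c g)" if "s \<in> S" for s
      using upper[OF that] c(1) by (simp add: inv cscale_mult_left cscale_mult_right)
  qed
qed

end

subsection \<open>Solvability of groups of triangular matrices\<close>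

definition height :: "'n::{finite,linorder} \<Rightarrow> nat" where
  "height p = card {..<p}"

lemma height_strict_mono: "p < q \<Longrightarrow> height p < height q"
  unfolding height_def by (intro psubset_card_mono) auto

lemma height_le: "p \<le> q \<longleftrightarrow> height p \<le> height q"
  using height_strict_mono[of p q] height_strict_mono[of q p] by (cases p q rule: linorder_cases) auto

lemma height_less_card: "height (p :: 'n::{finite,linorder}) < CARD('n)"
  unfolding height_def by (intro psubset_card_mono) auto

definition upper_filtration :: "nat \<Rightarrow> 'n::{finite,linorder} sqmat set" where
  "upper_filtration k = coord_space {(p, q). height p + k \<le> height q}"

lemma upper_filtration_iff:
  "x \<in> upper_filtration k \<longleftrightarrow> (\<forall>p q. x $ p $ q \<noteq> 0 \<longrightarrow> height p + k \<le> height q)"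
  by (simp add: upper_filtration_def coord_space_def)

lemma upper_filtration_0: "x \<in> upper_filtration 0 \<longleftrightarrow> upper_triangular x"
  by (auto simp: upper_filtration_def upper_triangular_conv_coord[symmetric] height_le[symmetric])

lemma upper_filtration_antimono: "k \<le> l \<Longrightarrow> upper_filtration l \<subseteq> upper_filtration k"
  by (fastforce simp: upper_filtration_iff)

lemma upper_filtration_mult:
  assumes "x \<in> upper_filtration k" "y \<in> upper_filtration l"
  shows "x ** y \<in> upper_filtration (k + l)"
  unfolding upper_filtration_iff
proof (intro allI impI)
  fix p q assume "(x ** y) $ p $ q \<noteq> 0"
  then have "(\<Sum>r\<in>UNIV. x $ p $ r * y $ r $ q) \<noteq> 0"
    by (simp add: matrix_matrix_mult_def)
  then obtain r where "x $ p $ r * y $ r $ q \<noteq> 0"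
    by (rule sum.not_neutral_contains_not_neutral)
  then have "height p + k \<le> height r" "height r + l \<le> height q"
    using assms by (auto simp: upper_filtration_iff)
  then show "height p + (k + l) \<le> height q"
    by simp
qed

text \<open>At \<open>k = 0\<close> this is the full triangular group of determinant 1, from
  \<open>k = 1\<close> on its members are unipotent; one family thus bounds the whole derived
  series.\<close>

definition unitriangular :: "nat \<Rightarrow> 'n::{finite,linorder} sqmat set" where
  "unitriangular k = {g. det g = 1 \<and> upper_triangular g \<and> g - mat 1 \<in> upper_filtration k}"

lemma subspace_upper_filtration: "cmat.subspace (upper_filtration k)"
  by (simp add: upper_filtration_def subspace_coord_space)

lemmas upper_filtration_add = cmat.subspace_add[OF subspace_upper_filtration]
lemmas upper_filtration_diff = cmat.subspace_diff[OF subspace_upper_filtration]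
lemmas upper_filtration_neg = cmat.subspace_neg[OF subspace_upper_filtration]

lemma matrix_diff_ldistrib:
  fixes A B C :: "'n::finite sqmat"
  shows "A ** (B - C) = A ** B - A ** C"
  by (rule bounded_bilinear.diff_right[OF bounded_bilinear_matrix_mult])

lemma matrix_diff_rdistrib:
  fixes A B C :: "'n::finite sqmat"
  shows "(A - B) ** C = A ** C - B ** C"
  by (rule bounded_bilinear.diff_left[OF bounded_bilinear_matrix_mult])

lemma subgroup_unitriangular:
  "subgroup (unitriangular k :: 'n::{finite,linorder} sqmat set) SLn"
proof (rule subgroup_SLnI)
  show "mat 1 \<in> unitriangular k"
    by (simp add: unitriangular_def upper_triangular_mat_1 cmat.subspace_0[OF subspace_upper_filtration])
next
  fix x :: "'n sqmat" assume "x \<in> unitriangular k"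
  then show "det x = 1"
    by (simp add: unitriangular_def)
next
  fix x y :: "'n sqmat" assume xy: "x \<in> unitriangular k" "y \<in> unitriangular k"
  have eq: "x ** y - mat 1 = (x - mat 1) ** y + (y - mat 1)"
    by (simp add: matrix_diff_rdistrib)
  have "(x - mat 1) ** y \<in> upper_filtration k"
    using upper_filtration_mult[of "x - mat 1" k y 0] xy
    by (simp add: unitriangular_def upper_filtration_0)
  then have "x ** y - mat 1 \<in> upper_filtration k"
    unfolding eq using xy by (intro upper_filtration_add) (simp_all add: unitriangular_def)
  then show "x ** y \<in> unitriangular k"
    using xy by (simp add: unitriangular_def det_mul upper_triangular_mult)
next
  fix x :: "'n sqmat" assume x: "x \<in> unitriangular k"
  have det: "det x \<noteq> 0" and inv: "upper_triangular (matrix_inv x)"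
    using x by (auto simp: unitriangular_def upper_triangular_inv)
  have eq: "matrix_inv x - mat 1 = - (matrix_inv x ** (x - mat 1))"
    by (simp add: matrix_diff_ldistrib matrix_inv_cancel det)
  have "matrix_inv x ** (x - mat 1) \<in> upper_filtration k"
    using upper_filtration_mult[of "matrix_inv x" 0 "x - mat 1" k] x inv
    by (simp add: unitriangular_def upper_filtration_0)
  then have "matrix_inv x - mat 1 \<in> upper_filtration k"
    unfolding eq by (rule upper_filtration_neg)
  then show "matrix_inv x \<in> unitriangular k"
    using x inv by (simp add: unitriangular_def det_matrix_inv)
qed

lemma diag_upper_mult:
  assumes "upper_triangular x" "upper_triangular y"
  shows "(x ** y) $ p $ p = x $ p $ p * y $ p $ p"
proof -
  have "(x ** y) $ p $ p = (\<Sum>r\<in>UNIV. x $ p $ r * y $ r $ p)"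
    by (simp add: matrix_matrix_mult_def)
  also have "\<dots> = (\<Sum>r\<in>{p}. x $ p $ r * y $ r $ p)"
    using assms by (intro sum.mono_neutral_right) (auto simp: upper_triangular_def neq_iff)
  finally show ?thesis
    by simp
qed

text \<open>At \<open>k = 0\<close> the diagonals of \<open>x ** y\<close> and \<open>y ** x\<close>
  agree. For larger \<open>k\<close> the bracket is that of \<open>x - mat 1\<close> and
  \<open>y - mat 1\<close>, at depth \<open>k + k\<close>, which is at least
  \<open>Suc k\<close>.\<close>

lemma bracket_upper_filtration:
  assumes x: "x \<in> unitriangular k" and y: "y \<in> unitriangular k"
  shows "x ** y - y ** x \<in> upper_filtration (Suc k)"
proof (cases "k = 0")
  case True
  have ut: "upper_triangular x" "upper_triangular y"
    using x y by (auto simp: unitriangular_def)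
  have "upper_triangular (x ** y - y ** x)"
    using upper_triangular_mult[OF ut] upper_triangular_mult[OF ut(2,1)]
    by (simp add: upper_triangular_def)
  moreover have "(x ** y - y ** x) $ p $ p = 0" for p
    using diag_upper_mult[OF ut] diag_upper_mult[OF ut(2,1)] by (simp add: mult.commute)
  ultimately show ?thesis
    unfolding upper_filtration_iff True upper_triangular_def
    by (metis One_nat_def Suc_leI add.commute height_strict_mono linorder_cases plus_1_eq_Suc)
next
  case False
  have "x ** y - y ** x = (x - mat 1) ** (y - mat 1) - (y - mat 1) ** (x - mat 1)"
    by (simp add: matrix_diff_ldistrib matrix_diff_rdistrib)
  also have "\<dots> \<in> upper_filtration (k + k)"
    using x y by (auto intro!: upper_filtration_diff[of "_ ** _"] upper_filtration_mult
        simp: unitriangular_def)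
  also have "\<dots> \<subseteq> upper_filtration (Suc k)"
    using False by (intro upper_filtration_antimono) simp
  finally show ?thesis .
qed

text \<open>A commutator minus \<open>mat 1\<close> is the bracket \<open>x ** y - y ** x\<close>
  times the inverse of \<open>y ** x\<close>, and a triangular factor preserves the depth.\<close>

lemma derived_unitriangular:
  "derived SLn (unitriangular k) \<subseteq> (unitriangular (Suc k) :: 'n::{finite,linorder} sqmat set)"
  unfolding derived_def
proof (rule SLn.generate_subgroup_incl[OF _ subgroup_unitriangular])
  show "derived_set SLn (unitriangular k) \<subseteq> (unitriangular (Suc k) :: 'n sqmat set)"
  proof (intro UN_least)
    fix x y :: "'n sqmat"
    assume xy: "x \<in> unitriangular k" "y \<in> unitriangular k"
    have d: "det x = 1" "det y = 1" and ut: "upper_triangular x" "upper_triangular y"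
      using xy by (auto simp: unitriangular_def)
    let ?c = "x ** y ** matrix_inv x ** matrix_inv y"
    have ui: "upper_triangular (matrix_inv x ** matrix_inv y)"
      using ut d by (simp add: upper_triangular_inv upper_triangular_mult)
    have c1: "y ** x ** (matrix_inv x ** matrix_inv y) = mat 1"
    proof -
      have "y ** x ** (matrix_inv x ** matrix_inv y) = y ** (x ** matrix_inv x) ** matrix_inv y"
        by (simp add: matrix_mul_assoc)
      then show ?thesis
        by (simp add: matrix_inv_cancel d)
    qed
    have "?c - mat 1 = (x ** y - y ** x) ** (matrix_inv x ** matrix_inv y)"
      unfolding matrix_diff_rdistrib c1 by (simp add: matrix_mul_assoc)
    also have "\<dots> \<in> upper_filtration (Suc k + 0)"
      using bracket_upper_filtration[OF xy] ui
      by (intro upper_filtration_mult) (simp_all add: upper_filtration_0)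
    finally have "?c - mat 1 \<in> upper_filtration (Suc k)"
      by simp
    then have "?c \<in> unitriangular (Suc k)"
      using d ut by (simp add: unitriangular_def det_mul det_matrix_inv upper_triangular_inv
          upper_triangular_mult)
    then show "{x \<otimes>\<^bsub>SLn\<^esub> y \<otimes>\<^bsub>SLn\<^esub> inv\<^bsub>SLn\<^esub> x \<otimes>\<^bsub>SLn\<^esub> inv\<^bsub>SLn\<^esub> y} \<subseteq> unitriangular (Suc k)"
      using d by simp
  qed
qed

text \<open>After \<open>CARD('n)\<close> steps the filtration has run out of
  superdiagonals.\<close>

lemma solvable_seq_upper:
  fixes H :: "'n::{finite,linorder} sqmat set"
  assumes H: "subgroup H SLn" and ut: "\<And>h. h \<in> H \<Longrightarrow> upper_triangular h"
  shows "solvable_seq SLn H"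
proof (rule SLn.trivial_derived_seq_imp_solvable[OF H])
  have "H \<subseteq> unitriangular 0"
    using ut subgroup_SLnD(2)[OF H]
    by (auto simp: unitriangular_def upper_filtration_0 intro: cmat.subspace_diff[OF
        subspace_upper_triangular, simplified] upper_triangular_mat_1)
  moreover have "(derived SLn ^^ k) (unitriangular 0) \<subseteq> (unitriangular k :: 'n sqmat set)" for k
  proof (induction k)
    case (Suc k)
    then show ?case
      using SLn.mono_derived[OF Suc] derived_unitriangular[of k] by auto
  qed simp
  ultimately have "(derived SLn ^^ CARD('n)) H \<subseteq> unitriangular CARD('n)"
    using SLn.mono_exp_of_derived by blast
  also have "\<dots> \<subseteq> {mat 1}"
  proof
    fix x :: "'n sqmat" assume "x \<in> unitriangular CARD('n)"
    then have "(x - mat 1) $ p $ q = 0" for p q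
      using height_less_card[of q] unfolding unitriangular_def upper_filtration_iff
      by (metis (mono_tags, lifting) mem_Collect_eq add_leD2 not_le)
    then show "x \<in> {mat 1}"
      by (simp add: vec_eq_iff)
  qed
  finally have "(derived SLn ^^ CARD('n)) H \<subseteq> {mat 1}" .
  moreover have "mat 1 \<in> (derived SLn ^^ CARD('n)) H"
    using subgroup_SLnD(1)[OF SLn.exp_of_derived_is_subgroup[OF H]] .
  ultimately show "(derived SLn ^^ CARD('n)) H = {\<one>\<^bsub>SLn\<^esub>}"
    by auto
qed

lemma solvable_carrier_update:
  assumes H: "subgroup H SLn" and "solvable_seq SLn H"
  shows "solvable (SLn\<lparr>carrier := H\<rparr>)"
proof -
  interpret GH: group "SLn\<lparr>carrier := H\<rparr>"
    by (rule subgroup.subgroup_is_group[OF H group_SLn])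
  obtain n where n: "(derived SLn ^^ n) H = {mat 1}"
    using SLn.solvable_imp_trivial_derived_seq[OF assms(2)] by auto
  have "(derived (SLn\<lparr>carrier := H\<rparr>) ^^ n) H = (derived SLn ^^ n) H
      \<and> (derived SLn ^^ n) H \<subseteq> H" for n
  proof (induction n)
    case (Suc n)
    then show ?case
      using SLn.derived_consistent[OF _ H] SLn.derived_incl[OF _ H] by simp
  qed simp
  then have "(derived (SLn\<lparr>carrier := H\<rparr>) ^^ n) (carrier (SLn\<lparr>carrier := H\<rparr>)) =
      {\<one>\<^bsub>SLn\<lparr>carrier := H\<rparr>\<^esub>}"
    using n by simp
  then show ?thesis
    using GH.solvable_iff_trivial_derived_seq by blast
qed

subsection \<open>Identity components, conjugation and Lie algebras\<close>

lemma subgroup_connected_component: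
  fixes P :: "'n::finite sqmat set"
  assumes P: "subgroup P SLn"
  shows "subgroup (connected_component_set P (mat 1)) SLn"
proof (rule subgroup_SLnI)
  let ?C = "connected_component_set P (mat 1)"
  note sg = subgroup_SLnD[OF P]
  have sub: "?C \<subseteq> P" and conn: "connected ?C"
    by (auto simp: connected_component_subset)
  show one: "mat 1 \<in> ?C"
    using sg(1) by simp
  show "det x = 1" if "x \<in> ?C" for x
    using sub sg(2) that by blast
  show "x ** y \<in> ?C" if x: "x \<in> ?C" and y: "y \<in> ?C" for x y
  proof -
    have "(\<lambda>y. x ** y) ` ?C \<subseteq> connected_component_set P x"
    proof (rule connected_component_maximal)
      show "x \<in> (\<lambda>y. x ** y) ` ?C"
        using one by (intro image_eqI[of _ _ "mat 1"]) simp_all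
      show "connected ((\<lambda>y. x ** y) ` ?C)"
        by (intro connected_continuous_image conn continuous_intros)
      show "(\<lambda>y. x ** y) ` ?C \<subseteq> P"
        using sub x sg(3) by blast
    qed
    also have "connected_component_set P x = ?C"
      using x connected_component_eq by blast
    finally show ?thesis
      using y by blast
  qed
  show "matrix_inv x \<in> ?C" if x: "x \<in> ?C" for x
  proof -
    have "matrix_inv ` ?C \<subseteq> ?C"
    proof (rule connected_component_maximal)
      show "mat 1 \<in> matrix_inv ` ?C"
        using one by (intro image_eqI[of _ _ "mat 1"]) simp_all
      show "connected (matrix_inv ` ?C)"
        using sub sg(2) by (intro connected_continuous_image conn continuous_intros) auto
      show "matrix_inv ` ?C \<subseteq> P"
        using sub sg(4) by blast
    qed
    then show ?thesis
      using x by blast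
  qed
qed

abbreviation conj_by :: "'n::finite sqmat \<Rightarrow> 'n sqmat \<Rightarrow> 'n sqmat" where
  "conj_by g \<equiv> \<lambda>x. g ** x ** matrix_inv g"

lemma conj_by_mult:
  assumes "det g \<noteq> 0"
  shows "conj_by g (x ** y) = conj_by g x ** conj_by g y"
proof -
  have "conj_by g x ** conj_by g y = g ** x ** (matrix_inv g ** g) ** y ** matrix_inv g"
    by (simp add: matrix_mul_assoc)
  then show ?thesis
    by (simp add: matrix_inv_cancel assms matrix_mul_assoc)
qed

lemma conj_by_inverse:
  assumes "det g \<noteq> 0"
  shows "conj_by g (matrix_inv g ** x ** g) = x" "matrix_inv g ** conj_by g x ** g = x"
proof -
  have "conj_by g (matrix_inv g ** x ** g) = (g ** matrix_inv g) ** x ** (g ** matrix_inv g)"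
    by (simp add: matrix_mul_assoc)
  then show "conj_by g (matrix_inv g ** x ** g) = x"
    by (simp add: matrix_inv_cancel assms)
  have "matrix_inv g ** conj_by g x ** g = (matrix_inv g ** g) ** x ** (matrix_inv g ** g)"
    by (simp add: matrix_mul_assoc)
  then show "matrix_inv g ** conj_by g x ** g = x"
    by (simp add: matrix_inv_cancel assms)
qed

lemma conj_by_hom:
  assumes "det g = 1"
  shows "group_hom SLn SLn (conj_by g)"
  by (intro group_hom.intro group_SLn group_hom_axioms.intro homI)
    (use assms in \<open>auto simp: det_mul det_matrix_inv conj_by_mult\<close>)

lemma has_vector_derivative_matrix_mult:
  fixes g h :: "'n::finite sqmat"
  assumes "(f has_vector_derivative v) F"
  shows "((\<lambda>t. g ** f t ** h) has_vector_derivative (g ** v ** h)) F"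
proof -
  have "bounded_linear (\<lambda>x. g ** x ** h)"
    by (intro bounded_linear_compose[OF
        bounded_bilinear.bounded_linear_left[OF bounded_bilinear_matrix_mult]
        bounded_bilinear.bounded_linear_right[OF bounded_bilinear_matrix_mult]])
  then show ?thesis
    using assms by (rule bounded_linear.has_vector_derivative)
qed

lemma has_vector_derivative_matrix:
  fixes f :: "real \<Rightarrow> 'n::finite sqmat"
  assumes "\<And>p q. ((\<lambda>t. f t $ p $ q) has_vector_derivative v $ p $ q) (at x)"
  shows "(f has_vector_derivative v) (at x)"
  unfolding has_vector_derivative_def
proof (subst has_derivative_componentwise_within, intro ballI)
  fix b :: "'n sqmat" assume "b \<in> Basis"
  then obtain p q c where b: "b = axis p (axis q c)"
    by (auto simp: Basis_vec_def)
  have "((\<lambda>t. f t $ p $ q \<bullet> c) has_derivative (\<lambda>t. (t *\<^sub>R v $ p $ q) \<bullet> c)) (at x)"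
    using assms[of p q] by (intro has_derivative_inner_left) (simp add: has_vector_derivative_def)
  then show "((\<lambda>t. f t \<bullet> b) has_derivative (\<lambda>t. (t *\<^sub>R v) \<bullet> b)) (at x)"
    by (simp add: b inner_axis)
qed

lemma lie_algebra_conj:
  fixes g :: "'n::finite sqmat"
  assumes g: "det g \<noteq> 0"
  shows "lie_algebra (conj_by g ` H) = conj_by g ` lie_algebra H"
proof -
  have *: "conj_by g v \<in> lie_algebra (conj_by g ` H)" if v: "v \<in> lie_algebra H" and g: "det g \<noteq> 0"
    for g v :: "'n sqmat" and H
  proof -
    obtain \<gamma> where \<gamma>: "\<forall>t. \<gamma> t \<in> H" "\<gamma> 0 = mat 1" "(\<gamma> has_vector_derivative v) (at 0)"
      using v by (auto simp: lie_algebra_def)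
    have "((\<lambda>t. conj_by g (\<gamma> t)) has_vector_derivative conj_by g v) (at 0)"
      by (rule has_vector_derivative_matrix_mult[OF \<gamma>(3)])
    then show ?thesis
      unfolding lie_algebra_def using \<gamma> g
      by (intro CollectI exI[of _ "\<lambda>t. conj_by g (\<gamma> t)"]) (simp add: matrix_inv_cancel)
  qed
  show ?thesis
  proof
    show "conj_by g ` lie_algebra H \<subseteq> lie_algebra (conj_by g ` H)"
      using * g by blast
    show "lie_algebra (conj_by g ` H) \<subseteq> conj_by g ` lie_algebra H"
    proof
      fix v assume "v \<in> lie_algebra (conj_by g ` H)"
      then have "conj_by (matrix_inv g) v \<in> lie_algebra (conj_by (matrix_inv g) ` conj_by g ` H)"
        using g by (intro *) (auto simp: det_matrix_inv)
      then have "matrix_inv g ** v ** g \<in> lie_algebra H"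
        by (simp add: matrix_inv_inv[OF g] image_image conj_by_inverse[OF g])
      then have "conj_by g (matrix_inv g ** v ** g) \<in> conj_by g ` lie_algebra H"
        by blast
      then show "v \<in> conj_by g ` lie_algebra H"
        by (simp only: conj_by_inverse[OF g])
    qed
  qed
qed

text \<open>No condition on trace or determinant, so that it is a linear space, the kernel of the
  commutator map on triangular matrices. The group is its part of determinant 1.\<close>

definition upper_centralizer :: "'n::{finite,linorder} sqmat \<Rightarrow> 'n sqmat set" where
  "upper_centralizer X = {a. upper_triangular a \<and> a ** X = X ** a}"

lemma cscale_nth: "cscale c A $ i $ j = c * A $ i $ j"
  by (simp add: cscale_def)

lemma subspace_upper_centralizer: "cmat.subspace (upper_centralizer X)"
  unfolding upper_centralizer_def
  by (rule cmat.subspaceI) (auto simp: upper_triangular_def matrix_add_ldistrib matrix_add_rdistrib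
      cscale_mult_left cscale_mult_right cscale_nth)

lemma mat_1_upper_centralizer: "mat 1 \<in> upper_centralizer X"
  by (simp add: upper_centralizer_def upper_triangular_mat_1)

lemma subgroup_upper_centralizer: "subgroup (upper_centralizer X \<inter> {g. det g = 1}) SLn"
proof (rule subgroup_SLnI)
  fix x y
  assume xy: "x \<in> upper_centralizer X \<inter> {g. det g = 1}" "y \<in> upper_centralizer X \<inter> {g. det g = 1}"
  then have "x ** y ** X = X ** (x ** y)"
    by (simp add: upper_centralizer_def) (metis matrix_mul_assoc)
  then show "x ** y \<in> upper_centralizer X \<inter> {g. det g = 1}"
    using xy by (auto simp: upper_centralizer_def upper_triangular_mult det_mul)
next
  fix x assume x: "x \<in> upper_centralizer X \<inter> {g. det g = 1}"
  then have "matrix_inv x ** (x ** X) ** matrix_inv x = matrix_inv x ** (X ** x) ** matrix_inv x"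
    by (simp add: upper_centralizer_def)
  then have "(matrix_inv x ** x) ** X ** matrix_inv x = matrix_inv x ** X ** (x ** matrix_inv x)"
    by (simp add: matrix_mul_assoc)
  then show "matrix_inv x \<in> upper_centralizer X \<inter> {g. det g = 1}"
    using x by (auto simp: upper_centralizer_def upper_triangular_inv det_matrix_inv matrix_inv_cancel)
qed (auto simp: mat_1_upper_centralizer)

text \<open>Triangularity and commutation are linear conditions and pass to the velocity; the
  product of the diagonal entries, constantly 1, differentiates to the trace.\<close>

lemma lie_algebra_upper_subset:
  fixes X :: "'n::{finite,linorder} sqmat"
  assumes H: "H \<subseteq> upper_centralizer X \<inter> {g. det g = 1}"
  shows "lie_algebra H \<subseteq> {a \<in> upper_centralizer X. trace a = 0}"
proof
  fix v assume "v \<in> lie_algebra H"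
  then obtain \<gamma> where \<gamma>: "\<And>t. \<gamma> t \<in> H" "\<gamma> 0 = mat 1" "(\<gamma> has_vector_derivative v) (at 0)"
    by (auto simp: lie_algebra_def)
  have comp: "((\<lambda>t. \<gamma> t $ p $ q) has_vector_derivative v $ p $ q) (at 0)" for p q
  proof -
    have "bounded_linear (\<lambda>x :: 'n sqmat. x $ p $ q)"
      by (intro bounded_linear_compose[OF bounded_linear_vec_nth bounded_linear_vec_nth])
    then show ?thesis
      using \<gamma>(3) by (rule bounded_linear.has_vector_derivative)
  qed
  have "v $ p $ q = 0" if "q < p" for p q
  proof -
    have "\<gamma> t $ p $ q = 0" for t
      using \<gamma>(1)[of t] H that by (auto simp: upper_centralizer_def upper_triangular_def)
    then have "((\<lambda>t. 0) has_vector_derivative v $ p $ q) (at (0 :: real))"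
      using comp[of p q] by simp
    then show ?thesis
      using vector_derivative_unique_at has_vector_derivative_const by blast
  qed
  moreover have "v ** X = X ** v"
  proof -
    have "((\<lambda>t. mat 1 ** \<gamma> t ** X - X ** \<gamma> t ** mat 1) has_vector_derivative
        (mat 1 ** v ** X - X ** v ** mat 1)) (at 0)"
      by (intro has_vector_derivative_diff has_vector_derivative_matrix_mult \<gamma>(3))
    moreover have "mat 1 ** \<gamma> t ** X - X ** \<gamma> t ** mat 1 = 0" for t
      using \<gamma>(1)[of t] H by (auto simp: upper_centralizer_def)
    ultimately have "((\<lambda>t. 0) has_vector_derivative v ** X - X ** v) (at (0 :: real))"
      by simp
    then show ?thesis
      using vector_derivative_unique_at has_vector_derivative_const by fastforce
  qed
  moreover have "trace v = 0"
  proof -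
    have "((\<lambda>t. \<Prod>p\<in>UNIV. \<gamma> t $ p $ p) has_derivative
        (\<lambda>y. \<Sum>p\<in>UNIV. (y *\<^sub>R v $ p $ p) * (\<Prod>q\<in>UNIV - {p}. \<gamma> 0 $ q $ q))) (at 0)"
      using comp by (intro has_derivative_prod) (simp add: has_vector_derivative_def)
    moreover have "(\<Prod>p\<in>UNIV. \<gamma> t $ p $ p) = 1" for t
    proof -
      have "\<gamma> t \<in> upper_centralizer X \<inter> {g. det g = 1}"
        using \<gamma>(1) H by blast
      then show ?thesis
        using det_upper_triangular[of "\<gamma> t"] by (auto simp: upper_centralizer_def)
    qed
    moreover have "(\<Prod>q\<in>UNIV - {p}. \<gamma> 0 $ q $ q) = 1" for p
      by (simp add: \<gamma>(2) mat_def)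
    ultimately have "((\<lambda>t. 1) has_vector_derivative trace v) (at (0 :: real))"
      by (simp add: has_vector_derivative_def trace_def scaleR_sum_right)
    then show ?thesis
      using vector_derivative_unique_at has_vector_derivative_const by blast
  qed
  ultimately show "v \<in> {a \<in> upper_centralizer X. trace a = 0}"
    by (simp add: upper_centralizer_def upper_triangular_def)
qed

text \<open>A trace-free \<open>v\<close> is the velocity of the curve that exponentiates only the diagonal of \<open>v\<close>; this
  requires the hypothesis that exponentiating a diagonal in the centralizer stays there.\<close>

lemma lie_algebra_upper_superset:
  fixes X :: "'n::{finite,linorder} sqmat"
  assumes diag: "\<And>a p q. a \<in> upper_centralizer X \<Longrightarrow> X $ p $ q \<noteq> 0 \<Longrightarrow> a $ p $ p = a $ q $ q"
    and H: "connected_component_set (upper_centralizer X \<inter> {g. det g = 1}) (mat 1) \<subseteq> H"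
  shows "{a \<in> upper_centralizer X. trace a = 0} \<subseteq> lie_algebra H"
proof
  fix v assume "v \<in> {a \<in> upper_centralizer X. trace a = 0}"
  then have v: "v \<in> upper_centralizer X" "upper_triangular v" "v ** X = X ** v" "trace v = 0"
    by (auto simp: upper_centralizer_def)
  let ?P = "upper_centralizer X \<inter> {g. det g = 1}"
  define D where "D f = (\<chi> p q. if p = q then f (v $ p $ p) else (0 :: complex))" for f
  define E where "E = v - D (\<lambda>z. z)"
  define \<gamma> where "\<gamma> t = D (\<lambda>z. exp (t *\<^sub>R z)) + t *\<^sub>R E" for t
  \<comment> \<open>By \<open>diag\<close>, the diagonal entries of \<open>v\<close> at
    \<open>p\<close> and \<open>q\<close> agree wherever \<open>X\<close> links \<open>p\<close> and
    \<open>q\<close>, so every function of the diagonal commutes with \<open>X\<close>.\<close>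
  have D_comm: "D f ** X = X ** D f" for f
  proof -
    have "(D f ** X) $ p $ q = f (v $ p $ p) * X $ p $ q" for p q
      by (simp add: D_def matrix_matrix_mult_def if_distrib if_distribR cong: if_cong)
    moreover have "(X ** D f) $ p $ q = f (v $ q $ q) * X $ p $ q" for p q
      by (simp add: D_def matrix_matrix_mult_def if_distrib if_distribR cong: if_cong)
    ultimately have "(D f ** X) $ p $ q = (X ** D f) $ p $ q" for p q
      using diag[OF v(1), of p q] by (cases "X $ p $ q = 0") simp_all
    then show ?thesis
      by (simp add: vec_eq_iff)
  qed
  have E_comm: "E ** X = X ** E"
    by (simp add: E_def matrix_diff_ldistrib matrix_diff_rdistrib v(3) D_comm)
  have nth: "\<gamma> t $ p $ q = (if p = q then exp (t *\<^sub>R v $ p $ p) else t *\<^sub>R v $ p $ q)" for t p q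
    by (simp add: \<gamma>_def D_def E_def)
  have ut: "upper_triangular (\<gamma> t)" for t
    using v(2) by (simp add: upper_triangular_def nth)
  have det: "det (\<gamma> t) = 1" for t
  proof -
    have "det (\<gamma> t) = (\<Prod>p\<in>UNIV. exp (t *\<^sub>R v $ p $ p))"
      by (simp add: det_upper_triangular[OF ut] nth)
    also have "\<dots> = exp (\<Sum>p\<in>UNIV. t *\<^sub>R v $ p $ p)"
      by (simp add: exp_sum)
    also have "\<dots> = exp (t *\<^sub>R trace v)"
      by (simp add: trace_def scaleR_sum_right)
    finally show ?thesis
      by (simp add: v(4))
  qed
  have "\<gamma> t ** X = X ** \<gamma> t" for t
    unfolding \<gamma>_def using E_comm D_comm
    by (simp add: matrix_add_ldistrib matrix_add_rdistrib
        bounded_bilinear.scaleR_left[OF bounded_bilinear_matrix_mult]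
        bounded_bilinear.scaleR_right[OF bounded_bilinear_matrix_mult])
  then have P: "\<gamma> t \<in> ?P" for t
    using ut det by (simp add: upper_centralizer_def)
  have g0: "\<gamma> 0 = mat 1"
    by (simp add: vec_eq_iff nth mat_def)
  have deriv: "(\<gamma> has_vector_derivative v) (at 0)"
  proof (rule has_vector_derivative_matrix)
    fix p q
    have "((\<lambda>t. exp (t *\<^sub>R v $ p $ p)) has_vector_derivative v $ p $ p) (at 0)"
      using exp_scaleR_has_vector_derivative_right[of "v $ p $ p" 0 UNIV] by simp
    moreover have "((\<lambda>t. t *\<^sub>R v $ p $ q) has_vector_derivative v $ p $ q) (at 0)"
      by (auto simp: has_vector_derivative_def intro!: derivative_eq_intros)
    ultimately show "((\<lambda>t. \<gamma> t $ p $ q) has_vector_derivative v $ p $ q) (at 0)"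
      unfolding nth by (cases "p = q") simp_all
  qed
  have "continuous_on UNIV (\<lambda>t. \<chi> p q. \<gamma> t $ p $ q)"
    unfolding nth
  proof (intro continuous_on_vec_lambda)
    fix p q
    show "continuous_on UNIV (\<lambda>t. if p = q then exp (t *\<^sub>R v $ p $ p) else t *\<^sub>R v $ p $ q)"
      by (cases "p = q") (auto intro!: continuous_intros)
  qed
  then have "connected (range \<gamma>)"
    by (intro connected_continuous_image) (simp_all add: connected_UNIV)
  then have "range \<gamma> \<subseteq> connected_component_set ?P (mat 1)"
    using P g0 by (intro connected_component_maximal) (auto intro: range_eqI[of _ _ 0])
  then have "\<forall>t. \<gamma> t \<in> H"
    using H by blast
  then show "v \<in> lie_algebra H"
    using g0 deriv unfolding lie_algebra_def by blast
qed

subsection \<open>The minimal ideal and the Borel subgroups of the centralizer\<close>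

lemma centralizer_iff: "h \<in> centralizer X \<longleftrightarrow> det h = 1 \<and> h ** X = X ** h"
proof -
  have "Ad h X = X \<longleftrightarrow> h ** X = X ** h" if "det h = 1"
  proof
    assume "Ad h X = X"
    then have "h ** X ** (matrix_inv h ** h) = X ** h"
      by (simp add: Ad_def matrix_mul_assoc)
    then show "h ** X = X ** h"
      by (simp add: matrix_inv_cancel that)
  next
    assume "h ** X = X ** h"
    then have "Ad h X = X ** (h ** matrix_inv h)"
      by (simp add: Ad_def matrix_mul_assoc)
    then show "Ad h X = X"
      by (simp add: matrix_inv_cancel that)
  qed
  then show ?thesis
    by (auto simp: centralizer_def)
qed

lemma card_upper_pairs:
  "2 * card {(p, q). p \<le> (q :: 'n::{finite,linorder})} = CARD('n) * (CARD('n) + 1)"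
proof -
  let ?L = "{(p, q). p \<le> (q :: 'n)}" and ?G = "{(p, q). q < (p :: 'n)}"
  have "card ?L + card ?G = card (?L \<union> ?G)"
    by (intro card_Un_disjoint[symmetric]) auto
  also have "?L \<union> ?G = UNIV"
    by auto
  also have "card (UNIV :: ('n \<times> 'n) set) = CARD('n) * CARD('n)"
    by simp
  finally have 1: "card ?L + card ?G = CARD('n) * CARD('n)" .
  have "?L = prod.swap ` ?G \<union> range (\<lambda>p. (p, p))"
    by (auto simp: image_iff)
  then have "card ?L = card (prod.swap ` ?G) + card (range (\<lambda>p :: 'n. (p, p)))"
    by (simp only:) (rule card_Un_disjoint; auto)
  also have "card (prod.swap ` ?G) = card ?G"
    by (rule card_image) (auto simp: inj_on_def)
  also have "card (range (\<lambda>p :: 'n. (p, p))) = CARD('n)"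
    by (rule card_image) (auto simp: inj_on_def)
  finally show ?thesis
    using 1 by simp
qed

section \<open>The ideal generated by the Jordan matrix, and its commutator map\<close>

context jordan_frame
begin

text \<open>The positions weakly above and to the right of a non-zero entry of \<open>X0\<close>,
  worked out for the lexicographic order.\<close>

definition Phi :: "('n \<times> 'n) set" where
  "Phi = {(p, q). lev p + 2 \<le> lev q \<or> lev q = lev p + 1 \<and> idx p \<le> idx q}"

definition min_ideal :: "'n sqmat set" where
  "min_ideal = coord_space Phi"

lemma min_ideal_iff: "x \<in> min_ideal \<longleftrightarrow> (\<forall>p q. x $ p $ q \<noteq> 0 \<longrightarrow> (p, q) \<in> Phi)"
  by (simp add: min_ideal_def coord_space_def)

lemma subspace_min_ideal: "cmat.subspace min_ideal"
  by (simp add: min_ideal_def subspace_coord_space)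

lemma Phi_mono: "(p, q) \<in> Phi \<Longrightarrow> p' \<le> p \<Longrightarrow> q \<le> q' \<Longrightarrow> (p', q') \<in> Phi"
  by (auto simp: Phi_def le_iff)

lemma Phi_less: "(p, q) \<in> Phi \<Longrightarrow> p < q"
  by (auto simp: Phi_def less_iff)

text \<open>Triangular factors are absorbed on each side separately, which is stronger than closure
  under brackets; the closedness of \<open>G I\<close> rests on it.\<close>

lemma min_ideal_mult:
  assumes b: "upper_triangular b" and x: "x \<in> min_ideal"
  shows "b ** x \<in> min_ideal" "x ** b \<in> min_ideal"
proof -
  show "b ** x \<in> min_ideal"
    unfolding min_ideal_iff
  proof (intro allI impI)
    fix p q assume "(b ** x) $ p $ q \<noteq> 0"
    then have "(\<Sum>r\<in>UNIV. b $ p $ r * x $ r $ q) \<noteq> 0"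
      by (simp add: matrix_matrix_mult_def)
    then obtain r where "b $ p $ r * x $ r $ q \<noteq> 0"
      by (rule sum.not_neutral_contains_not_neutral)
    then have "b $ p $ r \<noteq> 0" "(r, q) \<in> Phi"
      using x by (auto simp: min_ideal_iff)
    then have "p \<le> r"
      using b by (auto simp: upper_triangular_def not_less[symmetric])
    then show "(p, q) \<in> Phi"
      using Phi_mono \<open>(r, q) \<in> Phi\<close> by blast
  qed
  show "x ** b \<in> min_ideal"
    unfolding min_ideal_iff
  proof (intro allI impI)
    fix p q assume "(x ** b) $ p $ q \<noteq> 0"
    then have "(\<Sum>r\<in>UNIV. x $ p $ r * b $ r $ q) \<noteq> 0"
      by (simp add: matrix_matrix_mult_def)
    then obtain r where "x $ p $ r * b $ r $ q \<noteq> 0"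
      by (rule sum.not_neutral_contains_not_neutral)
    then have "b $ r $ q \<noteq> 0" "(p, r) \<in> Phi"
      using x by (auto simp: min_ideal_iff)
    then have "r \<le> q"
      using b by (auto simp: upper_triangular_def not_less[symmetric])
    then show "(p, q) \<in> Phi"
      using Phi_mono \<open>(p, r) \<in> Phi\<close> by blast
  qed
qed

lemma ad_nilpotent_min_ideal: "ad_nilpotent_ideal min_ideal"
  unfolding ad_nilpotent_ideal_def
proof (intro conjI ballI)
  show "cmat.subspace min_ideal"
    by (rule subspace_min_ideal)
  show "min_ideal \<subseteq> Collect strictly_upper_triangular"
    using Phi_less by (force simp: min_ideal_iff strictly_upper_triangular_def)
  fix b x :: "'n sqmat" assume "b \<in> borel_algebra" "x \<in> min_ideal"
  then show "b ** x - x ** b \<in> min_ideal"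
    by (intro cmat.subspace_diff[OF subspace_min_ideal] min_ideal_mult)
      (auto simp: borel_algebra_def)
qed

lemma X0_min_ideal: "X0 \<in> min_ideal"
  by (simp add: min_ideal_iff X0_nth Phi_def)

text \<open>\<open>descend y i m\<close> is the column at level \<open>lam ! i - 1 - m\<close> of block \<open>i\<close> of a matrix \<open>b\<close> with
  \<open>b X0 - X0 b = y\<close>: the columns at the top level are free, and this equation determines the others
  downwards.\<close>

primrec descend :: "'n sqmat \<Rightarrow> nat \<Rightarrow> nat \<Rightarrow> (complex, 'n) vec" where
  "descend y i 0 = 0"
| "descend y i (Suc m) = column (box (lam ! i - 1 - m) i) y + X0 *v descend y i m"

text \<open>Triangularity of the solution: if \<open>(r, ?q)\<close> is in \<open>Phi\<close>, then
  \<open>r\<close> is at most the box one level below \<open>?q\<close> in its block, and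
  \<open>X0\<close> lowers the entries by one level just as the bound drops by one.\<close>

lemma descend_upper:
  assumes y: "y \<in> min_ideal" and i: "i < length lam"
  shows "m < lam ! i \<Longrightarrow> descend y i m $ r \<noteq> 0 \<Longrightarrow> r \<le> box (lam ! i - 1 - m) i"
proof (induction m arbitrary: r)
  case 0
  then show ?case
    by simp
next
  case (Suc m)
  let ?q = "box (lam ! i - 1 - m) i"
  have q: "lev ?q = Suc (lam ! i - 1 - Suc m)" "idx ?q = i"
    using Suc.prems(1) i by auto
  have q': "lev (box (lam ! i - 1 - Suc m) i) = lam ! i - 1 - Suc m"
    "idx (box (lam ! i - 1 - Suc m) i) = i"
    using Suc.prems(1) i by auto
  consider "y $ r $ ?q \<noteq> 0" | "(X0 *v descend y i m) $ r \<noteq> 0"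
    using Suc.prems(2) by (cases "y $ r $ ?q = 0") (auto simp: column_def)
  then show ?case
  proof cases
    case 1
    then have "(r, ?q) \<in> Phi"
      using y by (simp add: min_ideal_iff)
    then show ?thesis
      unfolding le_iff q' Phi_def using q by auto
  next
    case 2
    then have r: "Suc (lev r) < lam ! idx r" "descend y i m $ box (Suc (lev r)) (idx r) \<noteq> 0"
      by (auto simp: X0_vec split: if_splits)
    then have "box (Suc (lev r)) (idx r) \<le> ?q"
      using Suc.IH Suc.prems(1) by simp
    then show ?thesis
      unfolding le_iff q' using q r(1) frame_range(1)[of r] by auto
  qed
qed

lemma ad_X0_surj:
  assumes y: "y \<in> min_ideal"
  obtains b where "upper_triangular b" "b ** X0 - X0 ** b = y"
proof
  define \<beta> where "\<beta> p = descend y (idx p) (lam ! idx p - 1 - lev p)" for p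
  define b where "b = (\<chi> r p. \<beta> p $ r)"
  have col: "column p b = \<beta> p" for p
    by (simp add: column_def b_def)
  have \<beta>_upper: "r \<le> p" if "\<beta> p $ r \<noteq> 0" for r p
  proof -
    have "lam ! idx p - 1 - (lam ! idx p - 1 - lev p) = lev p"
      using frame_range(2)[of p] by simp
    then show ?thesis
      using descend_upper[OF y frame_range(1)[of p], of "lam ! idx p - 1 - lev p" r] that
        frame_range(2)[of p] by (simp add: \<beta>_def)
  qed
  then show "upper_triangular b"
    by (auto simp: upper_triangular_def b_def not_le[symmetric])
  have X0b: "column q (X0 ** b) = X0 *v \<beta> q" for q
    unfolding col[symmetric] by (simp add: matrix_matrix_mult_def matrix_vector_mult_def column_def)
  have bX0: "column q (b ** X0) = (if lev q = 0 then 0 else \<beta> (box (lev q - 1) (idx q)))" for q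
    by (simp add: column_mult_X0 col)
  have "column q (b ** X0) = column q (y + X0 ** b)" for q
  proof (cases "lev q = 0")
    \<comment> \<open>At level 0 the left side is zero. So is the right one: no position in
      \<open>Phi\<close> has its second index at level 0, and \<open>X0\<close> kills a column
      supported up to a box of level 0.\<close>
    case True
    have "y $ r $ q = 0" for r
    proof -
      have "(r, q) \<notin> Phi"
        using True by (simp add: Phi_def)
      then show ?thesis
        using y by (auto simp: min_ideal_iff)
    qed
    moreover have "(X0 *v \<beta> q) $ r = 0" for r
    proof (rule ccontr)
      assume "(X0 *v \<beta> q) $ r \<noteq> 0"
      then have r: "Suc (lev r) < lam ! idx r" "\<beta> q $ box (Suc (lev r)) (idx r) \<noteq> 0"
        by (auto simp: X0_vec split: if_splits)
      then have "box (Suc (lev r)) (idx r) \<le> q"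
        by (intro \<beta>_upper)
      then show False
        using True r(1) frame_range(1)[of r] by (simp add: le_iff)
    qed
    moreover have "column q (y + X0 ** b) $ r = y $ r $ q + column q (X0 ** b) $ r" for r
      by (simp add: column_def)
    ultimately show ?thesis
      using True unfolding bX0 by (simp add: vec_eq_iff X0b)
  next
    case False
    let ?p = "box (lev q - 1) (idx q)"
    have p: "lev ?p = lev q - 1" "idx ?p = idx q"
      using frame_range[of q] by simp_all
    have m: "lam ! idx q - 1 - lev ?p = Suc (lam ! idx q - 1 - lev q)"
      "lam ! idx q - 1 - (lam ! idx q - 1 - lev q) = lev q"
      using frame_range(2)[of q] False p by simp_all
    have "\<beta> ?p = column q y + X0 *v \<beta> q"
      unfolding \<beta>_def p(2) m(1) descend.simps(2) m(2) by simp
    then show ?thesis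
      using False unfolding bX0 by (simp add: vec_eq_iff column_def flip: X0b)
  qed
  then have "b ** X0 = y + X0 ** b"
    by (auto simp: vec_eq_iff column_def)
  then show "b ** X0 - X0 ** b = y"
    by simp
qed

lemma dim_upper_centralizer_X0:
  "cmat.dim (Collect upper_triangular :: 'n sqmat set) = card Phi + cmat.dim (upper_centralizer X0)"
proof -
  let ?U = "Collect upper_triangular :: 'n sqmat set" and ?f = "\<lambda>A. A ** X0 - X0 ** A"
  have "?f ` ?U = min_ideal"
  proof
    show "?f ` ?U \<subseteq> min_ideal"
      using min_ideal_mult X0_min_ideal
      by (auto intro!: cmat.subspace_diff[OF subspace_min_ideal])
    show "min_ideal \<subseteq> ?f ` ?U"
      using ad_X0_surj by blast
  qed
  moreover have "{v \<in> ?U. ?f v = 0} = upper_centralizer X0"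
    by (auto simp: upper_centralizer_def)
  ultimately show ?thesis
    using cmat.rank_nullity[OF linear_commutator[of X0] subspace_upper_triangular]
    by (simp add: min_ideal_def dim_coord_space)
qed

text \<open>Compare entry \<open>(p, q)\<close> of \<open>a ** X0\<close> and
  \<open>X0 ** a\<close>. The diagonal is thus constant along each block, which is the hypothesis
  for exponentiating it within the centralizer.\<close>

lemma diag_upper_centralizer_X0:
  assumes a: "a \<in> upper_centralizer X0" and pq: "X0 $ p $ q \<noteq> 0"
  shows "a $ p $ p = a $ q $ q"
proof -
  from pq have pq: "lev q = Suc (lev p)" "idx q = idx p"
    by (auto simp: X0_nth split: if_splits)
  have Xq: "X0 $ r $ q = (if r = p then 1 else 0)" for r
    using pq frame_inj[of r p] by (cases "r = p") (auto simp: X0_nth)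
  have Xp: "X0 $ p $ r = (if r = q then 1 else 0)" for r
    using pq frame_inj[of r q] by (cases "r = q") (auto simp: X0_nth)
  have "(a ** X0) $ p $ q = a $ p $ p"
    by (simp add: matrix_matrix_mult_def Xq if_distrib cong: if_cong)
  moreover have "(X0 ** a) $ p $ q = a $ q $ q"
    by (simp add: matrix_matrix_mult_def Xp mult_if_delta)
  ultimately show ?thesis
    using a by (simp add: upper_centralizer_def)
qed

text \<open>The identity component is taken because the group can be disconnected: for a single
  block of size \<open>n\<close> its components correspond to the \<open>n\<close>-th roots of
  unity.\<close>

definition borel0 :: "'n sqmat set" where
  "borel0 = connected_component_set (upper_centralizer X0 \<inter> {g. det g = 1}) (mat 1)"

lemma borel0_subset: "borel0 \<subseteq> upper_centralizer X0 \<inter> {g. det g = 1}"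
  unfolding borel0_def by (rule connected_component_subset)

lemma lie_algebra_borel0: "lie_algebra borel0 = {a \<in> upper_centralizer X0. trace a = 0}"
  using lie_algebra_upper_subset[OF borel0_subset]
    lie_algebra_upper_superset[of X0 borel0, OF diag_upper_centralizer_X0] by (auto simp: borel0_def)

lemma subgroup_borel0: "subgroup borel0 SLn"
  unfolding borel0_def by (intro subgroup_connected_component subgroup_upper_centralizer)

lemma conn_solvable_conj_borel0:
  assumes g: "det g = 1" "X ** g = g ** X0"
  shows "connected_solvable_subgroup (conj_by g ` borel0) (centralizer X)"
  unfolding connected_solvable_subgroup_def
proof (intro conjI)
  interpret cg: group_hom SLn SLn "conj_by g"
    by (rule conj_by_hom[OF g(1)])
  show sub: "subgroup (conj_by g ` borel0) SLn"
    by (rule cg.subgroup_img_is_subgroup[OF subgroup_borel0])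
  show "connected (conj_by g ` borel0)"
    by (intro connected_continuous_image continuous_intros) (simp add: borel0_def)
  have "solvable_seq SLn borel0"
    using borel0_subset by (intro solvable_seq_upper subgroup_borel0) (auto simp: upper_centralizer_def)
  then show "solvable (SLn\<lparr>carrier := conj_by g ` borel0\<rparr>)"
    by (intro solvable_carrier_update sub cg.solvable_imp_solvable_img)
  show "conj_by g ` borel0 \<subseteq> centralizer X"
  proof (rule image_subsetI)
    fix h assume "h \<in> borel0"
    then have h: "det h = 1" "h ** X0 = X0 ** h"
      using borel0_subset by (auto simp: upper_centralizer_def)
    have X: "X = conj_by g X0"
    proof -
      have "X ** (g ** matrix_inv g) = conj_by g X0"
        by (simp add: matrix_mul_assoc g(2))
      then show ?thesis
        by (simp add: matrix_inv_cancel g(1))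
    qed
    have "conj_by g h ** X = X ** conj_by g h"
      unfolding X using g(1) by (simp add: h(2) flip: conj_by_mult)
    then show "conj_by g h \<in> centralizer X"
      using g(1) h by (simp add: centralizer_iff det_mul det_matrix_inv)
  qed
qed

lemma conn_solvable_subset_conj_borel0:
  fixes X :: "'n sqmat"
  assumes X: "has_jordan_type X lam" and H: "connected_solvable_subgroup H (centralizer X)"
  obtains g where "det g = 1" "X ** g = g ** X0" "H \<subseteq> conj_by g ` borel0"
proof -
  have sub: "subgroup H SLn" and conn: "connected H" and comm: "\<And>h. h \<in> H \<Longrightarrow> h ** X = X ** h"
    and "solvable (SLn\<lparr>carrier := H\<rparr>)"
    using H by (auto simp: connected_solvable_subgroup_def centralizer_iff)
  then have "triangularizable H"
    by (intro Lie_Kolchin)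
  then obtain g where g: "det g = 1" "X ** g = g ** X0"
    and ut: "\<And>h. h \<in> H \<Longrightarrow> upper_triangular (matrix_inv g ** h ** g)"
    using adapted_jordan_basis[OF X _ comm] by blast
  have det: "det g \<noteq> 0"
    using g(1) by simp
  let ?c = "\<lambda>h. matrix_inv g ** h ** g"
  have "?c ` H \<subseteq> borel0"
    unfolding borel0_def
  proof (rule connected_component_maximal)
    show "mat 1 \<in> ?c ` H"
      using subgroup_SLnD(1)[OF sub] det
      by (intro image_eqI[of _ _ "mat 1"]) (simp_all add: matrix_inv_cancel)
    show "connected (?c ` H)"
      by (intro connected_continuous_image continuous_intros conn)
    show "?c ` H \<subseteq> upper_centralizer X0 \<inter> {g. det g = 1}"
    proof (rule image_subsetI)
      fix h assume h: "h \<in> H"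
      have "?c h ** X0 = matrix_inv g ** h ** X ** g"
        by (simp add: g(2)[symmetric] flip: matrix_mul_assoc)
      also have "\<dots> = matrix_inv g ** X ** h ** g"
        using comm[OF h] by (simp flip: matrix_mul_assoc)
      also have "matrix_inv g ** X = X0 ** matrix_inv g"
      proof -
        have "matrix_inv g ** (X ** g) ** matrix_inv g = matrix_inv g ** (g ** X0) ** matrix_inv g"
          by (simp add: g(2))
        then have "matrix_inv g ** X ** (g ** matrix_inv g) = (matrix_inv g ** g) ** X0 ** matrix_inv g"
          by (simp add: matrix_mul_assoc)
        then show ?thesis
          by (simp add: matrix_inv_cancel det)
      qed
      finally have "?c h ** X0 = X0 ** ?c h"
        by (simp add: matrix_mul_assoc)
      then show "?c h \<in> upper_centralizer X0 \<inter> {g. det g = 1}"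
        using ut[OF h] subgroup_SLnD(2)[OF sub h] g(1)
        by (simp add: upper_centralizer_def det_mul det_matrix_inv)
    qed
  qed
  then have "H \<subseteq> conj_by g ` borel0"
    using conj_by_inverse(1)[OF det] by (metis (no_types, lifting) image_iff subset_iff)
  with g that show thesis
    by blast
qed

lemma jordan_type_X0: "has_jordan_type X0 lam"
  unfolding has_jordan_type_iff by (intro exI[of _ "mat 1"]) simp

text \<open>Dimension replaces the Lie correspondence: the inclusion of groups gives an inclusion of
  Lie algebras of equal dimension, hence equality. So conjugation by \<open>g\<close> preserves
  \<open>upper_centralizer X0\<close>, and the conjugate of \<open>borel0\<close>, being connected,
  falls back into the identity component.\<close>

lemma conj_borel0_eq:
  assumes g: "det g = 1" and sub: "borel0 \<subseteq> conj_by g ` borel0"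
  shows "conj_by g ` borel0 = borel0"
proof
  have det: "det g \<noteq> 0"
    using g by simp
  have gg: "matrix_inv g ** g = mat 1"
    by (simp add: matrix_inv_cancel det)
  let ?A = "upper_centralizer X0" and ?T = "{a \<in> upper_centralizer X0. trace a = 0}"
  have lin: "Vector_Spaces.linear cscale cscale (conj_by g)"
    by (rule linear_mult_mult)
  interpret lin: Vector_Spaces.linear cscale cscale "conj_by g"
    by (rule lin)
  have subA0: "cmat.subspace ?T"
    using subspace_upper_centralizer[of X0]
    by (auto simp: cmat.subspace_def trace_cscale trace_add trace_zero)
  have "lie_algebra borel0 \<subseteq> lie_algebra (conj_by g ` borel0)"
    using sub by (auto simp: lie_algebra_def)
  then have A0sub: "?T \<subseteq> conj_by g ` ?T"
    by (simp add: lie_algebra_conj[OF det] lie_algebra_borel0)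
  have A0eq: "?T = conj_by g ` ?T"
    by (rule cmat.subspace_dim_equal[OF subA0 lin.subspace_image[OF subA0] A0sub])
      (simp add: dim_conj[OF gg])
  have conj_A: "conj_by g a \<in> ?A" if a: "a \<in> ?A" for a
  proof -
    let ?c = "trace a / trace (mat 1 :: 'n sqmat)"
    have "a - cscale ?c (mat 1) \<in> ?T"
    proof -
      have "a - cscale ?c (mat 1) \<in> ?A"
        by (intro cmat.subspace_diff[OF subspace_upper_centralizer]
            cmat.subspace_scale[OF subspace_upper_centralizer] mat_1_upper_centralizer a)
      moreover have "trace (a - cscale ?c (mat 1)) = 0"
        by (simp add: trace_sub trace_cscale trace_I)
      ultimately show ?thesis
        by simp
    qed
    then have "conj_by g (a - cscale ?c (mat 1)) \<in> ?A"
      using A0eq by blast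
    moreover have "conj_by g (a - cscale ?c (mat 1)) = conj_by g a - cscale ?c (mat 1)"
      by (simp add: lin.diff lin.scale matrix_inv_cancel det)
    ultimately have "conj_by g a - cscale ?c (mat 1) + cscale ?c (mat 1) \<in> ?A"
      by (intro cmat.subspace_add[OF subspace_upper_centralizer]
          cmat.subspace_scale[OF subspace_upper_centralizer] mat_1_upper_centralizer) simp
    then show ?thesis
      by simp
  qed
  show "conj_by g ` borel0 \<subseteq> borel0"
  proof (subst (2) borel0_def, rule connected_component_maximal)
    show "mat 1 \<in> conj_by g ` borel0"
      using sub subgroup_SLnD(1)[OF subgroup_borel0] by blast
    show "connected (conj_by g ` borel0)"
      by (intro connected_continuous_image continuous_intros) (simp add: borel0_def)
    show "conj_by g ` borel0 \<subseteq> upper_centralizer X0 \<inter> {g. det g = 1}"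
      using borel0_subset conj_A g by (auto simp: det_mul det_matrix_inv)
  qed
qed (rule sub)

lemma borel_borel0: "borel_subgroup_of borel0 (centralizer X0)"
  unfolding borel_subgroup_of_def
proof (intro conjI allI impI)
  have "connected_solvable_subgroup (conj_by (mat 1) ` borel0) (centralizer X0)"
    by (rule conn_solvable_conj_borel0) simp_all
  then show "connected_solvable_subgroup borel0 (centralizer X0)"
    by simp
  fix H' assume H': "connected_solvable_subgroup H' (centralizer X0) \<and> borel0 \<subseteq> H'"
  then obtain g where g: "det g = 1" "H' \<subseteq> conj_by g ` borel0"
    using conn_solvable_subset_conj_borel0[OF jordan_type_X0 conjunct1[OF H']] by metis
  then have "conj_by g ` borel0 = borel0"
    by (intro conj_borel0_eq g(1) subset_trans[OF conjunct2[OF H'] g(2)])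
  then show "H' = borel0"
    using g(2) H' by simp
qed

lemma group_dim_borel0: "group_dim borel0 + 1 = cmat.dim (upper_centralizer X0)"
  unfolding group_dim_def lie_algebra_borel0
  by (rule dim_trace_zero[OF subspace_upper_centralizer mat_1_upper_centralizer])

lemma group_dim_borel_subgroup:
  fixes X :: "'n sqmat"
  assumes X: "has_jordan_type X lam" and H: "borel_subgroup_of H (centralizer X)"
  shows "group_dim H = group_dim borel0"
proof -
  obtain g where g: "det g = 1" "X ** g = g ** X0" "H \<subseteq> conj_by g ` borel0"
    using conn_solvable_subset_conj_borel0[OF X] H by (auto simp: borel_subgroup_of_def)
  then have "H = conj_by g ` borel0"
    using H conn_solvable_conj_borel0[OF g(1,2)] by (auto simp: borel_subgroup_of_def)
  moreover have "det g \<noteq> 0"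
    using g(1) by simp
  ultimately show ?thesis
    by (simp add: group_dim_def lie_algebra_conj dim_conj matrix_inv_cancel)
qed

text \<open>\<open>Borel\<close> is the determinant 1 part of \<open>upper_centralizer 0\<close>, so
  the computation of Lie algebras for centralizers covers it.\<close>

lemma group_dim_Borel:
  "group_dim (Borel :: 'n sqmat set) + 1 = cmat.dim (Collect upper_triangular :: 'n sqmat set)"
proof -
  have U: "upper_centralizer (0 :: 'n sqmat) = Collect upper_triangular"
    by (auto simp: upper_centralizer_def)
  have B: "Borel = upper_centralizer (0 :: 'n sqmat) \<inter> {g. det g = 1}"
    by (auto simp: Borel_def U)
  have "lie_algebra Borel = {a \<in> upper_centralizer (0 :: 'n sqmat). trace a = 0}"
    unfolding B
    by (intro equalityI lie_algebra_upper_subset lie_algebra_upper_superset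
        connected_component_subset) simp_all
  then show ?thesis
    unfolding group_dim_def
    using dim_trace_zero[OF subspace_upper_centralizer mat_1_upper_centralizer, of "0 :: 'n sqmat"]
    by (simp add: U)
qed

theorem m_orbit_eq: "m_orbit (orbit_of_type lam :: 'n sqmat set) = int (card Phi)"
  unfolding m_orbit_def
proof (rule the_equality)
  have dim: "int (group_dim (Borel :: 'n sqmat set)) - int (group_dim borel0) = int (card Phi)"
    using group_dim_Borel group_dim_borel0 dim_upper_centralizer_X0 by linarith
  show "\<exists>X\<in>(orbit_of_type lam :: 'n sqmat set). \<exists>H. borel_subgroup_of H (centralizer X) \<and>
      int (card Phi) = int (group_dim (Borel :: 'n sqmat set)) - int (group_dim H)"
  proof (rule bexI[of _ X0])
    show "\<exists>H. borel_subgroup_of H (centralizer X0) \<and>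
        int (card Phi) = int (group_dim (Borel :: 'n sqmat set)) - int (group_dim H)"
      by (intro exI[of _ borel0] conjI borel_borel0) (simp add: dim)
  qed (simp add: orbit_of_type_def jordan_type_X0)
  fix d assume "\<exists>X\<in>(orbit_of_type lam :: 'n sqmat set). \<exists>H. borel_subgroup_of H (centralizer X) \<and>
      d = int (group_dim (Borel :: 'n sqmat set)) - int (group_dim H)"
  then show "d = int (card Phi)"
    using group_dim_borel_subgroup dim by (auto simp: orbit_of_type_def)
qed

subsection \<open>The lower bound for ideals\<close>

lemma jordan_type_conj:
  fixes X :: "'n sqmat"
  assumes "has_jordan_type X lam" "det g \<noteq> 0"
  shows "has_jordan_type (conj_by g X) lam"
proof -
  obtain f where f: "det f \<noteq> 0" "X ** f = f ** X0"
    using assms(1) has_jordan_type_iff by blast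
  have "conj_by g X ** (g ** f) = g ** X ** (matrix_inv g ** g) ** f"
    by (simp add: matrix_mul_assoc)
  also have "\<dots> = g ** (X ** f)"
    by (simp add: matrix_inv_cancel assms(2) matrix_mul_assoc)
  also have "\<dots> = g ** f ** X0"
    by (simp add: f(2) matrix_mul_assoc)
  finally show ?thesis
    unfolding has_jordan_type_iff using f(1) assms(2)
    by (intro exI[of _ "g ** f"]) (simp add: det_mul)
qed

lemma orbit_of_type_eq: "orbit_of_type lam = (\<lambda>g. Ad g X0) ` carrier SLn"
proof
  show "orbit_of_type lam \<subseteq> (\<lambda>g. Ad g X0) ` carrier SLn"
  proof
    fix X :: "'n sqmat" assume "X \<in> orbit_of_type lam"
    then have X: "has_jordan_type X lam"
      by (simp add: orbit_of_type_def)
    \<comment> \<open>Adapting to the empty set leaves any Jordan basis, normalized to determinant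
      1.\<close>
    obtain g where g: "det g = 1" "X ** g = g ** X0"
      using adapted_jordan_basis[OF X, of "{}"] triangularizable_upper[of "{}"] by auto
    have "X ** (g ** matrix_inv g) = Ad g X0"
      by (simp add: matrix_mul_assoc g(2) Ad_def)
    then have "X = Ad g X0"
      by (simp add: matrix_inv_cancel g(1))
    then show "X \<in> (\<lambda>g. Ad g X0) ` carrier SLn"
      using g(1) by auto
  qed
  show "(\<lambda>g. Ad g X0) ` carrier SLn \<subseteq> orbit_of_type lam"
    using jordan_type_conj[OF jordan_type_X0] by (auto simp: orbit_of_type_def Ad_def)
qed

lemma nilpotent_orbit_of_type: "nilpotent_orbit (orbit_of_type lam :: 'n sqmat set)"
proof -
  have pow: "((\<lambda>Y. X0 ** Y) ^^ k) (mat 1) *v x = ((*v) X0 ^^ k) x" for x k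
    by (induction k) (simp_all flip: matrix_vector_mul_assoc)
  define k where "k = Max (range (\<lambda>p. lam ! idx p))"
  have "lam ! idx p \<le> k" for p
    unfolding k_def by (intro Max_ge) auto
  then have "((*v) X0 ^^ k) x = 0" for x
    by (simp add: vec_eq_iff X0_pow_vec not_less[THEN iffD2] trans_le_add2)
  then have "((\<lambda>Y. X0 ** Y) ^^ k) (mat 1) = 0"
    unfolding matrix_eq pow by simp
  then show ?thesis
    unfolding nilpotent_orbit_def nilpotent_mat_def orbit_of_type_eq by blast
qed

theorem ideal_dim_ge:
  fixes I :: "'n sqmat set"
  assumes I: "ad_nilpotent_ideal I" "has_associated_orbit I (orbit_of_type lam)"
  shows "card Phi \<le> cmat.dim I"
proof -
  \<comment> \<open>The orbit lies in its closure \<open>G I\<close>, so some conjugate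
    \<open>x\<close> of \<open>X0\<close> belongs to \<open>I\<close> itself.\<close>
  have "X0 \<in> closure (orbit_of_type lam)"
    using jordan_type_X0 closure_subset[of "orbit_of_type lam :: 'n sqmat set"]
    by (auto simp: orbit_of_type_def)
  then obtain g x where g: "det g = 1" and x: "x \<in> I" "X0 = Ad g x"
    using I(2) by (auto simp: has_associated_orbit_def)
  have det: "det g \<noteq> 0"
    using g by simp
  have "conj_by (matrix_inv g) X0 = x"
    using conj_by_inverse(2)[OF det] by (simp add: x(2) Ad_def matrix_inv_inv det)
  then have jx: "has_jordan_type x lam"
    using jordan_type_conj[OF jordan_type_X0, of "matrix_inv g"] det by (simp add: det_matrix_inv)
  have subI: "cmat.subspace I" and adI: "\<And>b. b \<in> borel_algebra \<Longrightarrow> b ** x - x ** b \<in> I"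
    using I(1) x(1) by (auto simp: ad_nilpotent_ideal_def)
  let ?U = "Collect upper_triangular :: 'n sqmat set" and ?f = "\<lambda>A. A ** x - x ** A"
  have "?f ` ?U \<subseteq> I"
  proof (rule image_subsetI)
    fix b :: "'n sqmat" assume b: "b \<in> ?U"
    \<comment> \<open>\<open>borel_algebra\<close> admits trace-free matrices only; removing a
      scalar from \<open>b\<close> leaves its commutator with \<open>x\<close> unchanged.\<close>
    let ?c = "trace b / trace (mat 1 :: 'n sqmat)"
    let ?b = "b - cscale ?c (mat 1)"
    have "upper_triangular ?b"
      using b upper_triangular_mat_1
      by (auto simp: upper_triangular_def cscale_nth mat_def)
    then have "?b \<in> borel_algebra"
      by (simp add: borel_algebra_def trace_sub trace_cscale trace_I)
    then have "?f ?b \<in> I"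
      by (rule adI)
    also have "?f ?b = ?f b"
      by (simp add: matrix_diff_ldistrib matrix_diff_rdistrib cscale_mult_left cscale_mult_right)
    finally show "?f b \<in> I" .
  qed
  then have "cmat.dim (?f ` ?U) \<le> cmat.dim I"
    by (rule cmat.dim_subset)
  moreover have "cmat.dim ?U = cmat.dim (?f ` ?U) + cmat.dim (upper_centralizer x)"
  proof -
    have "{v \<in> ?U. ?f v = 0} = upper_centralizer x"
      by (auto simp: upper_centralizer_def)
    then show ?thesis
      using cmat.rank_nullity[OF linear_commutator[of x] subspace_upper_triangular] by simp
  qed
  moreover have "cmat.dim (upper_centralizer x) \<le> cmat.dim (upper_centralizer X0)"
  proof -
    \<comment> \<open>The adapted basis is applied to a linear space here, not to a group: it
      conjugates the triangular matrices commuting with \<open>x\<close> into those commuting with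
      \<open>X0\<close>.\<close>
    have tri: "triangularizable (upper_centralizer x)"
      by (rule triangularizable_upper) (simp add: upper_centralizer_def)
    have comm: "s ** x = x ** s" if "s \<in> upper_centralizer x" for s
      using that by (simp add: upper_centralizer_def)
    obtain f where f: "det f = 1" "x ** f = f ** X0"
      "\<And>s. s \<in> upper_centralizer x \<Longrightarrow> upper_triangular (matrix_inv f ** s ** f)"
    proof (rule adapted_jordan_basis[OF jx tri comm])
      fix f
      assume f: "det f = 1" "x ** f = f ** X0"
        and ut: "\<And>s. s \<in> upper_centralizer x \<Longrightarrow> upper_triangular (matrix_inv f ** s ** f)"
      show thesis
        by (rule that[OF f ut])
    qed
    have detf: "det f \<noteq> 0"
      using f(1) by simp
    have "(\<lambda>s. matrix_inv f ** s ** f) ` upper_centralizer x \<subseteq> upper_centralizer X0"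
    proof (rule image_subsetI)
      fix s assume s: "s \<in> upper_centralizer x"
      let ?t = "matrix_inv f ** s ** f"
      have "X0 = matrix_inv f ** (x ** f)"
        unfolding f(2) by (simp add: matrix_mul_assoc matrix_inv_cancel detf)
      then have X0: "X0 = conj_by (matrix_inv f) x"
        by (simp add: matrix_mul_assoc matrix_inv_inv detf)
      have t: "?t = conj_by (matrix_inv f) s"
        by (simp add: matrix_inv_inv detf)
      have "s ** x = x ** s"
        using s by (simp add: upper_centralizer_def)
      then have "?t ** X0 = X0 ** ?t"
        unfolding X0 t using detf by (simp add: det_matrix_inv flip: conj_by_mult)
      then show "?t \<in> upper_centralizer X0"
        using f(3)[OF s] by (simp add: upper_centralizer_def)
    qed
    then have "cmat.dim ((\<lambda>s. matrix_inv f ** s ** f) ` upper_centralizer x)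
        \<le> cmat.dim (upper_centralizer X0)"
      by (rule cmat.dim_subset)
    then show ?thesis
      using detf by (simp add: dim_conj matrix_inv_cancel)
  qed
  ultimately show ?thesis
    using dim_upper_centralizer_X0 by linarith
qed

end

subsection \<open>Closedness of \<open>G I\<close>\<close>

definition cadj :: "'n::finite sqmat \<Rightarrow> 'n sqmat" where
  "cadj k = (\<chi> i j. cnj (k $ j $ i))"

text \<open>All determinants are allowed: \<open>Ad\<close> is insensitive to scalars, so they can
  be corrected afterwards.\<close>

definition unitary_group :: "'n::finite sqmat set" where
  "unitary_group = {k. cadj k ** k = mat 1}"

lemma continuous_on_cadj [continuous_intros]:
  assumes "continuous_on S f"
  shows "continuous_on S (\<lambda>x. cadj (f x))"
  unfolding cadj_def by (intro continuous_intros assms)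

lemma cadj_mult_nth: "(cadj k ** k) $ p $ q = (\<Sum>i\<in>UNIV. cnj (k $ i $ p) * k $ i $ q)"
  by (simp add: matrix_matrix_mult_def cadj_def)

lemma compact_unitary_group: "compact (unitary_group :: 'n::finite sqmat set)"
proof -
  have "closed (unitary_group :: 'n sqmat set)"
    unfolding unitary_group_def by (intro closed_Collect_eq continuous_intros)
  moreover have "norm k \<le> real CARD('n) * real CARD('n)" if "k \<in> unitary_group" for k :: "'n sqmat"
  proof -
    have entry: "norm (k $ i $ j) \<le> 1" for i j
    proof -
      have "(\<Sum>i\<in>UNIV. cnj (k $ i $ j) * k $ i $ j) = 1"
        using that by (simp add: unitary_group_def cadj_mult_nth[symmetric] mat_def)
      then have "complex_of_real (\<Sum>i\<in>UNIV. (norm (k $ i $ j))\<^sup>2) = 1"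
        by (simp add: complex_norm_square mult.commute del: of_real_power)
      then have "(\<Sum>i\<in>UNIV. (norm (k $ i $ j))\<^sup>2) = 1"
        by (metis of_real_eq_1_iff)
      moreover have "(norm (k $ i $ j))\<^sup>2 \<le> (\<Sum>i\<in>UNIV. (norm (k $ i $ j))\<^sup>2)"
        by (rule member_le_sum) auto
      ultimately show ?thesis
        by (simp add: power2_le_iff_abs_le abs_square_le_1)
    qed
    have "norm (k $ i) \<le> (\<Sum>j\<in>UNIV. norm (k $ i $ j))" for i
      unfolding norm_vec_def by (rule L2_set_le_sum) simp
    also have "(\<Sum>j\<in>UNIV. norm (k $ i $ j)) \<le> real CARD('n)" for i
      using sum_bounded_above[of UNIV "\<lambda>j. norm (k $ i $ j)" 1] entry by simp
    finally have row: "norm (k $ i) \<le> real CARD('n)" for i .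
    have "norm k \<le> (\<Sum>i\<in>UNIV. norm (k $ i))"
      unfolding norm_vec_def[of k] by (rule L2_set_le_sum) simp
    also have "\<dots> \<le> real CARD('n) * real CARD('n)"
      using sum_bounded_above[of UNIV "\<lambda>i. norm (k $ i)" "real CARD('n)"] row by simp
    finally show ?thesis .
  qed
  then have "bounded (unitary_group :: 'n sqmat set)"
    unfolding bounded_iff by blast
  ultimately show ?thesis
    by (simp add: compact_eq_bounded_closed)
qed

lemma closed_coord_space: "closed (coord_space S)"
proof -
  have "coord_space S = {A. \<forall>i j. (i, j) \<notin> S \<longrightarrow> A $ i $ j = 0}"
    unfolding coord_space_def by blast
  also have "closed \<dots>"
  proof (intro closed_Collect_all)
    show "closed {A :: 'a sqmat. (i, j) \<notin> S \<longrightarrow> A $ i $ j = 0}" for i j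
      by (cases "(i, j) \<in> S") (auto intro!: closed_Collect_eq continuous_intros)
  qed
  finally show ?thesis .
qed

lemma span_columns_subset:
  fixes g :: "'n::finite sqmat"
  shows "vec.span ((\<lambda>p. column p g) ` S) \<subseteq> (*v) g ` {d. \<forall>p. p \<notin> S \<longrightarrow> d $ p = 0}"
    (is "_ \<subseteq> (*v) g ` ?D")
proof (rule vec.span_minimal)
  have "vec.subspace ?D"
    by (rule vec.subspaceI) auto
  then show "vec.subspace ((*v) g ` ?D)"
    by (rule vec.subspace_image)
  show "(\<lambda>p. column p g) ` S \<subseteq> (*v) g ` ?D"
  proof (rule image_subsetI)
    fix p assume "p \<in> S"
    then have "axis p 1 \<in> ?D"
      by (auto simp: axis_def)
    then have "g *v axis p 1 \<in> (*v) g ` ?D"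
      by (rule imageI)
    then show "column p g \<in> (*v) g ` ?D"
      by (simp only: matrix_vector_mult_axis)
  qed
qed

text \<open>The imaginary part of the Hermitian product is a real inner product with a rotated
  vector. A complex subspace contains the rotated vectors too, so real orthogonality to it is
  Hermitian orthogonality.\<close>

lemma hermitian_eq_inner:
  "(\<Sum>i\<in>UNIV. cnj (w $ i) * u $ i) = Complex (w \<bullet> u) ((\<i> *s w) \<bullet> u)"
  for w u :: "complex ^ 'n::finite"
  by (simp add: complex_eq_iff inner_vec_def inner_complex_def Re_sum Im_sum)

lemma subspace_complex_imp_real:
  assumes "vec.subspace U"
  shows "subspace (U :: (complex ^ 'n::finite) set)"
proof (rule subspaceI)
  show "0 \<in> U"
    using assms by (rule vec.subspace_0)
  show "x + y \<in> U" if "x \<in> U" "y \<in> U" for x y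
    using assms that by (rule vec.subspace_add)
  show "c *\<^sub>R x \<in> U" if "x \<in> U" for c x
  proof -
    have "c *\<^sub>R x = complex_of_real c *s x"
      by (simp add: vec_eq_iff) (simp add: scaleR_conv_of_real)
    then show ?thesis
      using vec.subspace_scale[OF assms that] by simp
  qed
qed

text \<open>Gram-Schmidt: the \<open>q\<close>-th column of \<open>k\<close> is the normalized component of the \<open>q\<close>-th column of \<open>g\<close>
  orthogonal to the complex span of the previous columns. The library projection is orthogonal
  for the real inner product, which on complex subspaces amounts to the same.\<close>

lemma unitary_upper_decomposition:
  fixes g :: "'n::{finite,linorder} sqmat"
  assumes g: "det g \<noteq> 0"
  obtains k where "k \<in> unitary_group" "upper_triangular (matrix_inv g ** k)"
proof -
  define U where "U S = vec.span ((\<lambda>p. column p g) ` S)" for S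
  have subU: "vec.subspace (U S)" for S
    by (simp add: U_def)
  have U_mono: "S \<subseteq> T \<Longrightarrow> U S \<subseteq> U T" for S T
    unfolding U_def by (intro vec.span_mono image_mono)
  have colU: "p \<in> S \<Longrightarrow> column p g \<in> U S" for p S
    unfolding U_def by (intro vec.span_base) simp
  have cancel: "matrix_inv g *v (g *v x) = x" for x
    by (simp add: matrix_vector_mul_assoc matrix_inv_cancel g)
  have "\<exists>z. z \<noteq> 0 \<and> z \<in> U {..q} \<and> (\<forall>w\<in>U {..<q}. w \<bullet> z = 0)" for q
  proof -
    have "span (U {..<q}) = U {..<q}"
      using subspace_complex_imp_real[OF subU] by (rule span_eq_iff[THEN iffD2])
    then obtain y z where yz: "y \<in> U {..<q}" "\<And>w. w \<in> U {..<q} \<Longrightarrow> orthogonal z w"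
      "column q g = y + z"
      using orthogonal_subspace_decomp_exists[of "U {..<q}" "column q g"] by metis
    have "column q g \<notin> U {..<q}"
    proof
      assume "column q g \<in> U {..<q}"
      then obtain d where d: "\<forall>p. p \<notin> {..<q} \<longrightarrow> d $ p = 0" "column q g = g *v d"
        using span_columns_subset[of g "{..<q}"] unfolding U_def by blast
      then have "axis q 1 = d"
        using cancel[of d] cancel[of "axis q 1"] by (simp add: matrix_vector_mult_axis)
      then have "d $ q = 1"
        by (auto simp: axis_def)
      with d(1) show False
        by simp
    qed
    then have "z \<noteq> 0"
      using yz by auto
    moreover have "z \<in> U {..q}"
    proof -
      have "y \<in> U {..q}"
        using yz(1) U_mono[of "{..<q}" "{..q}"] by (auto simp: subset_iff less_imp_le)
      then have "column q g - y \<in> U {..q}"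
        by (intro vec.subspace_diff[OF subU] colU) simp_all
      then show ?thesis
        using yz(3) by simp
    qed
    moreover have "\<forall>w\<in>U {..<q}. w \<bullet> z = 0"
      using yz(2) by (simp add: orthogonal_def inner_commute)
    ultimately show ?thesis
      by blast
  qed
  then obtain z where z: "\<And>q. z q \<noteq> 0" "\<And>q. z q \<in> U {..q}"
    "\<And>q w. w \<in> U {..<q} \<Longrightarrow> w \<bullet> z q = 0"
    by metis
  define u where "u q = z q /\<^sub>R norm (z q)" for q
  have uU: "u q \<in> U {..q}" for q
    unfolding u_def using subspace_complex_imp_real[OF subU] z(2) by (intro subspace_scale)
  have uo: "w \<bullet> u q = 0" if "w \<in> U {..<q}" for q w
    using z(3)[OF that] by (simp add: u_def)
  define k where "k = (\<chi> i q. u q $ i)"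
  have herm: "(cadj k ** k) $ p $ q = Complex (u p \<bullet> u q) ((\<i> *s u p) \<bullet> u q)" for p q
    by (simp add: cadj_mult_nth k_def hermitian_eq_inner)
  have less: "(cadj k ** k) $ p $ q = 0" if "p < q" for p q
  proof -
    have "u p \<in> U {..<q}"
      using uU[of p] U_mono[of "{..p}" "{..<q}"] that by (auto simp: subset_iff intro: le_less_trans)
    then have "\<i> *s u p \<in> U {..<q}"
      by (rule vec.subspace_scale[OF subU])
    then show ?thesis
      using uo \<open>u p \<in> U {..<q}\<close> by (simp add: herm complex_eq_iff)
  qed
  have flip: "(cadj k ** k) $ q $ p = cnj ((cadj k ** k) $ p $ q)" for p q
    by (simp add: cadj_mult_nth mult.commute)
  have diag: "(cadj k ** k) $ p $ p = 1" for p
  proof -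
    have "norm (u p) = 1"
      using z(1)[of p] by (simp add: u_def)
    then have "u p \<bullet> u p = 1"
      by (simp only: norm_eq_1)
    moreover have "(\<i> *s u p) \<bullet> u p = 0"
      by (simp add: inner_vec_def inner_complex_def mult.commute)
    ultimately show ?thesis
      by (simp add: herm complex_eq_iff)
  qed
  have "(cadj k ** k) $ p $ q = mat 1 $ p $ q" for p q
    using less[of p q] less[of q p] flip[of q p] diag[of p]
    by (cases p q rule: linorder_cases) (simp_all add: mat_def)
  then have "k \<in> unitary_group"
    by (simp add: unitary_group_def vec_eq_iff)
  moreover have "upper_triangular (matrix_inv g ** k)"
    unfolding upper_triangular_def
  proof (intro allI impI)
    fix p q :: 'n assume "q < p"
    obtain d where d: "\<forall>p. p \<notin> {..q} \<longrightarrow> d $ p = 0" "u q = g *v d"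
      using uU[of q] span_columns_subset[of g "{..q}"] unfolding U_def by blast
    have "(matrix_inv g ** k) $ p $ q = (matrix_inv g *v u q) $ p"
      by (simp add: matrix_matrix_mult_def matrix_vector_mult_def k_def)
    also have "matrix_inv g *v u q = d"
      by (simp add: d(2) cancel)
    finally show "(matrix_inv g ** k) $ p $ q = 0"
      using d(1) \<open>q < p\<close> by simp
  qed
  ultimately show thesis
    using that by blast
qed

lemma Ad_cscale:
  assumes "c \<noteq> 0" "det g \<noteq> 0"
  shows "Ad (cscale c g) x = Ad g x"
proof -
  have "matrix_inv (cscale c g) = cscale (inverse c) (matrix_inv g)"
    using assms by (intro matrix_inv_unique)
      (simp add: cscale_mult_left cscale_mult_right matrix_inv_cancel)
  then show ?thesis
    using assms by (simp add: Ad_def cscale_mult_left cscale_mult_right)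
qed

context jordan_frame
begin

lemma closed_saturation_min_ideal: "closed {Ad g x | g x. g \<in> carrier SLn \<and> x \<in> min_ideal}"
proof -
  \<comment> \<open>Writing \<open>cadj\<close> for the inverse makes this condition closed for all
    matrices; on unitary ones it says that \<open>y\<close> is conjugated into the ideal.\<close>
  let ?T = "{ky. cadj (fst ky) ** snd ky ** fst ky \<in> min_ideal}"
  have "closed ?T"
  proof -
    have "closed ((\<lambda>ky. cadj (fst ky) ** snd ky ** fst ky) -` min_ideal)"
      unfolding min_ideal_def
      by (intro closed_vimage closed_coord_space continuous_intros)
    then show ?thesis
      by (simp add: vimage_def)
  qed
  then have "closed {y. \<exists>k. k \<in> unitary_group \<and> (k, y) \<in> ?T}"
    by (rule closed_compact_projection[OF compact_unitary_group])
  also have "{y. \<exists>k. k \<in> unitary_group \<and> (k, y) \<in> ?T} =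
      {Ad g x | g x. g \<in> carrier SLn \<and> x \<in> min_ideal}"
  proof (intro equalityI subsetI)
    fix y assume "y \<in> {y. \<exists>k. k \<in> unitary_group \<and> (k, y) \<in> ?T}"
    then obtain k where k: "cadj k ** k = mat 1" "cadj k ** y ** k \<in> min_ideal"
      by (auto simp: unitary_group_def)
    have inv: "matrix_inv k = cadj k"
      by (rule matrix_inv_unique[OF k(1)])
    have "det (cadj k) * det k = 1"
      by (simp add: k(1) flip: det_mul)
    then have det: "det k \<noteq> 0"
      by auto
    obtain c where c: "c \<noteq> 0" "det (cscale c k) = 1"
      by (rule scale_to_SLn[OF det])
    have "Ad (cscale c k) (cadj k ** y ** k) = y"
      unfolding Ad_cscale[OF c(1) det] unfolding Ad_def
      using conj_by_inverse(1)[OF det, of y] by (simp add: inv)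
    then show "y \<in> {Ad g x | g x. g \<in> carrier SLn \<and> x \<in> min_ideal}"
      using c(2) k(2) by (intro CollectI exI[of _ "cscale c k"] exI[of _ "cadj k ** y ** k"]) simp
  next
    fix y assume "y \<in> {Ad g x | g x. g \<in> carrier SLn \<and> x \<in> min_ideal}"
    then obtain g x where g: "det g = 1" and x: "x \<in> min_ideal" and y: "y = Ad g x"
      by auto
    have detg: "det g \<noteq> 0"
      using g by simp
    obtain k where k: "k \<in> unitary_group" "upper_triangular (matrix_inv g ** k)"
      by (rule unitary_upper_decomposition[OF detg])
    have ck: "cadj k ** k = mat 1"
      using k(1) by (simp add: unitary_group_def)
    have inv: "matrix_inv k = cadj k"
      by (rule matrix_inv_unique[OF ck])
    have "det (cadj k) * det k = 1"
      by (simp add: ck flip: det_mul)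
    then have det: "det k \<noteq> 0"
      by auto
    have "matrix_inv (matrix_inv g ** k) = cadj k ** g"
      using detg det by (simp add: matrix_inv_mult det_matrix_inv matrix_inv_inv inv)
    moreover have "upper_triangular (matrix_inv (matrix_inv g ** k))"
      using k(2) detg det by (intro upper_triangular_inv) (simp_all add: det_mul det_matrix_inv)
    ultimately have "upper_triangular (cadj k ** g)"
      by simp
    \<comment> \<open>\<open>cadj k ** g\<close> and \<open>matrix_inv g ** k\<close> are mutually
      inverse triangular matrices, and the ideal absorbs one on each side.\<close>
    then have "(cadj k ** g) ** x ** (matrix_inv g ** k) \<in> min_ideal"
      using k(2) x by (intro min_ideal_mult)
    then have "cadj k ** y ** k \<in> min_ideal"
      by (simp add: y Ad_def matrix_mul_assoc)
    then show "y \<in> {y. \<exists>k. k \<in> unitary_group \<and> (k, y) \<in> ?T}"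
      using k(1) by auto
  qed
  finally show ?thesis .
qed

subsection \<open>The orbit of the minimal ideal\<close>

text \<open>The images of the top vectors of the blocks under powers of \<open>Y\<close> form a Jordan basis, because
  they are triangular in the order of the frame.\<close>

lemma generic_jordan_type:
  assumes Y: "Y \<in> min_ideal" and nz: "\<And>p q. X0 $ p $ q \<noteq> 0 \<Longrightarrow> Y $ p $ q \<noteq> 0"
  shows "has_jordan_type Y lam"
proof -
  define v where "v i m = ((*v) Y ^^ m) (axis (box (lam ! i - 1) i) 1)" for i m
  \<comment> \<open>Each application of \<open>Y\<close> moves the leading index one level down in
    block \<open>i\<close>, with a non-zero leading coefficient.\<close>
  have v: "(\<forall>r. v i m $ r \<noteq> 0 \<longrightarrow> r \<le> box (lam ! i - 1 - m) i) \<and> v i m $ box (lam ! i - 1 - m) i \<noteq> 0"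
    if i: "i < length lam" and "m < lam ! i" for i m
    using that(2)
  proof (induction m)
    case 0
    then show ?case
      by (simp add: v_def axis_def)
  next
    case (Suc m)
    let ?q = "box (lam ! i - 1 - m) i" and ?q' = "box (lam ! i - 1 - Suc m) i"
    have IH: "r \<le> ?q" if "v i m $ r \<noteq> 0" for r
      using Suc that by simp
    have q: "lev ?q = Suc (lam ! i - 1 - Suc m)" "idx ?q = i"
      and q': "lev ?q' = lam ! i - 1 - Suc m" "idx ?q' = i"
      using Suc.prems i by auto
    have step: "v i (Suc m) $ r = (\<Sum>s\<in>UNIV. Y $ r $ s * v i m $ s)" for r
      by (simp add: v_def matrix_vector_mult_def)
    have le: "r \<le> ?q'" if nz: "v i (Suc m) $ r \<noteq> 0" for r
    proof -
      obtain s where "Y $ r $ s * v i m $ s \<noteq> 0"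
        using nz unfolding step by (rule sum.not_neutral_contains_not_neutral)
      then have "(r, s) \<in> Phi" "s \<le> ?q"
        using Y IH by (auto simp: min_ideal_iff)
      then have "(r, ?q) \<in> Phi"
        using Phi_mono by blast
      then show ?thesis
        unfolding le_iff q' Phi_def using q by auto
    qed
    \<comment> \<open>Only the leading index contributes: \<open>?q\<close> is the first index that
      \<open>Phi\<close> pairs with \<open>?q'\<close>.\<close>
    have "v i (Suc m) $ ?q' = (\<Sum>s\<in>{?q}. Y $ ?q' $ s * v i m $ s)"
      unfolding step
    proof (rule sum.mono_neutral_right; clarsimp)
      fix s assume s: "s \<noteq> box (lam ! i - Suc m) i" "v i m $ s \<noteq> 0"
      have "s \<le> ?q"
        using IH s(2) .
      moreover have "s \<noteq> ?q"
        using s(1) by simp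
      ultimately have "s < ?q"
        by simp
      then have "(?q', s) \<notin> Phi"
        using q q' by (auto simp: Phi_def less_iff)
      then show "Y $ box (lam ! i - Suc (Suc m)) i $ s = 0"
        using Y by (auto simp: min_ideal_iff)
    qed
    moreover have "Y $ ?q' $ ?q \<noteq> 0"
      using q q' by (intro nz) (simp add: X0_nth)
    moreover have "v i m $ ?q \<noteq> 0"
      using Suc by simp
    ultimately show ?case
      using le by simp
  qed
  define g where "g = (\<chi> r q. v (idx q) (lam ! idx q - 1 - lev q) $ r)"
  have col: "column q g = v (idx q) (lam ! idx q - 1 - lev q)" for q
    by (simp add: column_def g_def)
  have lev_eq: "lam ! idx q - 1 - (lam ! idx q - 1 - lev q) = lev q"
    "lam ! idx q - 1 - lev q < lam ! idx q" for q
    using frame_range(2)[of q] by simp_all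
  have vq: "r \<le> q" if "column q g $ r \<noteq> 0" for q r
    using v[OF frame_range(1)[of q] lev_eq(2)[of q]] that
    unfolding col lev_eq(1) box_lev_idx by blast
  have vqq: "column q g $ q \<noteq> 0" for q
    using v[OF frame_range(1)[of q] lev_eq(2)[of q]] unfolding col lev_eq(1) box_lev_idx by blast
  have "upper_triangular g"
    using vq by (auto simp: upper_triangular_def column_def not_le[symmetric])
  then have "det g \<noteq> 0"
    using vqq by (simp add: det_upper_triangular column_def)
  moreover have "Y ** g = g ** X0"
    unfolding conj_X0_iff
  proof
    fix q
    show "Y *v column q g = (if lev q = 0 then 0 else column (box (lev q - 1) (idx q)) g)"
    proof (cases "lev q = 0")
      case True
      have *: "Y $ r $ s * column q g $ s = 0" for r s
      proof (rule ccontr)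
        assume "Y $ r $ s * column q g $ s \<noteq> 0"
        then have "(r, s) \<in> Phi" "s \<le> q"
          using Y vq by (auto simp: min_ideal_iff)
        then have "(r, q) \<in> Phi"
          using Phi_mono by blast
        then show False
          using True by (simp add: Phi_def)
      qed
      have "(Y *v column q g) $ r = 0" for r
        unfolding matrix_vector_mult_def by (simp only: vec_lambda_beta * sum.neutral_const)
      then show ?thesis
        using True by (simp add: vec_eq_iff)
    next
      case False
      have "Y *v column q g = v (idx q) (Suc (lam ! idx q - 1 - lev q))"
        unfolding col by (simp add: v_def)
      also have "Suc (lam ! idx q - 1 - lev q) = lam ! idx q - 1 - (lev q - 1)"
        using frame_range(2)[of q] False by simp
      finally show ?thesis
        using False frame_range[of q] by (simp add: col)
    qed
  qed
  ultimately show ?thesis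
    unfolding has_jordan_type_iff by blast
qed

text \<open>On the line through \<open>x\<close> in direction \<open>X0\<close>, all but finitely
  many points have non-zero entries where \<open>X0\<close> does, hence lie in the orbit;
  \<open>x\<close> is a limit of such points.\<close>

lemma saturation_subset_closure:
  assumes g: "det g = 1" and x: "x \<in> min_ideal"
  shows "Ad g x \<in> closure (orbit_of_type lam)"
proof -
  \<comment> \<open>For real \<open>t\<close> and an entry 1 of \<open>X0\<close>, the entry of
    \<open>x + t X0\<close> can vanish only if \<open>t\<close> is minus the real part of that of
    \<open>x\<close>.\<close>
  define F where "F = range (\<lambda>(p, q). - Re (x $ p $ q))"
  let ?f = "\<lambda>t :: real. conj_by g (x + t *\<^sub>R X0)"
  have det: "det g \<noteq> 0"
    using g by simp
  have "?f t \<in> orbit_of_type lam" if t: "t \<in> - F" for t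
  proof -
    have "x + t *\<^sub>R X0 \<in> min_ideal"
      unfolding min_ideal_iff
    proof (intro allI impI)
      fix p q assume "(x + t *\<^sub>R X0) $ p $ q \<noteq> 0"
      then have "x $ p $ q \<noteq> 0 \<or> X0 $ p $ q \<noteq> 0"
        by auto
      then show "(p, q) \<in> Phi"
        using x X0_min_ideal unfolding min_ideal_iff by blast
    qed
    moreover have "(x + t *\<^sub>R X0) $ p $ q \<noteq> 0" if "X0 $ p $ q \<noteq> 0" for p q
    proof
      assume 0: "(x + t *\<^sub>R X0) $ p $ q = 0"
      have "X0 $ p $ q = 1"
        using that by (simp add: X0_nth split: if_splits)
      moreover have "x $ p $ q + t *\<^sub>R X0 $ p $ q = 0"
        using 0 by simp
      ultimately have "Re (x $ p $ q) + t = 0"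
        by (metis Re_complex_of_real plus_complex.sel(1) scaleR_conv_of_real mult.right_neutral
            zero_complex.sel(1))
      then have "t = - Re (x $ p $ q)"
        by simp
      then have "t \<in> F"
        by (auto simp: F_def)
      with t show False
        by simp
    qed
    ultimately have "has_jordan_type (x + t *\<^sub>R X0) lam"
      by (rule generic_jordan_type)
    then show ?thesis
      using jordan_type_conj[OF _ det] by (simp add: orbit_of_type_def)
  qed
  then have "?f ` (- F) \<subseteq> closure (orbit_of_type lam)"
    using closure_subset[of "orbit_of_type lam :: 'n sqmat set"] by blast
  then have "?f ` closure (- F) \<subseteq> closure (orbit_of_type lam)"
    by (intro image_closure_subset continuous_intros closed_closure)
  moreover have "closure (- F) = UNIV"
    by (simp add: closure_complement F_def empty_interior_finite)
  ultimately have "?f 0 \<in> closure (orbit_of_type lam)"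
    by blast
  then show ?thesis
    by (simp add: Ad_def)
qed

theorem associated_orbit_min_ideal: "has_associated_orbit min_ideal (orbit_of_type lam)"
  unfolding has_associated_orbit_def
proof (intro conjI equalityI)
  show "nilpotent_orbit (orbit_of_type lam :: 'n sqmat set)"
    by (rule nilpotent_orbit_of_type)
  show "closure (orbit_of_type lam) \<subseteq> {Ad g x | g x. g \<in> carrier SLn \<and> x \<in> min_ideal}"
  proof (rule closure_minimal[OF _ closed_saturation_min_ideal])
    show "orbit_of_type lam \<subseteq> {Ad g x | g x. g \<in> carrier SLn \<and> x \<in> min_ideal}"
      unfolding orbit_of_type_eq using X0_min_ideal by blast
  qed
  show "{Ad g x | g x. g \<in> carrier SLn \<and> x \<in> min_ideal} \<subseteq> closure (orbit_of_type lam)"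
    using saturation_subset_closure by auto
qed

end

subsection \<open>The dimension formula\<close>

context jordan_frame
begin

text \<open>Once the blocks \<open>i\<close> and \<open>k\<close> are fixed, only the level
  \<open>a\<close> of the first box is free, with \<open>a < lam ! i\<close> and
  \<open>a + d < lam ! k\<close>. Truncated subtraction gives 0 for a block shorter than
  \<open>d\<close>.\<close>

lemma card_shift:
  "card {(p, q). lev q = lev p + d \<and> Q (idx p) (idx q)} =
    (\<Sum>(i, k) | i < length lam \<and> k < length lam \<and> Q i k. min (lam ! i) (lam ! k - d))"
proof -
  let ?S = "{(i, k). i < length lam \<and> k < length lam \<and> Q i k}"
  let ?A = "\<lambda>(i, k). {a. a < lam ! i \<and> a + d < lam ! k}"
  let ?f = "\<lambda>((i, k), a). (box a i, box (a + d) k)"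
  have finS: "finite ?S"
    by (rule finite_subset[of _ "{..<length lam} \<times> {..<length lam}"]) auto
  have finA: "finite (?A x)" for x
    by (cases x) auto
  have "{(p, q). lev q = lev p + d \<and> Q (idx p) (idx q)} = ?f ` (Sigma ?S ?A)"
  proof (intro equalityI subsetI)
    fix x assume "x \<in> {(p, q). lev q = lev p + d \<and> Q (idx p) (idx q)}"
    then obtain p q where x: "x = (p, q)" "lev q = lev p + d" "Q (idx p) (idx q)"
      by blast
    then have "x = ?f ((idx p, idx q), lev p)"
      using box_lev_idx[of q] by simp
    moreover have "((idx p, idx q), lev p) \<in> Sigma ?S ?A"
      using frame_range[of p] frame_range[of q] x by simp
    ultimately show "x \<in> ?f ` (Sigma ?S ?A)"
      by blast
  qed auto
  moreover have "inj_on ?f (Sigma ?S ?A)"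
  proof (rule inj_onI)
    fix x y assume xy: "x \<in> Sigma ?S ?A" "y \<in> Sigma ?S ?A" "?f x = ?f y"
    obtain i k a where x: "x = ((i, k), a)" "i < length lam" "k < length lam" "a < lam ! i" "a + d < lam ! k"
      using xy(1) by auto
    obtain i' k' a' where y: "y = ((i', k'), a')" "i' < length lam" "k' < length lam"
      "a' < lam ! i'" "a' + d < lam ! k'"
      using xy(2) by auto
    have "box a i = box a' i'" "box (a + d) k = box (a' + d) k'"
      using xy(3) x(1) y(1) by auto
    then have "lev (box a i) = lev (box a' i')" "idx (box a i) = idx (box a' i')"
      "idx (box (a + d) k) = idx (box (a' + d) k')"
      by simp_all
    then show "x = y"
      using x y by simp
  qed
  ultimately have "card {(p, q). lev q = lev p + d \<and> Q (idx p) (idx q)} = card (Sigma ?S ?A)"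
    by (simp add: card_image)
  also have "\<dots> = (\<Sum>x\<in>?S. card (?A x))"
    using finS finA by (intro card_SigmaI) auto
  also have "\<dots> = (\<Sum>(i, k)\<in>?S. min (lam ! i) (lam ! k - d))"
  proof (intro sum.cong refl, clarify)
    fix i k
    have "{a. a < lam ! i \<and> a + d < lam ! k} = {..<min (lam ! i) (lam ! k - d)}"
      by auto
    then show "card {a. a < lam ! i \<and> a + d < lam ! k} = min (lam ! i) (lam ! k - d)"
      by simp
  qed
  finally show ?thesis .
qed

text \<open>Unordered pairs of distinct blocks of equal size; their number is the last sum of the
  formula.\<close>

definition coinc :: "(nat \<times> nat) set" where
  "coinc = {(i, k). k < i \<and> i < length lam \<and> lam ! i = lam ! k}"

text \<open>The pairs \<open>p \<le> q\<close> outside \<open>Phi\<close> lie on one level, or on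
  consecutive levels with \<open>q\<close> in an earlier block. With \<open>k < i\<close> the latter
  contribute \<open>min (lam ! i) (lam ! k - 1)\<close>, short of
  \<open>min (lam ! i) (lam ! k)\<close> by 1 exactly for equal parts. Doubling keeps the identity
  in the natural numbers.\<close>

lemma card_Phi:
  "CARD('n) * (CARD('n) + 1) + 2 * card coinc =
    2 * card Phi + 2 * (\<Sum>i<length lam. \<Sum>k<length lam. min (lam ! i) (lam ! k))"
proof -
  let ?N = "length lam"
  let ?U = "{(p, q). p \<le> (q :: 'n)}"
  let ?B = "{(p, q). lev q = lev p + 0 \<and> idx p \<le> idx q}"
  let ?C = "{(p, q). lev q = lev p + 1 \<and> idx q < idx p}"
  let ?L = "{(i, k). i < ?N \<and> k < ?N \<and> i \<le> k}" and ?G = "{(i, k). i < ?N \<and> k < ?N \<and> k < i}"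
  have fin: "finite ?L" "finite ?G"
    by (rule finite_subset[of _ "{..<?N} \<times> {..<?N}"]; auto)+
  have "?U = Phi \<union> (?B \<union> ?C)"
    by (auto simp: le_iff Phi_def)
  moreover have "card (Phi \<union> (?B \<union> ?C)) = card Phi + card (?B \<union> ?C)"
    by (rule card_Un_disjoint) (auto simp: Phi_def)
  moreover have "card (?B \<union> ?C) = card ?B + card ?C"
    by (rule card_Un_disjoint) auto
  moreover have "card ?B = (\<Sum>(i, k)\<in>?L. min (lam ! i) (lam ! k))"
    using card_shift[of 0 "\<lambda>i k. i \<le> k"] by simp
  moreover have "card ?C + card coinc = (\<Sum>(i, k)\<in>?G. min (lam ! i) (lam ! k))"
  proof -
    have "card coinc = (\<Sum>(i, k)\<in>?G. if lam ! i = lam ! k then 1 else 0)"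
    proof -
      have "coinc = {x \<in> ?G. lam ! fst x = lam ! snd x}"
        by (auto simp: coinc_def)
      then have "card coinc = (\<Sum>x\<in>?G. if lam ! fst x = lam ! snd x then 1 else 0)"
        using fin(2) by (simp add: sum.If_cases Int_def)
      then show ?thesis
        by (simp add: case_prod_unfold)
    qed
    moreover have "card ?C = (\<Sum>(i, k)\<in>?G. min (lam ! i) (lam ! k - 1))"
      using card_shift[of 1 "\<lambda>i k. k < i"] by simp
    ultimately have "card ?C + card coinc =
        (\<Sum>(i, k)\<in>?G. min (lam ! i) (lam ! k - 1) + (if lam ! i = lam ! k then 1 else 0))"
      by (simp add: sum.distrib[symmetric] case_prod_unfold)
    also have "\<dots> = (\<Sum>(i, k)\<in>?G. min (lam ! i) (lam ! k))"
    proof (intro sum.cong refl, clarify)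
      fix i k assume ik: "i < ?N" "k < ?N" "k < i"
      then have "lam ! i \<le> lam ! k" "0 < lam ! i"
        using lam_antimono[of k i] lam_nth_pos by auto
      then show "min (lam ! i) (lam ! k - 1) + (if lam ! i = lam ! k then 1 else 0) =
          min (lam ! i) (lam ! k)"
        by auto
    qed
    finally show ?thesis .
  qed
  moreover have "(\<Sum>i<?N. \<Sum>k<?N. min (lam ! i) (lam ! k)) =
      (\<Sum>(i, k)\<in>?L. min (lam ! i) (lam ! k)) + (\<Sum>(i, k)\<in>?G. min (lam ! i) (lam ! k))"
  proof -
    have "(\<Sum>i<?N. \<Sum>k<?N. min (lam ! i) (lam ! k)) =
        (\<Sum>(i, k)\<in>{..<?N} \<times> {..<?N}. min (lam ! i) (lam ! k))"
      by (rule sum.cartesian_product)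
    also have "{..<?N} \<times> {..<?N} = ?L \<union> ?G"
      by auto
    also have "(\<Sum>(i, k)\<in>?L \<union> ?G. min (lam ! i) (lam ! k)) =
        (\<Sum>(i, k)\<in>?L. min (lam ! i) (lam ! k)) + (\<Sum>(i, k)\<in>?G. min (lam ! i) (lam ! k))"
      by (rule sum.union_disjoint[OF fin]) auto
    finally show ?thesis .
  qed
  ultimately show ?thesis
    using card_upper_pairs[where 'n = 'n] by (simp add: algebra_simps)
qed

end

text \<open>Coding the box at level \<open>j\<close> of block \<open>i\<close> as
  \<open>j * ?N + i\<close> makes the lexicographic order numerical; the increasing enumeration of
  the codes is matched with the positions of the indices.\<close>

lemma exists_jordan_frame:
  assumes n: "CARD('n::{finite,linorder}) = n" and lam: "is_partition lam n"
  obtains lev idx :: "'n::{finite,linorder} \<Rightarrow> nat" where "jordan_frame lam lev idx"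
proof -
  let ?N = "length lam"
  let ?J = "{(j, i). i < ?N \<and> j < lam ! i}"
  define code where "code = (\<lambda>(j, i). j * ?N + i)"
  have decode: "code (j, i) div ?N = j" "code (j, i) mod ?N = i" if "i < ?N" for i j
  proof -
    have "?N \<noteq> 0"
      using that by linarith
    then show "code (j, i) div ?N = j" "code (j, i) mod ?N = i"
      using that by (simp_all add: code_def)
  qed
  have J: "?J = (\<lambda>(i, j). (j, i)) ` (SIGMA i:{..<?N}. {..<lam ! i})"
    by (auto simp: image_iff)
  have "card ?J = card (SIGMA i:{..<?N}. {..<lam ! i})"
    unfolding J by (rule card_image) (auto simp: inj_on_def)
  also have "\<dots> = (\<Sum>i<?N. lam ! i)"
    by simp
  also have "\<dots> = n"
    using lam by (simp add: is_partition_def sum_list_sum_nth atLeast0LessThan)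
  finally have cardJ: "card ?J = n" .
  have finJ: "finite ?J"
    unfolding J by simp
  have injc: "inj_on code ?J"
  proof (rule inj_onI)
    fix x y assume xy: "x \<in> ?J" "y \<in> ?J" "code x = code y"
    then have "code x div ?N = code y div ?N" "code x mod ?N = code y mod ?N"
      by simp_all
    then show "x = y"
      using xy(1,2) by (auto simp: decode)
  qed
  have cardM: "card (code ` ?J) = n"
    using cardJ card_image[OF injc] by simp
  obtain h where h: "bij_betw h {..<card (code ` ?J)} (code ` ?J)"
    "strict_mono_on {..<card (code ` ?J)} h"
    using ex_bij_betw_strict_mono_card[of "code ` ?J"] finJ by auto
  have height: "bij_betw (height :: 'n \<Rightarrow> nat) UNIV {..<n}"
  proof -
    have "inj (height :: 'n \<Rightarrow> nat)"
      by (rule linorder_injI) (metis height_strict_mono less_irrefl)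
    moreover have "range (height :: 'n \<Rightarrow> nat) = {..<n}"
      using height_less_card calculation n by (intro card_subset_eq) (auto simp: card_image)
    ultimately show ?thesis
      by (simp add: bij_betw_def)
  qed
  define c where "c p = h (height (p :: 'n))" for p
  define lev where "lev p = c p div ?N" for p
  define idx where "idx p = c p mod ?N" for p
  have c_bij: "bij_betw c UNIV (code ` ?J)"
    unfolding c_def using bij_betw_trans[OF height] h(1) cardM by (simp add: comp_def)
  have pos: "bij_betw (\<lambda>p. (lev p, idx p)) UNIV ?J"
  proof -
    have "bij_betw (\<lambda>x. (x div ?N, x mod ?N)) (code ` ?J) ?J"
      by (rule bij_betw_byWitness[where f' = code]) (auto simp: decode)
    then have "bij_betw ((\<lambda>x. (x div ?N, x mod ?N)) \<circ> c) UNIV ?J"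
      by (rule bij_betw_trans[OF c_bij])
    then show ?thesis
      by (simp add: comp_def lev_def idx_def)
  qed
  have le: "p \<le> q \<longleftrightarrow> lev p < lev q \<or> lev p = lev q \<and> idx p \<le> idx q" for p q
  proof -
    have "height p < n" "height q < n"
      using height_less_card[of p] height_less_card[of q] n by auto
    then have "p \<le> q \<longleftrightarrow> c p \<le> c q"
      unfolding c_def height_le[of p q] using strict_mono_on_leD[OF h(2)] strict_mono_onD[OF h(2)] cardM
      by (metis lessThan_iff not_le)
    also have "\<dots> \<longleftrightarrow> lev p < lev q \<or> lev p = lev q \<and> idx p \<le> idx q"
    proof (cases "lev p = lev q")
      case True
      then show ?thesis
        using div_mult_mod_eq[of "c p" ?N] div_mult_mod_eq[of "c q" ?N]
        unfolding lev_def idx_def by (metis nat_add_left_cancel_le less_irrefl)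
    next
      case False
      then show ?thesis
        using div_le_mono[of "c p" "c q" ?N] div_le_mono[of "c q" "c p" ?N]
        unfolding lev_def by linarith
    qed
    finally show ?thesis .
  qed
  have "jordan_frame lam lev idx"
    using lam pos le by unfold_locales (auto simp: is_partition_def)
  then show thesis
    by (rule that)
qed

section \<open>Counting eigenvalues of the Dynkin element\<close>

lemma dynkin_count_eq:
  "dynkin_count lam l = (\<Sum>k<length lam. card {j. j < lam ! k \<and> int (lam ! k) - 1 - 2 * int j \<le> l})"
proof -
  let ?f = "\<lambda>a. map (\<lambda>j. int a - 1 - 2 * int j) [0..<a]"
  have "dynkin_count lam l = length (filter (\<lambda>x. x \<le> l) (dynkin_diag lam))"
    by (simp add: dynkin_count_def length_filter_conv_card)
  also have "\<dots> = size (filter_mset (\<lambda>x. x \<le> l) (mset (dynkin_diag lam)))"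
    unfolding mset_filter[symmetric] size_mset ..
  also have "mset (dynkin_diag lam) = mset (concat (map ?f lam))"
    by (simp add: dynkin_diag_def)
  also have "size (filter_mset (\<lambda>x. x \<le> l) (mset (concat (map ?f lam)))) =
      length (filter (\<lambda>x. x \<le> l) (concat (map ?f lam)))"
    unfolding mset_filter[symmetric] size_mset ..
  also have "\<dots> = sum_list (map (\<lambda>a. length (filter (\<lambda>x. x \<le> l) (?f a))) lam)"
    by (simp add: filter_concat length_concat comp_def)
  also have "\<dots> = (\<Sum>k<length lam. length (filter (\<lambda>x. x \<le> l) (?f (lam ! k))))"
    by (simp add: sum_list_sum_nth atLeast0LessThan)
  also have "\<dots> = (\<Sum>k<length lam. card {j. j < lam ! k \<and> int (lam ! k) - 1 - 2 * int j \<le> l})"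
    by (intro sum.cong refl) (auto simp: length_filter_conv_card intro!: arg_cong[of _ _ card])
  finally show ?thesis .
qed

text \<open>The window from \<open>-b\<close> to \<open>b - 1\<close> holds \<open>b\<close>
  integers of each parity. If \<open>b < a\<close>, those of the parity of \<open>a - 1\<close> all
  belong to the string; otherwise the window contains the whole string.\<close>

lemma card_string_interval:
  "card {j. j < a \<and> int a - 1 - 2 * int j \<le> int b - 1} =
    card {j. j < a \<and> int a - 1 - 2 * int j \<le> - int b - 1} + min a b"
proof -
  let ?S = "{j. j < a \<and> int a - 1 - 2 * int j \<le> int b - 1}"
  let ?T = "{j. j < a \<and> int a - 1 - 2 * int j \<le> - int b - 1}"
  let ?D = "{j. j < a \<and> a \<le> 2 * j + b \<and> 2 * j < a + b}"
  have "?S = ?T \<union> ?D"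
    by auto
  moreover have "card (?T \<union> ?D) = card ?T + card ?D"
    by (rule card_Un_disjoint) auto
  moreover have "card ?D = min a b"
  proof (cases "a \<le> b")
    case True
    then have "?D = {..<a}"
      by auto
    then show ?thesis
      using True by simp
  next
    case False
    then have "?D = {(a - b + 1) div 2..<(a - b + 1) div 2 + b}"
      by auto
    then show ?thesis
      using False by simp
  qed
  ultimately show ?thesis
    by simp
qed

lemma dynkin_count_diff:
  "dynkin_count lam (int b - 1) = dynkin_count lam (- int b - 1) + (\<Sum>k<length lam. min (lam ! k) b)"
  unfolding dynkin_count_eq card_string_interval sum.distrib ..

lemma sum_dynkin_count:
  assumes "length lam \<le> n"
  shows "(\<Sum>i = 1..n. - real (dynkin_count lam (int (part lam i) - 1))
      + real (dynkin_count lam (- int (part lam i) - 1))) =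
    - real (\<Sum>i<length lam. \<Sum>k<length lam. min (lam ! i) (lam ! k))"
proof -
  let ?m = "\<lambda>b. \<Sum>k<length lam. min (lam ! k) b"
  have "(\<Sum>i = 1..n. - real (dynkin_count lam (int (part lam i) - 1))
      + real (dynkin_count lam (- int (part lam i) - 1))) = (\<Sum>i = 1..n. - real (?m (part lam i)))"
    by (simp add: dynkin_count_diff)
  also have "\<dots> = (\<Sum>i<n. - real (?m (part lam (Suc i))))"
    by (simp add: sum.atLeast1_atMost_eq)
  \<comment> \<open>Beyond the last part \<open>part\<close> is 0, and so is every minimum with
    it.\<close>
  also have "\<dots> = (\<Sum>i<length lam. - real (?m (part lam (Suc i))))"
    using assms by (intro sum.mono_neutral_right) (auto simp: part_def)
  also have "\<dots> = (\<Sum>i<length lam. - real (?m (lam ! i)))"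
    by (intro sum.cong) (auto simp: part_def)
  also have "\<dots> = - real (\<Sum>i<length lam. \<Sum>k<length lam. min (lam ! i) (lam ! k))"
    by (simp add: sum_negf min.commute)
  finally show ?thesis .
qed

text \<open>The squares of the multiplicities count all pairs of positions with equal parts: those
  below, above and on the diagonal, the first two being equally many.\<close>

lemma sum_multiplicity_pairs:
  "(\<Sum>t\<in>set lam. real (count_list lam t) * (real (count_list lam t) - 1) / 2) =
    real (card {(i, k). k < i \<and> i < length lam \<and> lam ! i = lam ! k})"
proof -
  let ?N = "length lam"
  let ?A = "\<lambda>t. {i. i < ?N \<and> lam ! i = t}"
  let ?E = "{(i, k). k < i \<and> i < ?N \<and> lam ! i = lam ! k}"
  let ?E' = "{(i, k). i < k \<and> k < ?N \<and> lam ! i = lam ! k}"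
  let ?D = "(\<lambda>i. (i, i)) ` {..<?N}"
  have count: "count_list lam t = card (?A t)" for t
    by (simp add: count_list_eq_length_filter length_filter_conv_card eq_commute)
  have finE: "finite ?E" and finE': "finite ?E'"
    by (rule finite_subset[of _ "{..<?N} \<times> {..<?N}"]; auto)+
  have "(\<Sum>t\<in>set lam. count_list lam t * count_list lam t) = card (\<Union>t\<in>set lam. ?A t \<times> ?A t)"
    by (subst card_UN_disjoint) (auto simp: card_cartesian_product count)
  also have "(\<Union>t\<in>set lam. ?A t \<times> ?A t) = ?E \<union> (?E' \<union> ?D)"
    by (auto simp: neq_iff)
  also have "card \<dots> = card ?E + (card ?E' + card ?D)"
    using finE finE' by (subst card_Un_disjoint, auto)+
  also have "card ?E' = card ?E"
  proof -
    have "?E' = prod.swap ` ?E"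
      by (auto simp: image_iff)
    then show ?thesis
      by (simp add: card_image)
  qed
  also have "card ?D = ?N"
    by (subst card_image) (auto simp: inj_on_def)
  finally have sq: "(\<Sum>t\<in>set lam. count_list lam t * count_list lam t) = 2 * card ?E + ?N"
    by simp
  have "(\<Sum>t\<in>set lam. count_list lam t) = ?N"
    by (rule sum_count_set) auto
  then have lin: "(\<Sum>t\<in>set lam. real (count_list lam t)) = real ?N"
    by (metis of_nat_sum)
  have "(\<Sum>t\<in>set lam. real (count_list lam t) * real (count_list lam t)) = 2 * real (card ?E) + real ?N"
    using arg_cong[OF sq, of real] by simp
  with lin show ?thesis
    by (simp add: algebra_simps sum_subtractf flip: sum_divide_distrib)
qed

theorem proposition4p1:
  fixes lam :: "nat list" and n :: nat
  assumes "n = CARD('n::{finite,linorder})"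
    and "is_partition lam n"
  shows "let \<O> = (orbit_of_type lam :: 'n sqmat set);
             A = (\<lambda>l. real (dynkin_count lam l));
             m = real n * (real n + 1) / 2
               + (\<Sum>i = 1..n. - A (int (part lam i) - 1) + A (- int (part lam i) - 1))
               + (\<Sum>t \<in> set lam. real (count_list lam t) * (real (count_list lam t) - 1) / 2)
         in real_of_int (m_orbit \<O>) = m \<and>
            (\<exists>I. ad_nilpotent_ideal I \<and> has_associated_orbit I \<O> \<and> real (cmat.dim I) = m) \<and>
            (\<forall>I. ad_nilpotent_ideal I \<and> has_associated_orbit I \<O> \<longrightarrow> m \<le> real (cmat.dim I))"
proof -
  obtain lev idx :: "'n \<Rightarrow> nat" where "jordan_frame lam lev idx"
    using exists_jordan_frame[OF assms(1)[symmetric] assms(2)] by blast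
  then interpret jordan_frame lam lev idx .
  \<comment> \<open>Parts are at least 1, so the sum from 1 to \<open>n\<close> reaches all of
    them.\<close>
  have len: "length lam \<le> n"
  proof -
    have "length lam = (\<Sum>l\<leftarrow>lam. 1)"
      by (simp add: sum_list_triv)
    also have "\<dots> \<le> (\<Sum>l\<leftarrow>lam. l)"
      using lam_pos by (intro sum_list_mono) (simp add: Suc_le_eq)
    also have "\<dots> = n"
      using assms(2) by (simp add: is_partition_def)
    finally show ?thesis .
  qed
  define m where "m = real n * (real n + 1) / 2
      + (\<Sum>i = 1..n. - real (dynkin_count lam (int (part lam i) - 1))
         + real (dynkin_count lam (- int (part lam i) - 1)))
      + (\<Sum>t\<in>set lam. real (count_list lam t) * (real (count_list lam t) - 1) / 2)"
  have "real (card Phi) = m"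
  proof -
    have "real (n * (n + 1) + 2 * card coinc) =
        real (2 * card Phi + 2 * (\<Sum>i<length lam. \<Sum>k<length lam. min (lam ! i) (lam ! k)))"
      using card_Phi unfolding assms(1) by simp
    then have "real n * (real n + 1) + 2 * real (card coinc) = 2 * real (card Phi)
        + 2 * real (\<Sum>i<length lam. \<Sum>k<length lam. min (lam ! i) (lam ! k))"
      by (simp only: of_nat_add of_nat_mult of_nat_1 of_nat_numeral)
    then show ?thesis
      unfolding m_def sum_dynkin_count[OF len] sum_multiplicity_pairs coinc_def[symmetric]
      by (simp add: field_simps)
  qed
  moreover have "cmat.dim min_ideal = card Phi"
    by (simp add: min_ideal_def dim_coord_space)
  ultimately show ?thesis
    unfolding Let_def m_def[symmetric]
    using m_orbit_eq ad_nilpotent_min_ideal associated_orbit_min_ideal ideal_dim_ge by auto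
qed

end
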